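(* Let $f:\mathbb{R}^{n_1\times\cdots\times n_d}\to\mathbb{R}$ be continuously differentiable with locally Lipschitz continuous gradient, bounded below by $f^*\in\mathbb{R}$ on $\mathcal{M}_{\leq\mathbf{r}}$, and such that the sublevel set $\{\mathcal{X}\in\mathcal{M}_{\leq\mathbf{r}}:f(\mathcal{X})\leq f(\mathcal{X}^{(0)})\}$ is compact. Let $\{\mathcal{X}^{(t)}\}$ be a sequence generated by the rfGRAP-R method from the initial guess $\mathcal{X}^{(0)}\in\mathcal{M}_{\leq\mathbf{r}}$. If $\{\mathcal{X}^{(t)}\}$ is finite, the method terminates at a stationary point of $f$ on $\mathcal{M}_{\leq\mathbf{r}}$. Otherwise, $\{\mathcal{X}^{(t)}\}$ has an accumulation point, and any accumulation point of $\{\mathcal{X}^{(t)}\}$ is stationary.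
   Context: Notation. $d,n_1,\dots,n_d$ are positive integers, $[d]=\{1,\dots,d\}$, $n_{-k}=\prod_{i\ne k}n_i$, and $\mathbf{r}=(r_1,\dots,r_d)$ are positive integers with $r_k\le\min\{n_k,n_{-k}\}$. The mode-$k$ unfolding $\mathbf{X}_{(k)}\in\mathbb{R}^{n_k\times n_{-k}}$ of $\mathcal{X}$ has the mode-$k$ fibers as columns; $\mathrm{ten}_{(k)}$ is the inverse of mode-$k$ unfolding; $(\mathcal{X}\times_k\mathbf{A})_{(k)}=\mathbf{A}\mathbf{X}_{(k)}$ defines the $k$-mode product. $\langle\cdot,\cdot\rangle$, $\|\cdot\|_{\mathrm{F}}$ are the entrywise inner product and Frobenius norm. $\mathrm{St}(r,n)=\{\mathbf{X}\in\mathbb{R}^{n\times r}:\mathbf{X}^\top\mathbf{X}=\mathbf{I}_r\}$; for $\mathbf{S}$ with orthonormal columns, $\mathrm{P}_{\mathbf{S}}=\mathbf{S}\mathbf{S}^\top$, $\mathrm{P}_{\mathbf{S}}^\perp=\mathbf{I}-\mathbf{S}\mathbf{S}^\top$. Tucker rank: $\mathrm{rank}_{\mathrm{tc}}(\mathcal{X})=(\mathrm{rank}(\mathbf{X}_{(k)}))_{k=1}^d$; $\mathcal{M}_{\leq\mathbf{r}}=\{\mathcal{X}:\mathrm{rank}_{\mathrm{tc}}(\mathcal{X})\leq\mathbf{r}\}$. A tensor of Tucker rank $\underline{\mathbf{r}}$ has a Tucker decomposition $\mathcal{X}=\mathcal{G}\times_{k=1}^d\mathbf{U}_k$, $\mathcal{G}\in\mathbb{R}^{\underline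 r_1\times\cdots\times\underline r_d}$, $\mathbf{U}_k\in\mathrm{St}(\underline r_k,n_k)$ (empty if $\underline r_k=0$), and $\mathbf{G}_{(k)}^\dagger=\mathbf{G}_{(k)}^\top(\mathbf{G}_{(k)}\mathbf{G}_{(k)}^\top)^{-1}$. $\sigma_{\min}$ of a matrix is its smallest nonzero singular value. Stationarity. $\mathcal{X}\in\mathcal{M}_{\leq\mathbf{r}}$ is stationary if $\|\mathrm{P}_{\mathrm{T}_{\mathcal{X}}\mathcal{M}_{\leq\mathbf{r}}}(-\nabla f(\mathcal{X}))\|_{\mathrm{F}}=0$, where $\mathrm{T}_{\mathcal{X}}\mathcal{M}_{\leq\mathbf{r}}$ is the Bouligand tangent cone and $\mathrm{P}$ the metric projection onto it. HOSVD. For $\mathbf{s}=(s_1,\dots,s_d)$, $\mathrm{P}_{\leq\mathbf{s}}^{\mathrm{HO}}(\mathcal{A})=\mathrm{P}_{\leq s_d}^d(\cdots(\mathrm{P}_{\leq s_1}^1(\mathcal{A})))$, where $\mathrm{P}_{\leq s}^k(\mathcal{A})=\mathrm{ten}_{(k)}(\mathrm{P}_{\leq s}(\mathbf{A}_{(k)}))$ and $\mathrm{P}_{\leq s}(\mathbf{A})$ is a best Frobenius-norm approximation of $\mathbf{A}$ of rank at most $s$ (truncated SVD). Partial projection. For $\mathcal{X}=\mathcal{G}\times_{k=1}^d\mathbf{U}_k$ of Tucker rank $\underline{\mathbf{r}}\leq\mathbf{r}$, $I=\{k:\underline r_k<r_k\}$, and a tensor $\mathcal{A}$, choose $\tilde{\mathbf{U}}_{k,1}\in\mathrm{St}(r_k-\underline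 r_k,n_k)$, $k\in I$, with $\mathbf{U}_k^\top\tilde{\mathbf{U}}_{k,1}=0$ and $\|\mathcal{A}\times_{k\in I}\mathrm{P}_{[\mathbf{U}_k\ \tilde{\mathbf{U}}_{k,1}]}\times_{k\notin I}\mathrm{P}_{\mathbf{U}_k}\|_{\mathrm{F}}\geq\|\mathcal{A}\times_{k\notin I}\mathrm{P}_{\mathbf{U}_k}\|_{\mathrm{F}}\prod_{k\in I}\sqrt{(r_k-\underline r_k)/\min\{n_k,n_{-k}\}}$ (possible via SVD). With $\tilde{\mathbf{S}}_k=[\mathbf{U}_k\ \tilde{\mathbf{U}}_{k,1}]$ for $k\in I$ and $\tilde{\mathbf{S}}_k=\mathbf{U}_k$ otherwise, let $\tilde{\mathrm{P}}_0(\mathcal{A})=\mathcal{A}\times_{k=1}^d\mathrm{P}_{\tilde{\mathbf{S}}_k}$ and $\mathrm{P}_k(\mathcal{A})=\mathcal{G}\times_k(\mathrm{P}_{\mathbf{U}_k}^\perp(\mathcal{A}\times_{j\neq k}\mathbf{U}_j^\top)_{(k)}\mathbf{G}_{(k)}^\dagger)\times_{j\neq k}\mathbf{U}_j$ for $k\in[d]$. Then $\hat{\mathrm{P}}_{\mathrm{T}_{\mathcal{X}}\mathcal{M}_{\leq\mathbf{r}}}(\mathcal{A})$ is an element of largest Frobenius norm in $\{\tilde{\mathrm{P}}_0(\mathcal{A}),\mathrm{P}_1(\mathcal{A}),\dots,\mathrm{P}_d(\mathcal{A})\}$. One has $\mathcal{X}+s\,\hat{\mathrm{P}}_{\mathrm{T}_{\mathcal{X}}\mathcal{M}_{\leq\mathbf{r}}}(\mathcal{A})\in\mathcal{M}_{\leq\mathbf{r}}$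 for $s\ge 0$. Armijo backtracking. Fix $\bar s>0$ and $\rho,a\in(0,1)$. For $\mathcal{X}\in\mathcal{M}_{\leq\mathbf{r}}$ and $\mathcal{V}\in\mathrm{T}_{\mathcal{X}}\mathcal{M}_{\leq\mathbf{r}}$, the stepsize is $s=\rho^l\bar s$ with the smallest integer $l\geq0$ such that $f(\mathcal{X})-f(\mathrm{P}_{\leq\mathbf{r}}^{\mathrm{HO}}(\mathcal{X}+s\mathcal{V}))\geq s\,a\,\langle-\nabla f(\mathcal{X}),\mathcal{V}\rangle$ (and $\mathrm{P}_{\leq\mathbf{r}}^{\mathrm{HO}}(\mathcal{X}+s\mathcal{V})=\mathcal{X}+s\mathcal{V}$ when $\mathcal{X}+s\mathcal{V}\in\mathcal{M}_{\leq\mathbf{r}}$). rfGRAP-R method. Input $\mathcal{X}^{(0)}\in\mathcal{M}_{\leq\mathbf{r}}$, $\Delta>0$, $\bar s,\rho,a$. At iteration $t$: stop if $\|\hat{\mathrm{P}}_{\mathrm{T}_{\mathcal{X}^{(t)}}\mathcal{M}_{\leq\mathbf{r}}}(-\nabla f(\mathcal{X}^{(t)}))\|_{\mathrm{F}}=0$. Otherwise, for $k\in[d]$ let $I_k=\{\mathrm{rank}(\mathbf{X}_{(k)}^{(t)})-1,\mathrm{rank}(\mathbf{X}_{(k)}^{(t)})\}$ if $\sigma_{\min}(\mathbf{X}_{(k)}^{(t)})\leq\Delta$ and $I_k=\{\mathrm{rank}(\mathbf{X}_{(k)}^{(t)})\}$ otherwise (with $I_k=\{0\}$ if $\mathbf{X}_{(k)}^{(t)}=0$);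 for every $\breve{\mathbf{r}}\in I_1\times\cdots\times I_d$ form $\mathcal{X}_{\breve{\mathbf{r}}}^{(t)}=\mathrm{P}_{\leq\breve{\mathbf{r}}}^{\mathrm{HO}}(\mathcal{X}^{(t)})$ and $\mathcal{Y}_{\breve{\mathbf{r}}}^{(t)}=\mathcal{X}_{\breve{\mathbf{r}}}^{(t)}+s_{\breve{\mathbf{r}}}^{(t)}\hat{\mathcal{V}}$, where $\hat{\mathcal{V}}=\hat{\mathrm{P}}_{\mathrm{T}_{\mathcal{X}_{\breve{\mathbf{r}}}^{(t)}}\mathcal{M}_{\leq\mathbf{r}}}(-\nabla f(\mathcal{X}_{\breve{\mathbf{r}}}^{(t)}))$ and $s_{\breve{\mathbf{r}}}^{(t)}$ is the Armijo stepsize at $\mathcal{X}_{\breve{\mathbf{r}}}^{(t)}$ along $\hat{\mathcal{V}}$. Let $\mathcal{X}^{(t+1)}$ be a point with lowest $f$-value among all $\mathcal{Y}_{\breve{\mathbf{r}}}^{(t)}$. *)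

theory Defs
  imports
    "HOL-Analysis.Analysis"
    "HOL-Library.Poly_Mapping"
    "Jordan_Normal_Form.DL_Rank"
    "Jordan_Normal_Form.Char_Poly"
    "Jordan_Normal_Form.Gauss_Jordan_Elimination"
begin

section \<open>The inner product space of finitely supported functions\<close>

instantiation poly_mapping :: (type, real_vector) real_vector
begin

lift_definition scaleR_poly_mapping :: "real \<Rightarrow> ('a \<Rightarrow>\<^sub>0 'b) \<Rightarrow> 'a \<Rightarrow>\<^sub>0 'b"
  is "\<lambda>c x i. c *\<^sub>R x i"
  by (rule finite_subset[rotated]) auto

instance
  by standard (transfer; simp add: fun_eq_iff algebra_simps)+

end

lemma lookup_scaleR [simp]: "Poly_Mapping.lookup (c *\<^sub>R x) i = c *\<^sub>R Poly_Mapping.lookup x i"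
  by transfer simp

instantiation poly_mapping :: (type, real_inner) real_inner
begin

definition inner_poly_mapping :: "('a \<Rightarrow>\<^sub>0 'b) \<Rightarrow> ('a \<Rightarrow>\<^sub>0 'b) \<Rightarrow> real" where
  "inner_poly_mapping x y =
     (\<Sum>i\<in>Poly_Mapping.keys x. inner (Poly_Mapping.lookup x i) (Poly_Mapping.lookup y i))"

definition norm_poly_mapping :: "('a \<Rightarrow>\<^sub>0 'b) \<Rightarrow> real" where
  "norm_poly_mapping x = sqrt (inner x x)"

definition sgn_poly_mapping :: "('a \<Rightarrow>\<^sub>0 'b) \<Rightarrow> ('a \<Rightarrow>\<^sub>0 'b)" where
  "sgn_poly_mapping x = inverse (norm x) *\<^sub>R x"

definition dist_poly_mapping :: "('a \<Rightarrow>\<^sub>0 'b) \<Rightarrow> ('a \<Rightarrow>\<^sub>0 'b) \<Rightarrow> real" where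
  "dist_poly_mapping x y = norm (x - y)"

definition uniformity_poly_mapping :: "(('a \<Rightarrow>\<^sub>0 'b) \<times> ('a \<Rightarrow>\<^sub>0 'b)) filter" where
  "uniformity_poly_mapping = (INF e\<in>{0<..}. principal {(x, y). dist x y < e})"

definition open_poly_mapping :: "('a \<Rightarrow>\<^sub>0 'b) set \<Rightarrow> bool" where
  "open_poly_mapping U \<longleftrightarrow> (\<forall>x\<in>U. \<forall>\<^sub>F (x', y) in uniformity. x' = x \<longrightarrow> y \<in> U)"

lemma inner_poly_mapping_superset:
  fixes x y :: "'a \<Rightarrow>\<^sub>0 'b"
  assumes "finite K" "Poly_Mapping.keys x \<subseteq> K"
  shows "inner x y = (\<Sum>i\<in>K. inner (Poly_Mapping.lookup x i) (Poly_Mapping.lookup y i))"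
  unfolding inner_poly_mapping_def
  by (rule sum.mono_neutral_left) (use assms in \<open>auto simp: in_keys_iff\<close>)

instance
proof
  fix x y z :: "'a \<Rightarrow>\<^sub>0 'b" and r :: real
  let ?K = "Poly_Mapping.keys x \<union> Poly_Mapping.keys y \<union> Poly_Mapping.keys z"
  have K: "finite ?K" by simp
  have S: "inner u v = (\<Sum>i\<in>?K. inner (Poly_Mapping.lookup u i) (Poly_Mapping.lookup v i))"
    if "Poly_Mapping.keys u \<subseteq> ?K" for u v :: "'a \<Rightarrow>\<^sub>0 'b"
    using inner_poly_mapping_superset[OF K that] .
  have kr: "Poly_Mapping.keys (r *\<^sub>R x) \<subseteq> ?K" by (auto simp: in_keys_iff)
  have ka: "Poly_Mapping.keys (x + y) \<subseteq> ?K"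
    using Poly_Mapping.keys_add[of x y] by blast
  show "inner x y = inner y x" by (subst (1 2) S) (auto simp: inner_commute)
  show "inner (x + y) z = inner x z + inner y z"
    using ka by (subst (1 2 3) S) (auto simp: lookup_add inner_add_left sum.distrib)
  show "inner (r *\<^sub>R x) y = r * inner x y"
    using kr by (subst (1 2) S) (auto simp: sum_distrib_left)
  show "0 \<le> inner x x" by (auto simp: inner_poly_mapping_def intro: sum_nonneg)
  show "inner x x = 0 \<longleftrightarrow> x = 0"
    by (simp add: inner_poly_mapping_def sum_nonneg_eq_0_iff)
       (auto simp: in_keys_iff poly_mapping_eq_iff fun_eq_iff)
  show "norm x = sqrt (inner x x)" by (fact norm_poly_mapping_def)
  show "sgn x = inverse (norm x) *\<^sub>R x" by (fact sgn_poly_mapping_def)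
  show "dist x y = norm (x - y)" by (fact dist_poly_mapping_def)
  show "(uniformity :: (('a \<Rightarrow>\<^sub>0 'b) \<times> ('a \<Rightarrow>\<^sub>0 'b)) filter) =
      (INF e\<in>{0<..}. principal {(x, y). dist x y < e})"
    by (fact uniformity_poly_mapping_def)
  show "open U \<longleftrightarrow> (\<forall>x\<in>U. \<forall>\<^sub>F (x', y) in uniformity. x' = x \<longrightarrow> y \<in> U)"
    for U :: "('a \<Rightarrow>\<^sub>0 'b) set"
    by (fact open_poly_mapping_def)
qed

end

section \<open>Tensors, unfoldings and mode products\<close>

text \<open>
  Tensors of all shapes live in one type. A shape is the list \<open>ns\<close> of the sizes of the modes, so
  the order of the tensor is \<open>length ns\<close>; modes and indices are counted from \<open>0\<close>. The tensors of
  shape \<open>ns\<close> form the finite-dimensional subspace \<open>tspace ns\<close>, on which \<^const>\<open>inner\<close> and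
  \<^const>\<open>norm\<close> are the entrywise inner product and the Frobenius norm.
\<close>

type_synonym tensor = "nat list \<Rightarrow>\<^sub>0 real"

definition midx :: "nat list \<Rightarrow> nat list set" where
  "midx ns = {\<alpha>. list_all2 (<) \<alpha> ns}"

definition tspace :: "nat list \<Rightarrow> tensor set" where
  "tspace ns = {X. Poly_Mapping.keys X \<subseteq> midx ns}"

text \<open>\<open>nminus ns k\<close> is the number of columns of the mode-\<open>k\<close> unfolding. The column of the entry with
  multi-index \<open>\<alpha>\<close> has number \<open>\<Sum>l\<noteq>k. \<alpha>\<^sub>l \<cdot> stride ns k l\<close>, so that the earlier modes vary faster;
  \<open>unidx\<close> is the multi-index of the entry in row \<open>i\<close> and column \<open>j\<close>.\<close>

definition nminus :: "nat list \<Rightarrow> nat \<Rightarrow> nat" where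
  "nminus ns k = (\<Prod>l\<in>{..<length ns} - {k}. ns ! l)"

definition stride :: "nat list \<Rightarrow> nat \<Rightarrow> nat \<Rightarrow> nat" where
  "stride ns k l = (\<Prod>m\<in>{..<l} - {k}. ns ! m)"

definition colidx :: "nat list \<Rightarrow> nat \<Rightarrow> nat list \<Rightarrow> nat" where
  "colidx ns k \<alpha> = (\<Sum>l\<in>{..<length ns} - {k}. \<alpha> ! l * stride ns k l)"

definition unidx :: "nat list \<Rightarrow> nat \<Rightarrow> nat \<Rightarrow> nat \<Rightarrow> nat list" where
  "unidx ns k i j =
     map (\<lambda>l. if l = k then i else (j div stride ns k l) mod (ns ! l)) [0..<length ns]"

definition unfolding_mat :: "nat list \<Rightarrow> nat \<Rightarrow> tensor \<Rightarrow> real mat" where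
  "unfolding_mat ns k X =
     Matrix.mat (ns ! k) (nminus ns k) (\<lambda>(i, j). Poly_Mapping.lookup X (unidx ns k i j))"

definition ten :: "nat list \<Rightarrow> nat \<Rightarrow> real mat \<Rightarrow> tensor" where
  "ten ns k A = (\<Sum>\<alpha>\<in>midx ns. Poly_Mapping.single \<alpha> (A $$ (\<alpha> ! k, colidx ns k \<alpha>)))"

text \<open>\<open>X \<times>\<^sub>k A\<close> for \<open>X\<close> of shape \<open>ns\<close>; the result has shape \<open>ns[k := dim_row A]\<close>.\<close>

definition mode_prod :: "nat list \<Rightarrow> tensor \<Rightarrow> nat \<Rightarrow> real mat \<Rightarrow> tensor" where
  "mode_prod ns X k A = ten (ns[k := dim_row A]) k (A * unfolding_mat ns k X)"

fun mode_prods :: "nat list \<Rightarrow> tensor \<Rightarrow> (nat \<times> real mat) list \<Rightarrow> tensor" where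
  "mode_prods ns X [] = X"
| "mode_prods ns X ((k, A) # ps) = mode_prods (ns[k := dim_row A]) (mode_prod ns X k A) ps"

definition mat_rank :: "real mat \<Rightarrow> nat" where
  "mat_rank A = vec_space.rank (dim_row A) A"

definition tucker_rank :: "nat list \<Rightarrow> tensor \<Rightarrow> nat list" where
  "tucker_rank ns X = map (\<lambda>k. mat_rank (unfolding_mat ns k X)) [0..<length ns]"

definition tucker_variety :: "nat list \<Rightarrow> nat list \<Rightarrow> tensor set" where
  "tucker_variety ns rs = {X \<in> tspace ns. list_all2 (\<le>) (tucker_rank ns X) rs}"

subsection \<open>\<open>ten\<close> is the inverse of the unfolding\<close>

lemma finite_midx: "finite (midx ns)"
proof (rule finite_subset)
  show "midx ns \<subseteq> {\<alpha>. set \<alpha> \<subseteq> {..<Suc (sum_list ns)} \<and> length \<alpha> = length ns}"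
  proof
    fix \<alpha> assume "\<alpha> \<in> midx ns"
    then have l: "length \<alpha> = length ns" and b: "\<forall>i<length ns. \<alpha> ! i < ns ! i"
      by (auto simp: midx_def list_all2_conv_all_nth)
    have "\<alpha> ! i < Suc (sum_list ns)" if "i < length ns" for i
      using b that elem_le_sum_list[OF that] by (meson le_imp_less_Suc less_or_eq_imp_le order_trans)
    with l show "\<alpha> \<in> {\<alpha>. set \<alpha> \<subseteq> {..<Suc (sum_list ns)} \<and> length \<alpha> = length ns}"
      by (auto simp: in_set_conv_nth)
  qed
qed (simp add: finite_lists_length_eq)

lemma lookup_ten:
  "Poly_Mapping.lookup (ten ns k A) \<alpha> = (if \<alpha> \<in> midx ns then A $$ (\<alpha> ! k, colidx ns k \<alpha>) else 0)"
  by (simp add: ten_def lookup_sum lookup_single when_def finite_midx)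

lemma ten_in_tspace: "ten ns k A \<in> tspace ns"
  by (auto simp: tspace_def in_keys_iff lookup_ten split: if_splits)

lemma mixed_radix_less:
  fixes w b :: "nat \<Rightarrow> nat"
  assumes "\<And>l. l < d \<Longrightarrow> b l < w l"
  shows "(\<Sum>l<d. b l * (\<Prod>m<l. w m)) < (\<Prod>m<d. w m)"
  using assms
proof (induction d)
  case (Suc d)
  let ?P = "\<Prod>m<d. w m"
  have "(\<Sum>l<Suc d. b l * (\<Prod>m<l. w m)) < ?P + b d * ?P"
    using Suc.IH Suc.prems by simp
  also have "\<dots> = Suc (b d) * ?P" by simp
  also have "\<dots> \<le> w d * ?P" using Suc.prems[of d] by (intro mult_right_mono) auto
  finally show ?case by (simp add: mult.commute)
qed simp

lemma mixed_radix_digit: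
  fixes w b :: "nat \<Rightarrow> nat"
  assumes "\<And>l. l < d \<Longrightarrow> b l < w l" "l < d"
  shows "(\<Sum>l<d. b l * (\<Prod>m<l. w m)) div (\<Prod>m<l. w m) mod w l = b l"
  using assms
proof (induction d)
  case (Suc d)
  let ?J = "\<lambda>l. \<Prod>m<l. w m"
  have "w m > 0" if "m < l" for m using Suc.prems(1)[of m] Suc.prems(2) that by linarith
  then have pos: "?J l > 0" by (intro prod_pos) auto
  show ?case
  proof (cases "l = d")
    case True
    with pos mixed_radix_less[of d b w] Suc.prems show ?thesis by simp
  next
    case False
    then have l: "l < d" using Suc.prems by simp
    have "?J d = (\<Prod>m\<in>{..<Suc l} \<union> {Suc l..<d}. w m)"
      using l by (intro prod.cong) auto
    also have "\<dots> = ?J (Suc l) * (\<Prod>m\<in>{Suc l..<d}. w m)"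
      by (rule prod.union_disjoint) auto
    finally obtain c where c: "?J d = ?J l * (w l * c)" by (metis mult.assoc prod.lessThan_Suc)
    have "(\<Sum>l<Suc d. b l * ?J l) = ?J l * (w l * (c * b d)) + (\<Sum>l<d. b l * ?J l)"
      using c by (simp only: sum.lessThan_Suc ac_simps)
    then have "(\<Sum>l<Suc d. b l * ?J l) div ?J l = w l * (c * b d) + (\<Sum>l<d. b l * ?J l) div ?J l"
      using div_mult_self4[of "?J l" "w l * (c * b d)"] pos by (simp only: neq0_conv)
    then show ?thesis using Suc.IH[OF Suc.prems(1) l] by simp
  qed
qed simp

lemma mixed_radix_value:
  fixes w :: "nat \<Rightarrow> nat"
  shows "(\<Sum>l<d. (j div (\<Prod>m<l. w m) mod w l) * (\<Prod>m<l. w m)) = j mod (\<Prod>m<d. w m)"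
proof (induction d)
  case (Suc d)
  then show ?case
    using mod_mult2_eq[of j "\<Prod>m<d. w m" "w d"] by (simp add: algebra_simps)
qed simp

lemma prod_skip: "(\<Prod>m\<in>{..<l} - {k}. ns ! m) = (\<Prod>m<l. if m = k then 1 else ns ! m :: nat)"
  by (rule prod.mono_neutral_cong_left) auto

lemma colidx_alt:
  "colidx ns k \<alpha> = (\<Sum>l<length ns. (if l = k then 0 else \<alpha> ! l) *
     (\<Prod>m<l. if m = k then 1 else ns ! m))"
  unfolding colidx_def stride_def prod_skip
  by (rule sum.mono_neutral_cong_left) auto

lemma colidx_less:
  assumes "\<alpha> \<in> midx ns"
  shows "colidx ns k \<alpha> < nminus ns k"
  unfolding colidx_alt nminus_def prod_skip
  by (rule mixed_radix_less) (use assms in \<open>auto simp: midx_def list_all2_conv_all_nth\<close>)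

lemma unidx_colidx:
  assumes "\<alpha> \<in> midx ns" "k < length ns"
  shows "unidx ns k (\<alpha> ! k) (colidx ns k \<alpha>) = \<alpha>"
proof (rule nth_equalityI)
  show "length (unidx ns k (\<alpha> ! k) (colidx ns k \<alpha>)) = length \<alpha>"
    using assms by (auto simp: unidx_def midx_def list_all2_conv_all_nth)
  fix l assume "l < length (unidx ns k (\<alpha> ! k) (colidx ns k \<alpha>))"
  then have l: "l < length ns" by (simp add: unidx_def)
  have "(colidx ns k \<alpha> div stride ns k l) mod (ns ! l) = \<alpha> ! l" if "l \<noteq> k"
    using mixed_radix_digit[of "length ns" "\<lambda>l. if l = k then 0 else \<alpha> ! l"
        "\<lambda>l. if l = k then 1 else ns ! l" l] that l assms
    by (simp add: colidx_alt stride_def prod_skip midx_def list_all2_conv_all_nth)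
  then show "unidx ns k (\<alpha> ! k) (colidx ns k \<alpha>) ! l = \<alpha> ! l"
    using l by (simp add: unidx_def)
qed

lemma colidx_unidx:
  assumes "j < nminus ns k"
  shows "colidx ns k (unidx ns k i j) = j"
proof -
  have "colidx ns k (unidx ns k i j) =
      (\<Sum>l<length ns. (j div (\<Prod>m<l. if m = k then 1 else ns ! m) mod
          (if l = k then 1 else ns ! l)) * (\<Prod>m<l. if m = k then 1 else ns ! m))"
    unfolding colidx_alt by (rule sum.cong) (auto simp: unidx_def stride_def prod_skip)
  also have "\<dots> = j"
    using assms unfolding mixed_radix_value by (simp add: nminus_def prod_skip)
  finally show ?thesis .
qed

lemma unidx_midx:
  assumes "i < ns ! k" "j < nminus ns k"
  shows "unidx ns k i j \<in> midx ns"
proof -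
  have "ns ! l > 0" if "l < length ns" "l \<noteq> k" for l
  proof (rule ccontr)
    assume "\<not> ns ! l > 0"
    then have "nminus ns k = 0" unfolding nminus_def using that by (auto intro: bexI[of _ l])
    with assms show False by simp
  qed
  then show ?thesis using assms by (auto simp: midx_def unidx_def list_all2_conv_all_nth)
qed

lemma ten_unfolding_mat:
  assumes "X \<in> tspace ns" "k < length ns"
  shows "ten ns k (unfolding_mat ns k X) = X"
proof (rule poly_mapping_eqI)
  fix \<alpha>
  show "Poly_Mapping.lookup (ten ns k (unfolding_mat ns k X)) \<alpha> = Poly_Mapping.lookup X \<alpha>"
  proof (cases "\<alpha> \<in> midx ns")
    case True
    then have "\<alpha> ! k < ns ! k" using assms by (simp add: midx_def list_all2_conv_all_nth)
    then show ?thesis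
      using True colidx_less[OF True] unidx_colidx[OF True assms(2)]
      by (simp add: lookup_ten unfolding_mat_def)
  next
    case False
    then show ?thesis using assms by (auto simp: lookup_ten tspace_def in_keys_iff)
  qed
qed

lemma unfolding_mat_ten:
  assumes "A \<in> carrier_mat (ns ! k) (nminus ns k)" "k < length ns"
  shows "unfolding_mat ns k (ten ns k A) = A"
proof (rule eq_matI)
  fix i j assume "i < dim_row A" "j < dim_col A"
  then have ij: "i < ns ! k" "j < nminus ns k" using assms by auto
  have "unidx ns k i j ! k = i" using assms by (simp add: unidx_def)
  then show "unfolding_mat ns k (ten ns k A) $$ (i, j) = A $$ (i, j)"
    using ij by (simp add: unfolding_mat_def lookup_ten unidx_midx colidx_unidx)
qed (use assms in \<open>auto simp: unfolding_mat_def\<close>)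

section \<open>Stationarity\<close>

definition tangent_cone :: "'a::real_normed_vector set \<Rightarrow> 'a \<Rightarrow> 'a set" where
  "tangent_cone C x = {v. \<exists>y s. (\<forall>i::nat. y i \<in> C \<and> s i > 0) \<and> s \<longlonglongrightarrow> (0::real) \<and> y \<longlonglongrightarrow> x \<and>
     (\<lambda>i. (y i - x) /\<^sub>R s i) \<longlonglongrightarrow> v}"

text \<open>The cone need not be convex, so the metric projection is set-valued; all its elements have
  the same norm.\<close>

definition metric_projection :: "'a::metric_space set \<Rightarrow> 'a \<Rightarrow> 'a set" where
  "metric_projection S a = {v \<in> S. \<forall>w\<in>S. dist a v \<le> dist a w}"

text \<open>In the following \<open>g\<close> stands for the gradient of \<open>f\<close>.\<close>

definition stationary :: "nat list \<Rightarrow> nat list \<Rightarrow> (tensor \<Rightarrow> tensor) \<Rightarrow> tensor \<Rightarrow> bool" where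
  "stationary ns rs g X \<longleftrightarrow> X \<in> tucker_variety ns rs \<and>
     norm ` metric_projection (tangent_cone (tucker_variety ns rs) X) (- g X) = {0}"

section \<open>Truncated HOSVD\<close>

definition frobenius_norm :: "real mat \<Rightarrow> real" where
  "frobenius_norm A = sqrt (\<Sum>i<dim_row A. \<Sum>j<dim_col A. (A $$ (i, j))\<^sup>2)"

text \<open>Best low-rank approximations need not be unique, so the truncations are set-valued.\<close>

definition best_rank_approx :: "nat \<Rightarrow> real mat \<Rightarrow> real mat set" where
  "best_rank_approx s A =
     {B \<in> carrier_mat (dim_row A) (dim_col A). mat_rank B \<le> s \<and>
        (\<forall>C \<in> carrier_mat (dim_row A) (dim_col A). mat_rank C \<le> s \<longrightarrow>
           frobenius_norm (A - B) \<le> frobenius_norm (A - C))}"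

definition mode_truncation :: "nat list \<Rightarrow> nat \<Rightarrow> nat \<Rightarrow> tensor \<Rightarrow> tensor set" where
  "mode_truncation ns k s X = ten ns k ` best_rank_approx s (unfolding_mat ns k X)"

definition hosvd :: "nat list \<Rightarrow> nat list \<Rightarrow> tensor \<Rightarrow> tensor set" where
  "hosvd ns ss X =
     foldl (\<lambda>S k. \<Union>Y\<in>S. mode_truncation ns k (ss ! k) Y) {X} [0..<length ns]"

section \<open>Partial projection\<close>

definition stiefel :: "nat \<Rightarrow> nat \<Rightarrow> real mat set" where
  "stiefel r n = {U \<in> carrier_mat n r. transpose_mat U * U = 1\<^sub>m r}"

definition proj_mat :: "real mat \<Rightarrow> real mat" where
  "proj_mat S = S * transpose_mat S"

definition proj_perp_mat :: "real mat \<Rightarrow> real mat" where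
  "proj_perp_mat S = 1\<^sub>m (dim_row S) - S * transpose_mat S"

definition append_cols :: "real mat \<Rightarrow> real mat \<Rightarrow> real mat" where
  "append_cols A B = mat_of_cols (dim_row A) (cols A @ cols B)"

text \<open>Only used for \<open>A\<close> of full row rank, where \<open>A A\<^sup>T\<close> is invertible.\<close>

definition right_pinv :: "real mat \<Rightarrow> real mat" where
  "right_pinv A = transpose_mat A * the (mat_inverse (A * transpose_mat A))"

definition tucker_decomposition ::
    "nat list \<Rightarrow> tensor \<Rightarrow> tensor \<Rightarrow> (nat \<Rightarrow> real mat) \<Rightarrow> bool" where
  "tucker_decomposition ns X G U \<longleftrightarrow>
     G \<in> tspace (tucker_rank ns X) \<and>
     (\<forall>k<length ns. U k \<in> stiefel (tucker_rank ns X ! k) (ns ! k)) \<and>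
     X = mode_prods (tucker_rank ns X) G [(k, U k). k \<leftarrow> [0..<length ns]]"

definition partial_proj_0 :: "nat list \<Rightarrow> (nat \<Rightarrow> real mat) \<Rightarrow> tensor \<Rightarrow> tensor" where
  "partial_proj_0 ns S A = mode_prods ns A [(k, proj_mat (S k)). k \<leftarrow> [0..<length ns]]"

definition partial_proj ::
    "nat list \<Rightarrow> nat list \<Rightarrow> tensor \<Rightarrow> (nat \<Rightarrow> real mat) \<Rightarrow> nat \<Rightarrow> tensor \<Rightarrow> tensor" where
  "partial_proj ns us G U k A =
     (let B = mode_prods ns A [(j, transpose_mat (U j)). j \<leftarrow> [0..<length ns], j \<noteq> k];
          W = proj_perp_mat (U k) * unfolding_mat (us[k := ns ! k]) k B *
              right_pinv (unfolding_mat us k G)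
      in mode_prods us G ((k, W) # [(j, U j). j \<leftarrow> [0..<length ns], j \<noteq> k]))"

text \<open>The factors \<open>S k\<close> of the zeroth projection: \<open>[U\<^sub>k U\<^sub>k']\<close> with \<open>r\<^sub>k - u\<^sub>k\<close> new orthonormal columns
  in the modes where the rank \<open>u\<^sub>k\<close> is deficient, and \<open>U\<^sub>k\<close> in the others.\<close>

definition extended_factors ::
    "nat list \<Rightarrow> nat list \<Rightarrow> nat list \<Rightarrow> (nat \<Rightarrow> real mat) \<Rightarrow> tensor \<Rightarrow> (nat \<Rightarrow> real mat) \<Rightarrow> bool" where
  "extended_factors ns rs us U A S \<longleftrightarrow>
     (let I = {k. k < length ns \<and> us ! k < rs ! k} in
       (\<exists>U'. \<forall>k<length ns.
          if k \<in> I
          then U' k \<in> stiefel (rs ! k - us ! k) (ns ! k) \<and>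
               transpose_mat (U k) * U' k = 0\<^sub>m (us ! k) (rs ! k - us ! k) \<and>
               S k = append_cols (U k) (U' k)
          else S k = U k) \<and>
       norm (partial_proj_0 ns S A) \<ge>
         norm (mode_prods ns A [(k, proj_mat (U k)). k \<leftarrow> [0..<length ns], k \<notin> I]) *
         (\<Prod>k\<in>I. sqrt (real (rs ! k - us ! k) / real (min (ns ! k) (nminus ns k)))))"

text \<open>All possible values, over the choices of the Tucker decomposition, of the new columns and of
  the element of largest norm.\<close>

definition hat_proj :: "nat list \<Rightarrow> nat list \<Rightarrow> tensor \<Rightarrow> tensor \<Rightarrow> tensor set" where
  "hat_proj ns rs X A =
     {V. \<exists>G U S. tucker_decomposition ns X G U \<and>
          extended_factors ns rs (tucker_rank ns X) U A S \<and>
          (let C = insert (partial_proj_0 ns S A)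
                     ((\<lambda>k. partial_proj ns (tucker_rank ns X) G U k A) ` {..<length ns})
           in V \<in> C \<and> (\<forall>Z\<in>C. norm Z \<le> norm V))}"

section \<open>The rfGRAP-R method\<close>

definition sufficient_decrease ::
    "nat list \<Rightarrow> nat list \<Rightarrow> (tensor \<Rightarrow> real) \<Rightarrow> (tensor \<Rightarrow> tensor) \<Rightarrow> real \<Rightarrow> tensor \<Rightarrow> tensor \<Rightarrow> real \<Rightarrow> bool" where
  "sufficient_decrease ns rs f g a X V s \<longleftrightarrow>
     (\<exists>Z \<in> hosvd ns rs (X + s *\<^sub>R V). f X - f Z \<ge> s * a * inner (- g X) V)"

definition armijo_stepsize ::
    "nat list \<Rightarrow> nat list \<Rightarrow> (tensor \<Rightarrow> real) \<Rightarrow> (tensor \<Rightarrow> tensor) \<Rightarrow> real \<Rightarrow> real \<Rightarrow> real \<Rightarrow>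
     tensor \<Rightarrow> tensor \<Rightarrow> real \<Rightarrow> bool" where
  "armijo_stepsize ns rs f g sbar \<rho> a X V s \<longleftrightarrow>
     (\<exists>l::nat. s = \<rho> ^ l * sbar \<and> sufficient_decrease ns rs f g a X V (\<rho> ^ l * sbar) \<and>
        (\<forall>m<l. \<not> sufficient_decrease ns rs f g a X V (\<rho> ^ m * sbar)))"

text \<open>The smallest nonzero singular value, for \<open>A \<noteq> 0\<close>.\<close>

definition sigma_min :: "real mat \<Rightarrow> real" where
  "sigma_min A = Min {sqrt \<mu> | \<mu>. eigenvalue (transpose_mat A * A) \<mu> \<and> \<mu> \<noteq> 0}"

definition rank_candidates :: "real \<Rightarrow> real mat \<Rightarrow> nat set" where
  "rank_candidates \<Delta> A =
     (if A = 0\<^sub>m (dim_row A) (dim_col A) then {0}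
      else if sigma_min A \<le> \<Delta> then {mat_rank A - 1, mat_rank A}
      else {mat_rank A})"

definition tucker_rank_candidates :: "nat list \<Rightarrow> real \<Rightarrow> tensor \<Rightarrow> nat list set" where
  "tucker_rank_candidates ns \<Delta> X =
     {qs. length qs = length ns \<and>
          (\<forall>k<length ns. qs ! k \<in> rank_candidates \<Delta> (unfolding_mat ns k X))}"

definition rfgrapr_stop :: "nat list \<Rightarrow> nat list \<Rightarrow> (tensor \<Rightarrow> tensor) \<Rightarrow> tensor \<Rightarrow> bool" where
  "rfgrapr_stop ns rs g X \<longleftrightarrow> (\<exists>V \<in> hat_proj ns rs X (- g X). norm V = 0)"

text \<open>One iteration that does not stop, from \<open>X\<close> to \<open>X'\<close>; \<open>Y qs\<close> is the trial point computed for the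
  candidate rank \<open>qs\<close>.\<close>

definition rfgrapr_step ::
    "nat list \<Rightarrow> nat list \<Rightarrow> (tensor \<Rightarrow> real) \<Rightarrow> (tensor \<Rightarrow> tensor) \<Rightarrow> real \<Rightarrow> real \<Rightarrow> real \<Rightarrow> real \<Rightarrow>
     tensor \<Rightarrow> tensor \<Rightarrow> bool" where
  "rfgrapr_step ns rs f g \<Delta> sbar \<rho> a X X' \<longleftrightarrow>
     (\<exists>V \<in> hat_proj ns rs X (- g X). norm V \<noteq> 0) \<and>
     (\<exists>Y. (\<forall>qs \<in> tucker_rank_candidates ns \<Delta> X.
             \<exists>Z \<in> hosvd ns qs X. \<exists>V \<in> hat_proj ns rs Z (- g Z). \<exists>s.
               armijo_stepsize ns rs f g sbar \<rho> a Z V s \<and> Y qs = Z + s *\<^sub>R V) \<and>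
          (\<exists>qs \<in> tucker_rank_candidates ns \<Delta> X.
             X' = Y qs \<and> (\<forall>ps \<in> tucker_rank_candidates ns \<Delta> X. f (Y qs) \<le> f (Y ps))))"

end

theory Submission
  imports Defs
begin

text \<open>
  Why the theorem holds. Let \<open>A = - \<nabla>f X\<close>, and let \<open>K\<close> be the set of modes in which \<open>X\<close> has the full
  rank \<open>r\<^sub>k\<close>. Write \<open>P\<^sub>k\<close> for the projector onto the column space of the mode-\<open>k\<close> unfolding of \<open>X\<close>.
  Then \<open>X\<close> is stationary if two conditions hold: \<open>A \<times>\<^bsub>k\<in>K\<^esub> P\<^sub>k = 0\<close>, and \<open>A\<close> is orthogonal to
  \<open>X \<times>\<^sub>k (1 - P\<^sub>k) N\<close> for all \<open>k \<in> K\<close> and all matrices \<open>N\<close> (\<open>stationary_if_orthogonal\<close>). The reason is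
  that in a mode \<open>k \<in> K\<close> the rank cannot increase, so that the normal part \<open>v \<times>\<^sub>k (1 - P\<^sub>k)\<close> of a tangent
  vector \<open>v\<close> has the form \<open>X \<times>\<^sub>k (1 - P\<^sub>k) N\<close> (\<open>tangent_normal_part\<close>). What remains of \<open>v\<close> after these
  parts have been removed is \<open>v \<times>\<^bsub>k\<in>K\<^esub> P\<^sub>k\<close>.

  The direction \<open>V\<close> chosen by the partial projection is an orthogonal projection of \<open>A\<close>, and it controls
  both conditions: \<open>\<parallel>V\<parallel>\<close> bounds \<open>\<parallel>A \<times>\<^bsub>k\<in>K\<^esub> P\<^sub>k\<parallel>\<close> up to a constant, because of the choice of the new
  columns in the deficient modes, and it bounds the inner product of \<open>A\<close> with every normalised
  \<open>X \<times>\<^sub>k (1 - P\<^sub>k) N\<close> (\<open>hat_proj_properties\<close>). In addition \<open>X + s V\<close> stays on the variety.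

  These bounds pass to limits. If \<open>Z\<^sub>t \<rightarrow> X\<close> on the variety, then in the modes in which \<open>X\<close> has full rank the
  projectors of \<open>Z\<^sub>t\<close> converge to those of \<open>X\<close> (\<open>proj_mat_tendsto\<close>). If moreover every \<open>Z\<^sub>t\<close> is rank
  deficient in all the modes in which \<open>X\<close> is, and the directions at \<open>Z\<^sub>t\<close> tend to \<open>0\<close>, then \<open>X\<close> is
  stationary (\<open>stationary_if_directions_vanish\<close>). For a constant sequence this is the case of termination.

  Let \<open>L\<close> be an accumulation point of the iterates. An iterate \<open>X\<close> close to \<open>L\<close> may have rank \<open>r\<^sub>k\<close> in
  a mode in which \<open>L\<close> is deficient. By \<open>rank_gap\<close> its smallest singular value in that mode is then at most
  \<open>\<parallel>X - L\<parallel>\<close>, so that the method also tries the rank \<open>r\<^sub>k - 1\<close>. One such reduction is enough: the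
  resulting point \<open>Z\<close> need not have the ranks of \<open>L\<close>, it only has to be deficient where \<open>L\<close> is. As the
  truncated HOSVD is quasi-optimal, \<open>\<parallel>Z - L\<parallel> \<le> 2\<^sup>d \<parallel>X - L\<parallel>\<close> (\<open>hosvd_properties\<close>). The Armijo step from
  \<open>Z\<close> decreases \<open>f\<close> by at least \<open>c \<parallel>V\<parallel>\<^sup>2\<close> with \<open>c > 0\<close> depending on \<open>L\<close> only (\<open>uniform_decrease\<close>). The
  next iterate is no worse than that step, and no iterate has a value below \<open>f L\<close>; hence
  \<open>c \<parallel>V\<parallel>\<^sup>2 \<le> f Z - f L \<rightarrow> 0\<close> (\<open>limit_point_stationary\<close>).
\<close>

no_notation inner (infix \<open>\<bullet>\<close> 70)

section \<open>Rank and orthonormal bases of column spaces\<close>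

lemma mat_rank_mult_le:
  assumes A: "A \<in> carrier_mat n m" and B: "B \<in> carrier_mat m p"
  shows "mat_rank (A * B) \<le> mat_rank A"
proof -
  interpret vec_space "TYPE(real)" n .
  have AB: "A * B \<in> carrier_mat n p" using A B by auto
  have cA: "set (cols A) \<subseteq> carrier_vec n" and cAB: "set (cols (A * B)) \<subseteq> carrier_vec n"
    using A AB cols_dim by (metis carrier_matD(1))+
  have "set (cols (A * B)) \<subseteq> span (set (cols A))"
  proof
    fix v assume "v \<in> set (cols (A * B))"
    then obtain j where j: "j < p" "v = col (A * B) j"
      using AB by (auto simp: in_set_conv_nth)
    then have "v = A *\<^sub>v col B j" using A B by (auto simp: col_mult2)
    moreover have "A *\<^sub>v col B j \<in> col_space A"
      using A B j by (subst col_space_eq[OF A]) auto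
    ultimately show "v \<in> span (set (cols A))" by (simp add: col_space_def)
  qed
  then have "span (set (cols (A * B))) \<subseteq> span (set (cols A))"
    by (simp add: cA span_is_subset span_is_submodule)
  moreover have sA: "subspace class_ring (span (set (cols A))) V"
    and sAB: "subspace class_ring (span (set (cols (A * B)))) V"
    using cA cAB span_is_subspace by auto
  ultimately have "subspace class_ring (span (set (cols (A * B)))) (vs (span (set (cols A))))"
    using nested_subspaces by blast
  moreover have "vectorspace.fin_dim class_ring (span_vs (set (cols (A * B))))"
    and "vectorspace.fin_dim class_ring (span_vs (set (cols A)))"
    using A AB fin_dim_span_cols by auto
  ultimately have "rank (A * B) \<le> rank A"
    unfolding rank_def using vectorspace.subspace_dim[OF subspace_is_vs[OF sA]] by auto
  then show ?thesis using A by (simp add: mat_rank_def)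
qed

lemma mat_rank_le_dim_col: "mat_rank A \<le> dim_col A"
  unfolding mat_rank_def by (rule vec_space.rank_le_nc) auto

lemma mult_unit_vec:
  fixes A :: "real mat"
  assumes "A \<in> carrier_mat n m" "j < m"
  shows "A *\<^sub>v unit_vec m j = col A j"
  using assms by (intro eq_vecI) auto

lemma mat_rank_left_inverse:
  assumes A: "A \<in> carrier_mat n r" and L: "L \<in> carrier_mat r n" and LA: "L * A = 1\<^sub>m r"
  shows "mat_rank A = r"
proof -
  interpret vec_space "TYPE(real)" n .
  have inj: "v = 0\<^sub>v r" if "v \<in> carrier_vec r" "A *\<^sub>v v = 0\<^sub>v n" for v
  proof -
    have "v = (L * A) *\<^sub>v v" using that LA by simp
    also have "\<dots> = L *\<^sub>v (A *\<^sub>v v)" using A L that by (simp add: assoc_mult_mat_vec)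
    also have "\<dots> = 0\<^sub>v r" using that L by auto
    finally show ?thesis .
  qed
  have d: "distinct (cols A)"
  proof (rule ccontr)
    assume "\<not> distinct (cols A)"
    then obtain i j where ij: "i < r" "j < r" "i \<noteq> j" "col A i = col A j"
      using A by (auto simp: distinct_conv_nth)
    have "A *\<^sub>v unit_vec r i = col A i" "A *\<^sub>v unit_vec r j = col A j"
      using A ij by (auto simp: mult_unit_vec)
    then have "A *\<^sub>v (unit_vec r i - unit_vec r j) = 0\<^sub>v n"
      using A ij by (simp add: mult_minus_distrib_mat_vec)
    from inj[OF _ this] have "unit_vec r i - unit_vec r j = (0\<^sub>v r :: real vec)" by simp
    then have "(unit_vec r i - unit_vec r j) $ i = (0\<^sub>v r :: real vec) $ i" by simp
    with ij show False by simp
  qed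
  have "lin_indpt (set (cols A))"
  proof
    assume "lin_dep (set (cols A))"
    from lin_depE[OF A this d] obtain v where "v \<in> carrier_vec r" "v \<noteq> 0\<^sub>v r" "A *\<^sub>v v = 0\<^sub>v n" .
    with inj show False by blast
  qed
  from lin_indpt_full_rank[OF A d this] show ?thesis using A by (simp add: mat_rank_def)
qed

lemma stiefel_carrier [dest]: "U \<in> stiefel r n \<Longrightarrow> U \<in> carrier_mat n r"
  by (simp add: stiefel_def)

lemma stiefel_left_inverse: "U \<in> stiefel r n \<Longrightarrow> transpose_mat U * U = 1\<^sub>m r"
  by (simp add: stiefel_def)

lemma stiefel_le:
  assumes "U \<in> stiefel r n" shows "r \<le> n"
proof -
  have U: "U \<in> carrier_mat n r" using assms by auto
  have "r = mat_rank (1\<^sub>m n * U)"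
    using mat_rank_left_inverse[OF U _ stiefel_left_inverse[OF assms]] U by auto
  also have "\<dots> \<le> mat_rank (1\<^sub>m n)" using U by (intro mat_rank_mult_le) auto
  also have "\<dots> \<le> n" using mat_rank_le_dim_col[of "1\<^sub>m n"] by simp
  finally show ?thesis .
qed


text \<open>Associativity with conditions on dimensions only, which the simplifier can discharge.\<close>

lemma mat_assoc:
  fixes A B C :: "real mat"
  assumes "dim_col A = dim_row B" "dim_col B = dim_row C"
  shows "A * B * C = A * (B * C)"
  by (rule assoc_mult_mat[OF carrier_matI carrier_matI carrier_matI]) (use assms in auto)

lemma stiefel_cancel:
  assumes "U \<in> stiefel r n" "dim_row Z = r"
  shows "transpose_mat U * (U * Z) = Z"
proof -
  have U: "U \<in> carrier_mat n r" using assms by auto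
  have "transpose_mat U * (U * Z) = transpose_mat U * U * Z"
    using U assms by (simp add: mat_assoc)
  then show ?thesis using assms by (simp add: stiefel_left_inverse)
qed

lemma stiefel_iff_cols:
  assumes U: "U \<in> carrier_mat n r"
  shows "U \<in> stiefel r n \<longleftrightarrow> (\<forall>i<r. \<forall>j<r. col U i \<bullet> col U j = (if i = j then 1 else 0))"
proof
  assume "U \<in> stiefel r n"
  then have e: "(transpose_mat U * U) $$ (i,j) = (1\<^sub>m r) $$ (i,j)" for i j
    by (simp add: stiefel_left_inverse)
  show "\<forall>i<r. \<forall>j<r. col U i \<bullet> col U j = (if i = j then 1 else 0)"
  proof (intro allI impI)
    fix i j assume "i < r" "j < r"
    then show "col U i \<bullet> col U j = (if i = j then 1 else 0)" using e[of i j] U by simp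
  qed
next
  assume *: "\<forall>i<r. \<forall>j<r. col U i \<bullet> col U j = (if i = j then 1 else 0)"
  have "transpose_mat U * U = 1\<^sub>m r" by (rule eq_matI) (use U * in auto)
  then show "U \<in> stiefel r n" using U by (simp add: stiefel_def)
qed

text \<open>One step of the Gram-Schmidt process: the normalised residual of a column of \<open>M\<close> outside the
  range of \<open>U\<close> is a further orthonormal column.\<close>

lemma stiefel_extend:
  assumes U: "U \<in> stiefel r n" and M: "M \<in> carrier_mat n m" and C: "C \<in> carrier_mat m r"
    and UC: "U = M * C" and ne: "U * transpose_mat U * M \<noteq> M"
  shows "\<exists>U' C'. U' \<in> stiefel (Suc r) n \<and> C' \<in> carrier_mat m (Suc r) \<and> U' = M * C'"
proof -
  have Uc: "U \<in> carrier_mat n r" using U by auto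
  obtain j where j: "j < m" "col (U * transpose_mat U * M) j \<noteq> col M j"
  proof -
    have "\<exists>j<m. col (U * transpose_mat U * M) j \<noteq> col M j"
    proof (rule ccontr)
      assume "\<not> ?thesis"
      then have "U * transpose_mat U * M = M"
        by (intro mat_col_eqI) (use M Uc in auto)
      with ne show False by simp
    qed
    then show ?thesis using that by blast
  qed
  let ?x = "col M j"
  have x: "?x \<in> carrier_vec n" using M j by auto
  define h where "h = transpose_mat U *\<^sub>v ?x"
  have h: "h \<in> carrier_vec r" using Uc x by (auto simp: h_def)
  define c where "c = ?x - U *\<^sub>v h"
  have c: "c \<in> carrier_vec n" using Uc x h by (auto simp: c_def)
  have Uhx: "U *\<^sub>v h = col (U * transpose_mat U * M) j"
    using Uc M j x
    by (subst mat_assoc) (auto simp: h_def col_mult2[of U n r "transpose_mat U * M" m]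
        col_mult2[of "transpose_mat U" r n M m] simp del: col_mult)
  have "c \<noteq> 0\<^sub>v n"
  proof
    assume "c = 0\<^sub>v n"
    then have "?x $ i = (U *\<^sub>v h) $ i" if "i < n" for i
    proof -
      have "c $ i = ?x $ i - (U *\<^sub>v h) $ i" unfolding c_def using that x Uc by auto
      with \<open>c = 0\<^sub>v n\<close> that show ?thesis by simp
    qed
    then have "?x = U *\<^sub>v h" using x Uc M by (intro eq_vecI) auto
    with Uhx j show False by simp
  qed
  then have cc: "c \<bullet> c > 0"
    using c conjugate_square_greater_0_vec[of c n] by simp
  define s where "s = sqrt (c \<bullet> c)"
  have s: "s > 0" "s * s = c \<bullet> c" using cc by (auto simp: s_def)
  define w where "w = (1 / s) \<cdot>\<^sub>v c"
  have w: "w \<in> carrier_vec n" using c by (simp add: w_def)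
  have ww: "w \<bullet> w = 1" using c s cc by (simp add: w_def field_simps)
  have Uw: "col U i \<bullet> w = 0" "w \<bullet> col U i = 0" if i: "i < r" for i
  proof -
    have ci: "col U i \<in> carrier_vec n" using Uc by auto
    have "transpose_mat U *\<^sub>v (U *\<^sub>v h) = (transpose_mat U * U) *\<^sub>v h"
      using Uc h by (simp add: assoc_mult_mat_vec[where n\<^sub>1=r and n\<^sub>2=n and n\<^sub>3=r])
    then have Uh: "transpose_mat U *\<^sub>v (U *\<^sub>v h) = h"
      using h by (simp add: stiefel_left_inverse[OF U])
    have "col U i \<bullet> c = col U i \<bullet> ?x - col U i \<bullet> (U *\<^sub>v h)"
      unfolding c_def using ci x Uc h by (intro scalar_prod_minus_distrib) auto
    also have "col U i \<bullet> ?x = h $ i" using Uc i by (simp add: h_def)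
    also have "col U i \<bullet> (U *\<^sub>v h) = (transpose_mat U *\<^sub>v (U *\<^sub>v h)) $ i" using Uc i by simp
    finally have *: "col U i \<bullet> c = 0" using Uh by simp
    then show "col U i \<bullet> w = 0" using c ci by (simp add: w_def)
    then show "w \<bullet> col U i = 0" using w ci by (simp add: comm_scalar_prod[of w n])
  qed
  define U' where "U' = Matrix.mat n (Suc r) (\<lambda>(i,k). if k < r then U $$ (i,k) else w $ i)"
  have colU': "col U' k = (if k < r then col U k else w)" if "k < Suc r" for k
    using that Uc w by (intro eq_vecI) (auto simp: U'_def)
  have st: "U' \<in> stiefel (Suc r) n"
    using U[unfolded stiefel_iff_cols[OF Uc]] Uw ww
    by (subst stiefel_iff_cols) (auto simp: colU' less_Suc_eq, auto simp: U'_def)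
  define b where "b = (1 / s) \<cdot>\<^sub>v (unit_vec m j - C *\<^sub>v h)"
  define C' where "C' = Matrix.mat m (Suc r) (\<lambda>(i,k). if k < r then C $$ (i,k) else b $ i)"
  have b: "b \<in> carrier_vec m" using C h by (auto simp: b_def)
  have colC': "col C' k = (if k < r then col C k else b)" if "k < Suc r" for k
    using that C b by (intro eq_vecI) (auto simp: C'_def)
  have "M *\<^sub>v (unit_vec m j - C *\<^sub>v h) = M *\<^sub>v unit_vec m j - M *\<^sub>v (C *\<^sub>v h)"
    using M C h by (intro mult_minus_distrib_mat_vec) auto
  also have "\<dots> = c" using M C h j by (simp add: c_def UC mult_unit_vec)
  finally have "M *\<^sub>v b = w"
    using M C h by (simp add: b_def w_def mult_mat_vec[where nr=n and nc=m])
  note Mb = this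
  have C': "C' \<in> carrier_mat m (Suc r)" by (simp add: C'_def)
  have UM: "U' = M * C'"
  proof (rule mat_col_eqI)
    fix k assume "k < dim_col (M * C')"
    then have k: "k < Suc r" using C' by simp
    have "col (M * C') k = M *\<^sub>v col C' k" using M C' k by (rule col_mult2)
    also have "\<dots> = col U' k"
      using k Mb M C by (auto simp: colC' colU' UC col_mult2[OF M C] simp del: col_mult)
    finally show "col U' k = col (M * C') k" by simp
  qed (use M C' in \<open>auto simp: U'_def\<close>)
  with st C' show ?thesis by blast
qed

text \<open>A maximal orthonormal system in the column space of \<open>M\<close> spans it.\<close>

lemma exists_column_space_basis:
  assumes M: "M \<in> carrier_mat n m"
  obtains U C where "U \<in> stiefel (mat_rank M) n" "C \<in> carrier_mat m (mat_rank M)" "U = M * C"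
    "U * transpose_mat U * M = M"
proof -
  define Q where "Q r \<longleftrightarrow> (\<exists>U C. U \<in> stiefel r n \<and> C \<in> carrier_mat m r \<and> U = M * C)" for r
  have "Q 0" unfolding Q_def
    by (rule exI[of _ "M * 0\<^sub>m m 0"], rule exI[of _ "0\<^sub>m m 0"]) (use M in \<open>auto simp: stiefel_def intro!: eq_matI\<close>)
  moreover have "\<forall>r. Q r \<longrightarrow> r \<le> n" using stiefel_le by (auto simp: Q_def)
  ultimately obtain r where r: "Q r" "\<forall>r'. Q r' \<longrightarrow> r' \<le> r"
    using Greatest_le_nat[of Q _ n] GreatestI_nat[of Q 0 n] by blast
  then obtain U C where U: "U \<in> stiefel r n" and C: "C \<in> carrier_mat m r" and UC: "U = M * C"
    by (auto simp: Q_def)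
  have Uc: "U \<in> carrier_mat n r" using U by auto
  have P: "U * transpose_mat U * M = M"
  proof (rule ccontr)
    assume "U * transpose_mat U * M \<noteq> M"
    from stiefel_extend[OF U M C UC this] have "Q (Suc r)" unfolding Q_def .
    with r(2) show False by fastforce
  qed
  have rU: "mat_rank U = r"
    using mat_rank_left_inverse[OF Uc _ stiefel_left_inverse[OF U]] Uc by auto
  then have "r \<le> mat_rank M" using mat_rank_mult_le[OF M C] UC by simp
  moreover have "mat_rank M \<le> r"
    using mat_rank_mult_le[of U n r "transpose_mat U * M" m] P Uc M rU by (simp add: mat_assoc)
  ultimately have "mat_rank M = r" by simp
  with that U C UC P show ?thesis by blast
qed

lemma mat_rank_le_of_fixed:
  assumes "B \<in> carrier_mat n r" "B * N = M" "N \<in> carrier_mat r m"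
  shows "mat_rank M \<le> r"
  using mat_rank_mult_le[OF assms(1,3)] mat_rank_le_dim_col[of B] assms by auto

section \<open>The Frobenius inner product and limits of projectors\<close>

definition minner :: "real mat \<Rightarrow> real mat \<Rightarrow> real" where
  "minner A B = (\<Sum>i<dim_row A. \<Sum>j<dim_col A. A $$ (i,j) * B $$ (i,j))"

lemma mat_mult_index:
  fixes A B :: "real mat"
  assumes "i < dim_row A" "j < dim_col B" "dim_col A = dim_row B"
  shows "(A * B) $$ (i,j) = (\<Sum>k<dim_row B. A $$ (i,k) * B $$ (k,j))"
  using assms by (simp add: scalar_prod_def atLeast0LessThan)

lemma minner_commute:
  assumes "dim_row A = dim_row B" "dim_col A = dim_col B"
  shows "minner A B = minner B A"
  using assms by (simp add: minner_def mult.commute)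

lemma minner_mult_left:
  assumes "dim_col A = dim_row M" "dim_row N = dim_row A" "dim_col N = dim_col M"
  shows "minner (A * M) N = minner M (transpose_mat A * N)"
proof -
  have "minner (A * M) N =
      (\<Sum>i<dim_row A. \<Sum>j<dim_col M. \<Sum>k<dim_row M. A $$ (i,k) * M $$ (k,j) * N $$ (i,j))"
    using assms by (simp add: minner_def mat_mult_index sum_distrib_right del: index_mult_mat(1))
  also have "\<dots> = (\<Sum>k<dim_row M. \<Sum>j<dim_col M. \<Sum>i<dim_row A. A $$ (i,k) * M $$ (k,j) * N $$ (i,j))"
    by (subst (2) sum.swap, subst sum.swap, rule sum.cong[OF refl], rule sum.swap)
  also have "\<dots> = minner M (transpose_mat A * N)"
    using assms by (simp add: minner_def mat_mult_index sum_distrib_left mult_ac del: index_mult_mat(1))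
  finally show ?thesis .
qed

lemma minner_transpose: "minner (transpose_mat A) (transpose_mat B) = minner A B"
  if "dim_row A = dim_row B" "dim_col A = dim_col B"
  unfolding minner_def using that by (simp, subst sum.swap) simp

lemma minner_mult_right:
  assumes "dim_col M = dim_row B" "dim_row N = dim_row M" "dim_col N = dim_col B"
  shows "minner (M * B) N = minner M (N * transpose_mat B)"
proof -
  have "minner (M * B) N = minner (transpose_mat (M * B)) (transpose_mat N)"
    using assms by (simp add: minner_transpose)
  also have "\<dots> = minner (transpose_mat B * transpose_mat M) (transpose_mat N)"
    using assms by (simp add: transpose_mult[OF carrier_matI carrier_matI])
  also have "\<dots> = minner (transpose_mat M) (B * transpose_mat N)"
    using assms by (subst minner_mult_left) auto
  also have "\<dots> = minner (transpose_mat M) (transpose_mat (N * transpose_mat B))"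
    using assms by (simp add: transpose_mult[OF carrier_matI carrier_matI])
  also have "\<dots> = minner M (N * transpose_mat B)"
    using assms by (intro minner_transpose) auto
  finally show ?thesis .
qed

lemma minner_diff_left:
  assumes "dim_row A = dim_row B" "dim_col A = dim_col B"
  shows "minner (A - B) C = minner A C - minner B C"
  using assms by (simp add: minner_def sum_subtractf left_diff_distrib)

lemma minner_diff_right:
  assumes "dim_row A = dim_row B" "dim_col A = dim_col B" "dim_row C = dim_row B" "dim_col C = dim_col B"
  shows "minner C (A - B) = minner C A - minner C B"
  using assms by (simp add: minner_def sum_subtractf right_diff_distrib)

lemma minner_nonneg: "minner A A \<ge> 0"
  by (auto simp: minner_def intro!: sum_nonneg)

lemma entry_le_minner:
  assumes "i < dim_row A" "j < dim_col A"
  shows "(A $$ (i,j))\<^sup>2 \<le> minner A A"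
proof -
  have "(A $$ (i,j))\<^sup>2 \<le> (\<Sum>j<dim_col A. A $$ (i,j) * A $$ (i,j))"
    unfolding power2_eq_square by (rule member_le_sum) (use assms in auto)
  also have "\<dots> \<le> minner A A" unfolding minner_def
    by (rule member_le_sum[of i _ "\<lambda>i. \<Sum>j<dim_col A. A $$ (i,j) * A $$ (i,j)"])
      (use assms in \<open>auto intro!: sum_nonneg\<close>)
  finally show ?thesis .
qed

lemma minner_eq_0D:
  assumes "minner A A = 0" shows "A = 0\<^sub>m (dim_row A) (dim_col A)"
  using entry_le_minner[of _ A] assms by (intro eq_matI) (auto simp: dual_order.antisym)

lemma frobenius_norm_minner: "frobenius_norm A = sqrt (minner A A)"
  by (simp add: frobenius_norm_def minner_def power2_eq_square)

lemma minner_one: "minner (1\<^sub>m r) (1\<^sub>m r) = real r"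
proof -
  have "minner (1\<^sub>m r) (1\<^sub>m r) = (\<Sum>i<r. \<Sum>j<r. if i = j then 1 else 0)"
    unfolding minner_def by (intro sum.cong) auto
  then show ?thesis by simp
qed

lemma proj_mat_carrier: "U \<in> stiefel r n \<Longrightarrow> proj_mat U \<in> carrier_mat n n"
  unfolding proj_mat_def by (auto dest!: stiefel_carrier)

lemma proj_mat_symmetric: "transpose_mat (proj_mat U) = proj_mat U"
  by (simp add: proj_mat_def transpose_mult[OF carrier_matI carrier_matI])

lemma proj_mat_idem: "U \<in> stiefel r n \<Longrightarrow> proj_mat U * proj_mat U = proj_mat U"
  by (frule stiefel_carrier) (simp add: proj_mat_def mat_assoc stiefel_cancel)

lemma minner_proj_mat:
  assumes "U \<in> stiefel r n"
  shows "minner (proj_mat U) (proj_mat U) = real r"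
proof -
  have U: "U \<in> carrier_mat n r" using assms by auto
  have "minner (proj_mat U) (proj_mat U) = minner (transpose_mat U) (transpose_mat U)"
    unfolding proj_mat_def using U by (subst minner_mult_left) (auto simp: stiefel_cancel[OF assms])
  also have "\<dots> = minner (U * 1\<^sub>m r) U" using U by (simp add: minner_transpose)
  also have "\<dots> = minner (1\<^sub>m r) (1\<^sub>m r)"
    using U by (subst minner_mult_left) (auto simp: stiefel_left_inverse[OF assms])
  finally show ?thesis by (simp add: minner_one)
qed

subsection \<open>Entrywise limits of matrices\<close>

definition mat_tendsto :: "(nat \<Rightarrow> real mat) \<Rightarrow> real mat \<Rightarrow> bool" where
  "mat_tendsto M L \<longleftrightarrow> (\<forall>t. M t \<in> carrier_mat (dim_row L) (dim_col L)) \<and>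
     (\<forall>i<dim_row L. \<forall>j<dim_col L. (\<lambda>t. M t $$ (i,j)) \<longlonglongrightarrow> L $$ (i,j))"

lemma mat_tendsto_const: "mat_tendsto (\<lambda>t. A) A"
  by (auto simp: mat_tendsto_def)

lemma mat_tendsto_mult:
  assumes "mat_tendsto A A0" "mat_tendsto B B0" "dim_col A0 = dim_row B0"
  shows "mat_tendsto (\<lambda>t. A t * B t) (A0 * B0)"
proof -
  have d: "dim_row (A t) = dim_row A0" "dim_col (A t) = dim_col A0"
    "dim_row (B t) = dim_row B0" "dim_col (B t) = dim_col B0" for t
    using assms by (auto simp: mat_tendsto_def)
  have "(\<lambda>t. \<Sum>k<dim_row B0. A t $$ (i,k) * B t $$ (k,j)) \<longlonglongrightarrow> (\<Sum>k<dim_row B0. A0 $$ (i,k) * B0 $$ (k,j))"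
    if "i < dim_row A0" "j < dim_col B0" for i j
    using assms that by (intro tendsto_sum tendsto_mult) (auto simp: mat_tendsto_def)
  then show ?thesis
    using assms d by (auto simp: mat_tendsto_def mat_mult_index simp del: index_mult_mat(1))
qed

lemma mat_tendsto_minus:
  assumes "mat_tendsto A A0" "mat_tendsto B B0" "dim_row A0 = dim_row B0" "dim_col A0 = dim_col B0"
  shows "mat_tendsto (\<lambda>t. A t - B t) (A0 - B0)"
proof -
  have d: "dim_row (A t) = dim_row A0" "dim_col (A t) = dim_col A0"
    "dim_row (B t) = dim_row B0" "dim_col (B t) = dim_col B0" for t
    using assms by (auto simp: mat_tendsto_def)
  then show ?thesis using assms by (auto simp: mat_tendsto_def intro!: tendsto_diff)
qed

lemma mat_tendsto_unique:
  assumes "mat_tendsto A A0" "mat_tendsto A A1"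
  shows "A0 = A1"
proof -
  have "dim_row A0 = dim_row A1" "dim_col A0 = dim_col A1"
    using assms unfolding mat_tendsto_def by (metis carrier_matD)+
  moreover from this have "A0 $$ (i,j) = A1 $$ (i,j)" if "i < dim_row A1" "j < dim_col A1" for i j
    using assms that LIMSEQ_unique[of "\<lambda>t. A t $$ (i,j)"] by (auto simp: mat_tendsto_def)
  ultimately show ?thesis by (intro eq_matI) auto
qed

lemma mat_tendsto_minner:
  assumes "mat_tendsto A A0"
  shows "(\<lambda>t. minner (A t) B) \<longlonglongrightarrow> minner A0 B"
proof -
  have d: "dim_row (A t) = dim_row A0" "dim_col (A t) = dim_col A0" for t
    using assms by (auto simp: mat_tendsto_def)
  show ?thesis unfolding minner_def d
    using assms by (intro tendsto_sum tendsto_mult) (auto simp: mat_tendsto_def)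
qed

text \<open>Projectors onto the column spaces converge when the matrices converge and the limit has the
  largest rank. With \<open>P\<^sub>t = U\<^sub>t U\<^sub>t\<^sup>T\<close> and \<open>P = U U\<^sup>T\<close>, the equality \<open>P\<^sub>t Y\<^sub>t = Y\<^sub>t\<close> yields
  \<open>P\<^sub>t P \<rightarrow> P\<close>, and \<open>\<parallel>P\<^sub>t - P\<parallel>\<^sup>2 = rank P\<^sub>t + rank P - 2 \<langle>P\<^sub>t P, P\<rangle>\<close>.\<close>

lemma proj_mat_tendsto:
  assumes Y: "mat_tendsto Y Y0" and Y0: "Y0 \<in> carrier_mat n m"
    and U: "\<And>t. U t \<in> stiefel (rk t) n" and PY: "\<And>t. proj_mat (U t) * Y t = Y t"
    and rk: "\<And>t. rk t \<le> r" and U0: "U0 \<in> stiefel r n" and C: "C \<in> carrier_mat m r" "U0 = Y0 * C"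
  shows "mat_tendsto (\<lambda>t. proj_mat (U t)) (proj_mat U0)"
proof -
  define P where "P t = proj_mat (U t)" for t
  define P0 where "P0 = proj_mat U0"
  have P: "P t \<in> carrier_mat n n" for t unfolding P_def using U by (rule proj_mat_carrier)
  have P0: "P0 \<in> carrier_mat n n" unfolding P0_def using U0 by (rule proj_mat_carrier)
  have U0c: "U0 \<in> carrier_mat n r" using U0 by auto
  have Yc: "Y t \<in> carrier_mat n m" for t using Y Y0 by (auto simp: mat_tendsto_def)
  have Pb: "\<bar>P t $$ (i,j)\<bar> \<le> sqrt (real r)" if "i < n" "j < n" for t i j
  proof -
    have "(P t $$ (i,j))\<^sup>2 \<le> minner (P t) (P t)" using that P[of t] by (intro entry_le_minner) auto
    also have "\<dots> \<le> real r" using minner_proj_mat[OF U] rk by (simp add: P_def)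
    finally show ?thesis by (simp add: real_le_rsqrt)
  qed
  have PYe: "P t * Y0 = Y t + P t * (Y0 - Y t)" for t
  proof -
    have "P t * (Y0 - Y t) = P t * Y0 - Y t"
      using P[of t] Y0 Yc[of t] PY[of t] by (simp add: P_def mult_minus_distrib_mat[where nr=n and n=n and nc=m])
    then show ?thesis using P[of t] Y0 Yc[of t] by (intro eq_matI) auto
  qed
  have "mat_tendsto (\<lambda>t. P t * Y0) Y0"
  proof -
    have "(\<lambda>t. (P t * Y0) $$ (i,j)) \<longlonglongrightarrow> Y0 $$ (i,j)" if ij: "i < n" "j < m" for i j
    proof -
      have e: "(P t * Y0) $$ (i,j) = Y t $$ (i,j) + (\<Sum>k<n. P t $$ (i,k) * (Y0 $$ (k,j) - Y t $$ (k,j)))" for t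
      proof -
        have "(P t * (Y0 - Y t)) $$ (i,j) = (\<Sum>k<n. P t $$ (i,k) * (Y0 $$ (k,j) - Y t $$ (k,j)))"
          using P[of t] Y0 Yc[of t] ij by (subst mat_mult_index) auto
        then show ?thesis using P[of t] Y0 Yc[of t] ij by (subst PYe) auto
      qed
      have "(\<lambda>t. P t $$ (i,k) * (Y0 $$ (k,j) - Y t $$ (k,j))) \<longlonglongrightarrow> 0" if k: "k < n" for k
      proof (rule Lim_null_comparison)
        show "\<forall>\<^sub>F t in sequentially. norm (P t $$ (i,k) * (Y0 $$ (k,j) - Y t $$ (k,j)))
            \<le> sqrt (real r) * \<bar>Y t $$ (k,j) - Y0 $$ (k,j)\<bar>"
          using Pb[OF ij(1) k] by (auto simp: abs_mult abs_minus_commute intro!: always_eventually mult_right_mono)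
        have "(\<lambda>t. Y t $$ (k,j)) \<longlonglongrightarrow> Y0 $$ (k,j)" using Y Y0 k ij by (auto simp: mat_tendsto_def)
        then have "(\<lambda>t. sqrt (real r) * \<bar>Y t $$ (k,j) - Y0 $$ (k,j)\<bar>) \<longlonglongrightarrow> sqrt (real r) * \<bar>Y0 $$ (k,j) - Y0 $$ (k,j)\<bar>"
          by (intro tendsto_intros)
        then show "(\<lambda>t. sqrt (real r) * \<bar>Y t $$ (k,j) - Y0 $$ (k,j)\<bar>) \<longlonglongrightarrow> 0" by simp
      qed
      then have "(\<lambda>t. \<Sum>k<n. P t $$ (i,k) * (Y0 $$ (k,j) - Y t $$ (k,j))) \<longlonglongrightarrow> 0"
        by (intro tendsto_null_sum) auto
      moreover have "(\<lambda>t. Y t $$ (i,j)) \<longlonglongrightarrow> Y0 $$ (i,j)" using Y Y0 ij by (auto simp: mat_tendsto_def)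
      ultimately have "(\<lambda>t. Y t $$ (i,j) + (\<Sum>k<n. P t $$ (i,k) * (Y0 $$ (k,j) - Y t $$ (k,j)))) \<longlonglongrightarrow> Y0 $$ (i,j) + 0"
        by (rule tendsto_add[rotated])
      then show ?thesis unfolding e by simp
    qed
    then show ?thesis using P Y0 by (auto simp: mat_tendsto_def simp del: index_mult_mat(1) intro: mult_carrier_mat)
  qed
  then have "mat_tendsto (\<lambda>t. P t * Y0 * (C * transpose_mat U0)) (Y0 * (C * transpose_mat U0))"
    using Y0 C by (intro mat_tendsto_mult mat_tendsto_const) auto
  moreover have "P t * Y0 * (C * transpose_mat U0) = P t * P0" for t
    using P[of t] Y0 C(1) U0c by (simp add: P0_def proj_mat_def C(2) mat_assoc)
  moreover have "Y0 * (C * transpose_mat U0) = P0"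
    using Y0 C(1) U0c by (simp add: P0_def proj_mat_def C(2) mat_assoc)
  ultimately have "mat_tendsto (\<lambda>t. P t * P0) P0" by simp
  from mat_tendsto_minner[OF this, of P0]
  have lim: "(\<lambda>t. minner (P t * P0) P0) \<longlonglongrightarrow> real r"
    using minner_proj_mat[OF U0] by (simp add: P0_def)
  have D: "minner (P t - P0) (P t - P0) \<le> 2 * real r - 2 * minner (P t * P0) P0" for t
  proof -
    have "minner (P t * P0) P0 = minner (P t) P0"
      using P[of t] P0 proj_mat_idem[OF U0] proj_mat_symmetric[of U0]
      by (subst minner_mult_right) (auto simp: P0_def)
    moreover have "minner (P t - P0) (P t - P0) = minner (P t) (P t) - minner (P t) P0 - minner P0 (P t) + minner P0 P0"
      using P[of t] P0 by (simp add: minner_diff_left minner_diff_right)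
    moreover have "minner P0 (P t) = minner (P t) P0" using P[of t] P0 by (intro minner_commute) auto
    moreover have "minner (P t) (P t) \<le> real r" "minner P0 P0 = real r"
      using minner_proj_mat[OF U] minner_proj_mat[OF U0] rk by (auto simp: P_def P0_def)
    ultimately show ?thesis by linarith
  qed
  have lim0: "(\<lambda>t. 2 * real r - 2 * minner (P t * P0) P0) \<longlonglongrightarrow> 0"
    using tendsto_diff[OF tendsto_const[of "2 * real r"] tendsto_mult[OF tendsto_const[of 2] lim]] by simp
  have "(\<lambda>t. P t $$ (i,j)) \<longlonglongrightarrow> P0 $$ (i,j)" if ij: "i < n" "j < n" for i j
  proof -
    have "(\<lambda>t. (P t $$ (i,j) - P0 $$ (i,j))\<^sup>2) \<longlonglongrightarrow> 0"
    proof (rule Lim_null_comparison[OF always_eventually lim0], rule allI)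
      fix t
      have "((P t - P0) $$ (i,j))\<^sup>2 \<le> minner (P t - P0) (P t - P0)"
        using ij P[of t] P0 by (intro entry_le_minner) auto
      with D[of t] show "norm ((P t $$ (i,j) - P0 $$ (i,j))\<^sup>2) \<le> 2 * real r - 2 * minner (P t * P0) P0"
        using ij P[of t] P0 by simp
    qed
    from tendsto_real_sqrt[OF this] have "(\<lambda>t. P t $$ (i,j) - P0 $$ (i,j)) \<longlonglongrightarrow> 0"
      by (simp add: tendsto_rabs_zero_iff)
    then show ?thesis by (simp add: LIM_zero_iff)
  qed
  then show ?thesis using P P0 by (auto simp: mat_tendsto_def P_def P0_def)
qed

text \<open>On the kernel of \<open>X\<close> the matrix \<open>Y\<^sub>t\<close> equals \<open>s\<^sub>t D\<^sub>t\<close>, and \<open>(1 - P\<^sub>0) P\<^sub>t \<rightarrow> 0\<close>. Dividing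
  \<open>(1 - P\<^sub>0) Y\<^sub>t = (1 - P\<^sub>0) P\<^sub>t Y\<^sub>t\<close> by \<open>s\<^sub>t\<close> shows that \<open>(1 - P\<^sub>0) v\<close> vanishes on the kernel of \<open>X\<close>,
  so that it factors through \<open>X\<close>. In the application \<open>v\<close> is tangent at \<open>X\<close> to the matrices of bounded
  rank.\<close>

lemma maximal_rank_tangent:
  assumes X: "X \<in> carrier_mat n m" and D: "mat_tendsto D v" and v: "v \<in> carrier_mat n m"
    and s: "\<And>t. s t \<noteq> 0" and Y: "\<And>t. Y t = X + s t \<cdot>\<^sub>m D t"
    and P: "mat_tendsto P P0" and P0: "P0 \<in> carrier_mat n n" and PY: "\<And>t. P t * Y t = Y t"
    and PX: "P0 * X = X" and idem: "P0 * P0 = P0"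
  shows "\<exists>N \<in> carrier_mat n n. (1\<^sub>m n - P0) * v = (1\<^sub>m n - P0) * N * X"
proof -
  obtain V C where V: "V \<in> stiefel (mat_rank (transpose_mat X)) m"
    and C: "C \<in> carrier_mat n (mat_rank (transpose_mat X))"
    and VC: "V = transpose_mat X * C" and VX: "V * transpose_mat V * transpose_mat X = transpose_mat X"
    using exists_column_space_basis[of "transpose_mat X" m n] X by auto
  have Vc: "V \<in> carrier_mat m (mat_rank (transpose_mat X))" using V by auto
  define Q where "Q = V * transpose_mat V"
  have Q: "Q \<in> carrier_mat m m" using Vc by (auto simp: Q_def)
  have "transpose_mat (Q * transpose_mat X) = transpose_mat (transpose_mat X)" using VX by (simp add: Q_def)
  then have XQ: "X * Q = X"
    using Q X proj_mat_symmetric[of V] transpose_mult[OF Q, of "transpose_mat X" n] by (simp add: Q_def proj_mat_def)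
  define R where "R = 1\<^sub>m n - P0"
  define S where "S = 1\<^sub>m m - Q"
  have R: "R \<in> carrier_mat n n" and S: "S \<in> carrier_mat m m" using P0 Q by (auto simp: R_def S_def)
  have XS: "X * S = 0\<^sub>m n m"
    unfolding S_def using X Q XQ by (subst mult_minus_distrib_mat[where nr=n and n=m and nc=m]) auto
  have RP: "R * P0 = 0\<^sub>m n n"
    unfolding R_def using P0 idem by (subst minus_mult_distrib_mat[where nr=n and n=n and nc=n]) auto
  then have "R * (P0 * X) = 0\<^sub>m n m" using R P0 X by (simp flip: mat_assoc)
  then have RX: "R * X = 0\<^sub>m n m" by (simp add: PX)
  have Dc: "D t \<in> carrier_mat n m" and Pc: "P t \<in> carrier_mat n n" for t
    using D P v P0 by (auto simp: mat_tendsto_def)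
  have "R * (D t * S) = R * (P t * (D t * S))" for t
  proof -
    have YS: "Y t * S = s t \<cdot>\<^sub>m (D t * S)"
      unfolding Y using X S Dc[of t] XS
      by (subst add_mult_distrib_mat[where nr=n and n=m and nc=m]) (auto intro!: eq_matI)
    have "s t \<cdot>\<^sub>m (R * (D t * S)) = R * (Y t * S)"
      using R Dc[of t] S by (subst YS) (simp add: mult_smult_distrib[OF R, of _ m])
    also have "Y t * S = P t * (Y t * S)"
      using PY[of t] Pc[of t] S Dc[of t] X by (simp add: Y flip: mat_assoc)
    also have "R * (P t * (Y t * S)) = s t \<cdot>\<^sub>m (R * (P t * (D t * S)))"
      using R Dc[of t] S Pc[of t] by (subst YS)
        (simp add: mult_smult_distrib[OF Pc[of t], of _ m] mult_smult_distrib[OF R, of _ m])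
    finally have e: "s t \<cdot>\<^sub>m (R * (D t * S)) = s t \<cdot>\<^sub>m (R * (P t * (D t * S)))" .
    show ?thesis
    proof (rule eq_matI)
      fix i j assume "i < dim_row (R * (P t * (D t * S)))" "j < dim_col (R * (P t * (D t * S)))"
      then have ij: "i < n" "j < m" using R S by auto
      have "(s t \<cdot>\<^sub>m (R * (D t * S))) $$ (i,j) = (s t \<cdot>\<^sub>m (R * (P t * (D t * S)))) $$ (i,j)"
        using e by simp
      then have "s t * (R * (D t * S)) $$ (i,j) = s t * (R * (P t * (D t * S))) $$ (i,j)"
        using ij R S by (simp del: index_mult_mat(1))
      with s[of t] show "(R * (D t * S)) $$ (i,j) = (R * (P t * (D t * S))) $$ (i,j)"
        by (simp del: index_mult_mat(1))
    qed (use R S in auto)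
  qed
  moreover have "mat_tendsto (\<lambda>t. R * (D t * S)) (R * (v * S))"
    using D R S v by (intro mat_tendsto_mult mat_tendsto_const) auto
  moreover have "mat_tendsto (\<lambda>t. R * (P t * (D t * S))) (R * (P0 * (v * S)))"
    using D R S v P P0 by (intro mat_tendsto_mult mat_tendsto_const) auto
  ultimately have "R * (v * S) = R * (P0 * (v * S))" by (auto intro: mat_tendsto_unique)
  also have "\<dots> = R * P0 * (v * S)" using R P0 v S by (simp add: mat_assoc)
  also have "\<dots> = 0\<^sub>m n m" using RP v S by simp
  finally have "R * v * S = 0\<^sub>m n m" using R v S by (simp add: mat_assoc)
  moreover have "R * v * S = R * v - R * v * Q"
    unfolding S_def using R v Q
    by (subst mult_minus_distrib_mat[where nr=n and n=m and nc=m]) auto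
  ultimately have Z: "R * v - R * v * Q = 0\<^sub>m n m" by simp
  have "R * v = R * v * Q"
  proof (rule eq_matI)
    fix i j assume ij: "i < dim_row (R * v * Q)" "j < dim_col (R * v * Q)"
    then have "(R * v - R * v * Q) $$ (i,j) = (R * v) $$ (i,j) - (R * v * Q) $$ (i,j)"
      using R v Q by (intro index_minus_mat) auto
    moreover have "(0\<^sub>m n m) $$ (i,j) = (0::real)" using ij R Q by auto
    ultimately show "(R * v) $$ (i,j) = (R * v * Q) $$ (i,j)" using Z by simp
  qed (use R v Q in auto)
  also have "\<dots> = R * (v * V * transpose_mat C) * X"
    using R v Vc C X by (simp add: Q_def mat_assoc, subst VC) (simp add: transpose_mult[OF _ C] mat_assoc)
  finally have "R * v = R * (v * V * transpose_mat C) * X" .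
  moreover have "v * V * transpose_mat C \<in> carrier_mat n n" using v C by auto
  ultimately show ?thesis unfolding R_def by blast
qed

section \<open>Mode products without shapes\<close>

text \<open>The mode product only looks at the index of one mode, so that it can be defined on all finitely
  supported functions at once. In this form products in different modes commute and adjoints exist
  without any condition on shapes.\<close>

definition act :: "nat \<Rightarrow> real mat \<Rightarrow> tensor \<Rightarrow> tensor" where
  "act k A X = (\<Sum>\<alpha>\<in>Poly_Mapping.keys X. \<Sum>j<dim_row A.
     if k < length \<alpha> \<and> \<alpha> ! k < dim_col A
     then Poly_Mapping.single (\<alpha>[k := j]) (A $$ (j, \<alpha> ! k) * Poly_Mapping.lookup X \<alpha>) else 0)"

lemma lookup_act:
  "Poly_Mapping.lookup (act k A X) \<beta> = (if k < length \<beta> \<and> \<beta> ! k < dim_row A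
     then \<Sum>i<dim_col A. A $$ (\<beta> ! k, i) * Poly_Mapping.lookup X (\<beta>[k := i]) else 0)"
proof -
  let ?T = "(\<lambda>i. \<beta>[k := i]) ` {..<dim_col A}"
  have e: "Poly_Mapping.lookup (act k A X) \<beta> = (\<Sum>\<alpha>\<in>Poly_Mapping.keys X. \<Sum>j<dim_row A.
     if k < length \<alpha> \<and> \<alpha> ! k < dim_col A \<and> \<alpha>[k := j] = \<beta> then A $$ (j, \<alpha> ! k) * Poly_Mapping.lookup X \<alpha> else 0)"
    unfolding act_def lookup_sum by (intro sum.cong refl) (auto simp: lookup_single when_def)
  show ?thesis
  proof (cases "k < length \<beta> \<and> \<beta> ! k < dim_row A")
    case False
    have "Poly_Mapping.lookup (act k A X) \<beta> = (\<Sum>\<alpha>\<in>Poly_Mapping.keys X. \<Sum>j<dim_row A. 0)"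
      unfolding e using False by (intro sum.cong refl) auto
    then show ?thesis unfolding if_not_P[OF False] by simp
  next
    case True
    have "Poly_Mapping.lookup (act k A X) \<beta> = (\<Sum>\<alpha>\<in>Poly_Mapping.keys X. 
       if \<alpha> \<in> ?T then A $$ (\<beta> ! k, \<alpha> ! k) * Poly_Mapping.lookup X \<alpha> else 0)"
      unfolding e
    proof (intro sum.cong refl)
      fix \<alpha>
      have "\<alpha> \<in> ?T \<longleftrightarrow> k < length \<alpha> \<and> \<alpha> ! k < dim_col A \<and> \<alpha>[k := \<beta> ! k] = \<beta>"
      proof
        assume "k < length \<alpha> \<and> \<alpha> ! k < dim_col A \<and> \<alpha>[k := \<beta> ! k] = \<beta>"
        then have "\<alpha> = \<beta>[k := \<alpha> ! k]" by (metis list_update_id list_update_overwrite)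
        with \<open>k < length \<alpha> \<and> _\<close> show "\<alpha> \<in> ?T" by blast
      qed (use True in auto)
      note T = this
      define c where "c = A $$ (\<beta> ! k, \<alpha> ! k) * Poly_Mapping.lookup X \<alpha>"
      have "(if k < length \<alpha> \<and> \<alpha> ! k < dim_col A \<and> \<alpha>[k := j] = \<beta>
          then A $$ (j, \<alpha> ! k) * Poly_Mapping.lookup X \<alpha> else 0) =
        (if j = \<beta> ! k then (if \<alpha> \<in> ?T then c else 0) else 0)" for j
      proof (cases "j = \<beta> ! k")
        case True
        then show ?thesis unfolding T c_def by simp
      next
        case False
        then have "\<not> (k < length \<alpha> \<and> \<alpha> ! k < dim_col A \<and> \<alpha>[k := j] = \<beta>)" by auto
        then show ?thesis using False by argo
      qed
      then have "(\<Sum>j<dim_row A. if k < length \<alpha> \<and> \<alpha> ! k < dim_col A \<and> \<alpha>[k := j] = \<beta>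
          then A $$ (j, \<alpha> ! k) * Poly_Mapping.lookup X \<alpha> else 0) =
        (\<Sum>j<dim_row A. if j = \<beta> ! k then (if \<alpha> \<in> ?T then c else 0) else 0)"
        by (rule sum.cong[OF refl])
      then show "(\<Sum>j<dim_row A. if k < length \<alpha> \<and> \<alpha> ! k < dim_col A \<and> \<alpha>[k := j] = \<beta>
          then A $$ (j, \<alpha> ! k) * Poly_Mapping.lookup X \<alpha> else 0) =
          (if \<alpha> \<in> ?T then A $$ (\<beta> ! k, \<alpha> ! k) * Poly_Mapping.lookup X \<alpha> else 0)"
        using True unfolding c_def by simp
    qed
    also have "\<dots> = (\<Sum>\<alpha>\<in>?T. A $$ (\<beta> ! k, \<alpha> ! k) * Poly_Mapping.lookup X \<alpha>)"
      by (rule sum.mono_neutral_cong) (auto simp: in_keys_iff)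
    also have "\<dots> = (\<Sum>i<dim_col A. A $$ (\<beta> ! k, i) * Poly_Mapping.lookup X (\<beta>[k := i]))"
    proof (subst sum.reindex)
      show "inj_on (\<lambda>i. \<beta>[k := i]) {..<dim_col A}"
        using True by (intro inj_onI) (metis nth_list_update_eq)
    qed (use True in simp)
    finally show ?thesis using True by simp
  qed
qed

lemma act_add: "act k A (X + Y) = act k A X + act k A Y"
  by (rule poly_mapping_eqI) (simp add: lookup_act lookup_add sum.distrib algebra_simps)

lemma act_scaleR: "act k A (c *\<^sub>R X) = c *\<^sub>R act k A X"
  by (rule poly_mapping_eqI) (simp add: lookup_act sum_distrib_left algebra_simps)

lemma act_plus_mat:
  assumes "dim_row A = dim_row B" "dim_col A = dim_col B"
  shows "act k (A + B) X = act k A X + act k B X"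
  using assms by (intro poly_mapping_eqI) (simp add: lookup_act lookup_add sum.distrib algebra_simps)

lemma act_minus_mat:
  assumes "dim_row A = dim_row B" "dim_col A = dim_col B"
  shows "act k (A - B) X = act k A X - act k B X"
  using assms by (intro poly_mapping_eqI) (simp add: lookup_act lookup_minus sum_subtractf algebra_simps)

lemma act_smult_mat: "act k (c \<cdot>\<^sub>m A) X = c *\<^sub>R act k A X"
  by (intro poly_mapping_eqI) (simp add: lookup_act sum_distrib_left algebra_simps)

lemma act_commute:
  assumes "k \<noteq> j"
  shows "act k A (act j B X) = act j B (act k A X)"
proof (rule poly_mapping_eqI)
  fix \<beta>
  show "Poly_Mapping.lookup (act k A (act j B X)) \<beta> = Poly_Mapping.lookup (act j B (act k A X)) \<beta>"
    using assms sum.swap[of "\<lambda>i l. A $$ (\<beta> ! k, i) * (B $$ (\<beta> ! j, l) * Poly_Mapping.lookup X (\<beta>[k := i, j := l]))"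
        "{..<dim_col B}" "{..<dim_col A}"]
    by (auto simp: lookup_act sum_distrib_left list_update_swap[of j k] mult.left_commute)
qed

lemma act_compose:
  assumes "dim_col B = dim_row A"
  shows "act k B (act k A X) = act k (B * A) X"
proof (rule poly_mapping_eqI)
  fix \<beta>
  have "(\<Sum>i<dim_col B. B $$ (\<beta> ! k, i) * (\<Sum>l<dim_col A. A $$ (i, l) * Poly_Mapping.lookup X (\<beta>[k := l])))
      = (\<Sum>l<dim_col A. (\<Sum>i<dim_row A. B $$ (\<beta> ! k, i) * A $$ (i, l)) * Poly_Mapping.lookup X (\<beta>[k := l]))"
    unfolding assms sum_distrib_left sum_distrib_right by (subst sum.swap) (simp add: mult.assoc)
  then show "Poly_Mapping.lookup (act k B (act k A X)) \<beta> = Poly_Mapping.lookup (act k (B * A) X) \<beta>"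
    using assms by (auto simp: lookup_act mat_mult_index simp del: index_mult_mat(1))
qed

lemma inner_single: "inner (Poly_Mapping.single \<alpha> c) (Y :: tensor) = c * Poly_Mapping.lookup Y \<alpha>"
  by (subst inner_poly_mapping_superset[of "{\<alpha>}"]) auto

lemma act_adjoint: "inner (act k A X) Y = inner X (act k (transpose_mat A) Y)"
proof -
  have "inner (act k A X) Y = (\<Sum>\<alpha>\<in>Poly_Mapping.keys X. \<Sum>j<dim_row A.
     if k < length \<alpha> \<and> \<alpha> ! k < dim_col A
     then A $$ (j, \<alpha> ! k) * Poly_Mapping.lookup X \<alpha> * Poly_Mapping.lookup Y (\<alpha>[k := j]) else 0)"
    unfolding act_def inner_sum_left by (intro sum.cong refl) (simp add: inner_single)
  also have "\<dots> = inner X (act k (transpose_mat A) Y)"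
    unfolding inner_poly_mapping_def
    by (intro sum.cong refl) (auto simp: lookup_act sum_distrib_left intro!: sum.cong)
  finally show ?thesis .
qed

subsection \<open>The action on tensors of a given shape\<close>

lemma lookup_outside_tspace: "X \<in> tspace ns \<Longrightarrow> \<alpha> \<notin> midx ns \<Longrightarrow> Poly_Mapping.lookup X \<alpha> = 0"
  by (auto simp: tspace_def in_keys_iff)

lemma midx_iff: "\<alpha> \<in> midx ns \<longleftrightarrow> length \<alpha> = length ns \<and> (\<forall>l<length ns. \<alpha> ! l < ns ! l)"
  by (auto simp: midx_def list_all2_conv_all_nth)

lemma tspace_add: "X \<in> tspace ns \<Longrightarrow> Y \<in> tspace ns \<Longrightarrow> X + Y \<in> tspace ns"
  using Poly_Mapping.keys_add[of X Y] by (auto simp: tspace_def)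

lemma tspace_diff: "X \<in> tspace ns \<Longrightarrow> Y \<in> tspace ns \<Longrightarrow> X - Y \<in> tspace ns"
  by (auto simp: tspace_def in_keys_iff lookup_minus subset_iff) (metis eq_iff_diff_eq_0)

lemma tspace_scaleR: "X \<in> tspace ns \<Longrightarrow> c *\<^sub>R X \<in> tspace ns"
  by (auto simp: tspace_def in_keys_iff subset_iff)

lemma tspace_uminus: "X \<in> tspace ns \<Longrightarrow> - X \<in> tspace ns"
  by (auto simp: tspace_def in_keys_iff subset_iff)

lemma act_tspace:
  assumes "X \<in> tspace ns" "dim_row A = ns' ! k" "length ns' = length ns"
    "\<And>l. l < length ns \<Longrightarrow> l \<noteq> k \<Longrightarrow> ns' ! l = ns ! l"
  shows "act k A X \<in> tspace ns'"
proof -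
  have "\<beta> \<in> midx ns'" if "Poly_Mapping.lookup (act k A X) \<beta> \<noteq> 0" for \<beta>
  proof -
    from that have k: "k < length \<beta>" "\<beta> ! k < ns' ! k"
      and "(\<Sum>i<dim_col A. A $$ (\<beta> ! k, i) * Poly_Mapping.lookup X (\<beta>[k := i])) \<noteq> 0"
      using assms by (auto simp: lookup_act split: if_splits)
    then obtain i where "Poly_Mapping.lookup X (\<beta>[k := i]) \<noteq> 0"
      by (auto elim!: sum.not_neutral_contains_not_neutral)
    then have m: "\<beta>[k := i] \<in> midx ns" using assms(1) by (auto simp: tspace_def in_keys_iff)
    have "\<beta> ! l < ns' ! l" if "l < length ns" for l
    proof (cases "l = k")
      case False
      then have "\<beta>[k := i] ! l = \<beta> ! l" by simp
      moreover have "\<beta>[k := i] ! l < ns ! l" using m that unfolding midx_iff by blast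
      ultimately show ?thesis using False assms(4)[OF that] by simp
    qed (use k in simp)
    with m assms(3) show ?thesis by (simp add: midx_iff)
  qed
  then show ?thesis by (auto simp: tspace_def in_keys_iff)
qed

lemma act_tspace_same:
  "X \<in> tspace ns \<Longrightarrow> dim_row A = ns ! k \<Longrightarrow> act k A X \<in> tspace ns"
  by (rule act_tspace) auto

lemma act_one:
  assumes "X \<in> tspace ns" "k < length ns"
  shows "act k (1\<^sub>m (ns ! k)) X = X"
proof (rule poly_mapping_eqI)
  fix \<beta>
  show "Poly_Mapping.lookup (act k (1\<^sub>m (ns ! k)) X) \<beta> = Poly_Mapping.lookup X \<beta>"
  proof (cases "k < length \<beta> \<and> \<beta> ! k < ns ! k")
    case True
    then have "Poly_Mapping.lookup (act k (1\<^sub>m (ns ! k)) X) \<beta> =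
        (\<Sum>i<ns ! k. if i = \<beta> ! k then Poly_Mapping.lookup X (\<beta>[k := i]) else 0)"
      by (auto simp: lookup_act simp del: sum.delta sum.delta' intro!: sum.cong)
    also have "\<dots> = Poly_Mapping.lookup X \<beta>" using True by simp
    finally show ?thesis .
  next
    case False
    then have "\<beta> \<notin> midx ns" using assms by (auto simp: midx_iff)
    then show ?thesis using False assms by (auto simp: lookup_act lookup_outside_tspace)
  qed
qed

lemma nminus_update [simp]: "nminus (ns[k := m]) k = nminus ns k"
  by (simp add: nminus_def)

lemma stride_update [simp]: "stride (ns[k := m]) k l = stride ns k l"
  unfolding stride_def by (rule prod.cong) auto

lemma unidx_nth: "k < length ns \<Longrightarrow> unidx ns k i j ! k = i"
  by (simp add: unidx_def)

lemma unidx_update: "unidx (ns[k := m]) k i j = unidx ns k i j"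
  by (auto simp: unidx_def intro!: map_cong)

lemma unfolding_mat_carrier [simp]:
  "dim_row (unfolding_mat ns k X) = ns ! k" "dim_col (unfolding_mat ns k X) = nminus ns k"
  by (auto simp: unfolding_mat_def)

lemma unfolding_mat_act:
  assumes "k < length ns" "A \<in> carrier_mat m (ns ! k)"
  shows "unfolding_mat (ns[k := m]) k (act k A X) = A * unfolding_mat ns k X"
proof (rule eq_matI)
  fix i j assume "i < dim_row (A * unfolding_mat ns k X)" "j < dim_col (A * unfolding_mat ns k X)"
  then have ij: "i < m" "j < nminus ns k" using assms by auto
  have "length (unidx ns k i j) = length ns" "unidx ns k i j ! k = i"
    using assms by (auto simp: unidx_def)
  moreover have "(unidx ns k i j)[k := l] = unidx ns k l j" for l
    by (rule nth_equalityI) (auto simp: unidx_def nth_list_update)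
  ultimately show "unfolding_mat (ns[k := m]) k (act k A X) $$ (i,j) = (A * unfolding_mat ns k X) $$ (i,j)"
    using ij assms
    by (simp add: mat_mult_index unidx_update unfolding_mat_def lookup_act del: index_mult_mat(1))
qed (use assms in auto)

lemma unfolding_mat_act_same:
  assumes "k < length ns" "A \<in> carrier_mat (ns ! k) (ns ! k)"
  shows "unfolding_mat ns k (act k A X) = A * unfolding_mat ns k X"
  using unfolding_mat_act[OF assms] by simp

lemma mode_prod_act:
  assumes "X \<in> tspace ns" "k < length ns" "dim_col A = ns ! k"
  shows "mode_prod ns X k A = act k A X"
proof -
  have A: "A \<in> carrier_mat (dim_row A) (ns ! k)" using assms by auto
  have "act k A X \<in> tspace (ns[k := dim_row A])" using assms by (intro act_tspace[OF assms(1)]) auto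
  from ten_unfolding_mat[OF this, of k] show ?thesis
    using assms by (simp add: mode_prod_def unfolding_mat_act[OF assms(2) A])
qed

lemma unfolding_mat_inject:
  assumes "X \<in> tspace ns" "Y \<in> tspace ns" "k < length ns" "unfolding_mat ns k X = unfolding_mat ns k Y"
  shows "X = Y"
  using assms ten_unfolding_mat by metis

lemma unfolding_mat_diff: "unfolding_mat ns k (X - Y) = unfolding_mat ns k X - unfolding_mat ns k Y"
  by (rule eq_matI) (auto simp: unfolding_mat_def lookup_minus)

lemma inner_unfolding:
  assumes X: "X \<in> tspace ns" and k: "k < length ns"
  shows "inner X Y = minner (unfolding_mat ns k X) (unfolding_mat ns k Y)"
proof -
  have "inner X Y = (\<Sum>\<alpha>\<in>midx ns. Poly_Mapping.lookup X \<alpha> * Poly_Mapping.lookup Y \<alpha>)"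
    using X by (subst inner_poly_mapping_superset[OF finite_midx[of ns]]) (auto simp: tspace_def)
  also have "\<dots> = (\<Sum>(i,j)\<in>{..<ns ! k} \<times> {..<nminus ns k}.
      Poly_Mapping.lookup X (unidx ns k i j) * Poly_Mapping.lookup Y (unidx ns k i j))"
    by (rule sum.reindex_bij_witness[of _ "\<lambda>(i,j). unidx ns k i j" "\<lambda>\<alpha>. (\<alpha> ! k, colidx ns k \<alpha>)"])
      (use k in \<open>auto simp: unidx_colidx unidx_midx colidx_less colidx_unidx unidx_nth midx_iff[THEN iffD1]\<close>)
  also have "\<dots> = minner (unfolding_mat ns k X) (unfolding_mat ns k Y)"
    by (simp add: minner_def sum.cartesian_product[symmetric] unfolding_mat_def)
  finally show ?thesis .
qed

lemma norm_unfolding: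
  assumes "X \<in> tspace ns" "k < length ns"
  shows "norm X = frobenius_norm (unfolding_mat ns k X)"
  using inner_unfolding[OF assms, of X] by (simp add: norm_poly_mapping_def frobenius_norm_minner)

subsection \<open>Products in several modes\<close>

definition acts :: "(nat \<Rightarrow> real mat) \<Rightarrow> nat list \<Rightarrow> tensor \<Rightarrow> tensor" where
  "acts M ks X = fold (\<lambda>k. act k (M k)) ks X"

lemma acts_Nil [simp]: "acts M [] X = X"
  and acts_Cons: "acts M (k # ks) X = acts M ks (act k (M k) X)"
  by (simp_all add: acts_def)

lemma acts_cong: "(\<And>k. k \<in> set ks \<Longrightarrow> M k = N k) \<Longrightarrow> acts M ks X = acts N ks X"
  unfolding acts_def by (induction ks arbitrary: X) auto

lemma acts_act_commute: "j \<notin> set ks \<Longrightarrow> acts M ks (act j B X) = act j B (acts M ks X)"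
proof (induction ks arbitrary: X)
  case (Cons k ks)
  then have "act k (M k) (act j B X) = act j B (act k (M k) X)" by (intro act_commute) auto
  with Cons show ?case by (simp add: acts_Cons)
qed simp

lemma acts_remove1:
  assumes "distinct ks" "j \<in> set ks"
  shows "acts M ks X = act j (M j) (acts M (remove1 j ks) X)"
  using assms
proof (induction ks)
  case (Cons k ks)
  show ?case
  proof (cases "j = k")
    case False
    then have "acts M (k # ks) X = act k (M k) (act j (M j) (acts M (remove1 j ks) X))"
      using Cons by (simp add: acts_Cons acts_act_commute)
    also have "\<dots> = act j (M j) (act k (M k) (acts M (remove1 j ks) X))"
      using False by (intro act_commute) auto
    finally show ?thesis using False Cons.prems by (simp add: acts_Cons acts_act_commute)
  qed (use Cons.prems in \<open>simp add: acts_Cons acts_act_commute\<close>)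
qed simp

lemma acts_adjoint:
  "distinct ks \<Longrightarrow> inner (acts M ks X) Y = inner X (acts (\<lambda>k. transpose_mat (M k)) ks Y)"
  by (induction ks arbitrary: X Y) (auto simp: acts_Cons act_adjoint acts_act_commute)

lemma acts_compose:
  assumes "distinct ks" "\<And>k. k \<in> set ks \<Longrightarrow> dim_col (B k) = dim_row (A k)"
  shows "acts B ks (acts A ks X) = acts (\<lambda>k. B k * A k) ks X"
  using assms
proof (induction ks arbitrary: X)
  case (Cons k ks)
  then show ?case by (simp add: acts_Cons acts_act_commute act_compose)
qed simp

lemma acts_tspace:
  assumes "X \<in> tspace ns" "length ns' = length ns"
    "\<And>l. l < length ns \<Longrightarrow> ns' ! l = (if l \<in> set ks then dim_row (M l) else ns ! l)"
    "\<And>k. k \<in> set ks \<Longrightarrow> k < length ns"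
  shows "acts M ks X \<in> tspace ns'"
  using assms
proof (induction ks arbitrary: X ns)
  case Nil
  then have "ns' = ns" by (auto intro: nth_equalityI)
  with Nil show ?case by simp
next
  case (Cons k ks)
  have "act k (M k) X \<in> tspace (ns[k := dim_row (M k)])"
    using Cons.prems by (intro act_tspace[OF Cons.prems(1)]) auto
  then show ?case unfolding acts_Cons
    by (rule Cons.IH) (use Cons.prems in \<open>auto simp: nth_list_update\<close>)
qed

lemma acts_tspace_same:
  "X \<in> tspace ns \<Longrightarrow> (\<And>k. k \<in> set ks \<Longrightarrow> k < length ns \<and> dim_row (M k) = ns ! k) \<Longrightarrow> acts M ks X \<in> tspace ns"
  by (rule acts_tspace) auto

lemma mode_prods_acts:
  assumes "X \<in> tspace ns" "distinct ks" "\<And>k. k \<in> set ks \<Longrightarrow> k < length ns \<and> dim_col (M k) = ns ! k"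
  shows "mode_prods ns X (map (\<lambda>k. (k, M k)) ks) = acts M ks X"
  using assms
proof (induction ks arbitrary: X ns)
  case (Cons k ks)
  have "mode_prod ns X k (M k) = act k (M k) X" using Cons.prems by (intro mode_prod_act) auto
  moreover have "act k (M k) X \<in> tspace (ns[k := dim_row (M k)])"
    using Cons.prems by (intro act_tspace[OF Cons.prems(1)]) auto
  moreover have "mode_prods (ns[k := dim_row (M k)]) (act k (M k) X) (map (\<lambda>k. (k, M k)) ks) =
      acts M ks (act k (M k) X)"
  proof (rule Cons.IH)
    show "i < length (ns[k := dim_row (M k)]) \<and> dim_col (M i) = ns[k := dim_row (M k)] ! i"
      if "i \<in> set ks" for i
      using that Cons.prems by (metis distinct.simps(2) length_list_update list.set_intros(2) nth_list_update_neq)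
  qed (use Cons.prems calculation in auto)
  ultimately show ?case by (simp add: acts_Cons)
qed simp

lemma comprehension_filter:
  "[(k, M k). k \<leftarrow> ks, P k] = map (\<lambda>k. (k, M k)) (filter P ks)"
  by (induction ks) auto

lemma acts_fixed: "(\<And>k. k \<in> set ks \<Longrightarrow> act k (M k) X = X) \<Longrightarrow> acts M ks X = X"
  by (induction ks) (auto simp: acts_Cons)

subsection \<open>Norms and limits\<close>

lemma norm_act_projection:
  assumes "transpose_mat P = P" "P * P = P"
  shows "norm (act k P X) \<le> norm X"
proof -
  have "dim_col P = dim_row P" using assms(1) by (metis index_transpose_mat(2))
  then have "inner (act k P X) (act k P X) = inner X (act k P X)"
    by (subst act_adjoint) (simp add: assms act_compose)
  then have "(norm (act k P X))\<^sup>2 \<le> norm X * norm (act k P X)"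
    using norm_cauchy_schwarz[of X "act k P X"] by (simp add: power2_norm_eq_inner)
  then show ?thesis by (metis mult_le_cancel_right norm_ge_zero norm_zero not_less_iff_gr_or_eq power2_eq_square order_less_le)
qed

lemma inner_acts_stiefel:
  assumes "X \<in> tspace ns" "distinct ks"
    "\<And>k. k \<in> set ks \<Longrightarrow> k < length ns \<and> M k \<in> stiefel (ns ! k) (m k)"
  shows "inner (acts M ks X) (acts M ks Y) = inner X Y"
proof -
  have "acts (\<lambda>k. transpose_mat (M k)) ks (acts M ks X) = acts (\<lambda>k. transpose_mat (M k) * M k) ks X"
    using assms by (intro acts_compose) auto
  also have "\<dots> = acts (\<lambda>k. 1\<^sub>m (ns ! k)) ks X"
    using assms stiefel_left_inverse by (intro acts_cong) blast
  also have "\<dots> = X" using assms by (intro acts_fixed act_one) auto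
  finally show ?thesis using acts_adjoint[OF assms(2), of M Y "acts M ks X"] by (simp add: inner_commute)
qed

lemma lookup_le_norm: "\<bar>Poly_Mapping.lookup X \<alpha>\<bar> \<le> norm (X :: tensor)"
proof -
  have "Poly_Mapping.lookup X \<alpha> = inner (Poly_Mapping.single \<alpha> 1) X" by (simp add: inner_single)
  also have "\<bar>\<dots>\<bar> \<le> norm (Poly_Mapping.single \<alpha> (1::real)) * norm X" by (rule Cauchy_Schwarz_ineq2)
  also have "norm (Poly_Mapping.single \<alpha> (1::real)) = 1" by (simp add: norm_eq_sqrt_inner inner_single)
  finally show ?thesis by simp
qed

lemma tendsto_lookup:
  assumes "(X :: nat \<Rightarrow> tensor) \<longlonglongrightarrow> L"
  shows "(\<lambda>t. Poly_Mapping.lookup (X t) \<alpha>) \<longlonglongrightarrow> Poly_Mapping.lookup L \<alpha>"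
proof (rule LIM_zero_cancel, rule Lim_null_comparison[OF always_eventually])
  show "\<forall>t. norm (Poly_Mapping.lookup (X t) \<alpha> - Poly_Mapping.lookup L \<alpha>) \<le> norm (X t - L)"
    using lookup_le_norm[of "X _ - L" \<alpha>] by (simp add: lookup_minus)
  show "(\<lambda>t. norm (X t - L)) \<longlonglongrightarrow> 0" using assms by (simp add: LIM_zero tendsto_norm_zero)
qed

lemma unfolding_tendsto: "X \<longlonglongrightarrow> L \<Longrightarrow> mat_tendsto (\<lambda>t. unfolding_mat ns k (X t)) (unfolding_mat ns k L)"
  by (auto simp: mat_tendsto_def unfolding_mat_def intro!: tendsto_lookup)

lemma tspace_closed:
  assumes "\<And>t::nat. X t \<in> tspace ns" "X \<longlonglongrightarrow> L"
  shows "L \<in> tspace ns"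
proof -
  have "Poly_Mapping.lookup L \<alpha> = 0" if "\<alpha> \<notin> midx ns" for \<alpha>
    using tendsto_lookup[OF assms(2), of \<alpha>] lookup_outside_tspace[OF assms(1) that] LIMSEQ_unique[OF _ tendsto_const] by auto
  then show ?thesis by (auto simp: tspace_def in_keys_iff)
qed

section \<open>The variety of tensors of bounded Tucker rank\<close>

abbreviation mrank :: "nat list \<Rightarrow> nat \<Rightarrow> tensor \<Rightarrow> nat" where
  "mrank ns k X \<equiv> mat_rank (unfolding_mat ns k X)"

lemma length_tucker_rank [simp]: "length (tucker_rank ns X) = length ns"
  by (simp add: tucker_rank_def)

lemma tucker_rank_nth [simp]: "k < length ns \<Longrightarrow> tucker_rank ns X ! k = mrank ns k X"
  by (simp add: tucker_rank_def)

lemma tucker_variety_iff: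
  "length rs = length ns \<Longrightarrow>
    X \<in> tucker_variety ns rs \<longleftrightarrow> X \<in> tspace ns \<and> (\<forall>k<length ns. mrank ns k X \<le> rs ! k)"
  by (auto simp: tucker_variety_def list_all2_conv_all_nth)

lemma act_fixed_iff:
  assumes "X \<in> tspace ns" "k < length ns" "A \<in> carrier_mat (ns ! k) (ns ! k)"
  shows "act k A X = X \<longleftrightarrow> A * unfolding_mat ns k X = unfolding_mat ns k X"
proof
  assume "A * unfolding_mat ns k X = unfolding_mat ns k X"
  then show "act k A X = X"
    using assms by (intro unfolding_mat_inject[of _ ns _ k]) (auto simp: unfolding_mat_act_same act_tspace_same)
qed (use assms unfolding_mat_act_same in metis)

lemma mode_basis:
  assumes "X \<in> tspace ns" "k < length ns"
  obtains U C where "U \<in> stiefel (mrank ns k X) (ns ! k)" "act k (proj_mat U) X = X"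
    "C \<in> carrier_mat (nminus ns k) (mrank ns k X)" "U = unfolding_mat ns k X * C"
proof -
  have "unfolding_mat ns k X \<in> carrier_mat (ns ! k) (nminus ns k)" by (auto intro: carrier_matI)
  from exists_column_space_basis[OF this] obtain U C where
    U: "U \<in> stiefel (mrank ns k X) (ns ! k)" and C: "C \<in> carrier_mat (nminus ns k) (mrank ns k X)"
    and UC: "U = unfolding_mat ns k X * C"
    and P: "U * transpose_mat U * unfolding_mat ns k X = unfolding_mat ns k X" .
  have "act k (proj_mat U) X = X"
    using P proj_mat_carrier[OF U] assms by (subst act_fixed_iff) (auto simp: proj_mat_def)
  with that U C UC show ?thesis by blast
qed

lemma mrank_le_of_fixed:
  assumes "X \<in> tspace ns" "k < length ns" "act k (B * L) X = X"
    "B \<in> carrier_mat (ns ! k) r" "L \<in> carrier_mat r (ns ! k)"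
  shows "mrank ns k X \<le> r"
proof -
  have "B * L * unfolding_mat ns k X = unfolding_mat ns k X"
    using act_fixed_iff[OF assms(1,2), of "B * L"] assms by auto
  then have "B * (L * unfolding_mat ns k X) = unfolding_mat ns k X"
    using assms by (simp add: mat_assoc)
  then show ?thesis
    using assms by (intro mat_rank_le_of_fixed[of B "ns ! k" r _ _ "nminus ns k"]) (auto intro: carrier_matI)
qed

text \<open>A product in one mode does not raise any multilinear rank: in its own mode the columns are mapped
  linearly, and in another mode \<open>k\<close> it commutes with the projector that fixes \<open>X\<close>.\<close>

lemma mrank_act_le:
  assumes X: "X \<in> tspace ns" and k: "k < length ns" and j: "j < length ns"
    and A: "A \<in> carrier_mat (ns ! j) (ns ! j)"
  shows "mrank ns k (act j A X) \<le> mrank ns k X"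
proof -
  obtain U where U: "U \<in> stiefel (mrank ns k X) (ns ! k)" and P: "act k (proj_mat U) X = X"
    using mode_basis[OF X k] by blast
  have Uc: "U \<in> carrier_mat (ns ! k) (mrank ns k X)" using U by auto
  show ?thesis
  proof (cases "k = j")
    case False
    have "act k (U * transpose_mat U) (act j A X) = act j A X"
      using P False by (simp add: act_commute[of k j] proj_mat_def)
    then show ?thesis using Uc X A k by (intro mrank_le_of_fixed) (auto intro: act_tspace_same)
  next
    case True
    have "A * U * (transpose_mat U * unfolding_mat ns k X) = A * (proj_mat U * unfolding_mat ns k X)"
      using A Uc True by (simp add: proj_mat_def mat_assoc)
    also have "\<dots> = unfolding_mat ns k (act j A X)"
      using P A True k X proj_mat_carrier[OF U] by (simp add: unfolding_mat_act_same act_fixed_iff)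
    finally show ?thesis
      using A Uc True by (intro mat_rank_le_of_fixed[of "A * U" "ns ! k" _ _ _ "nminus ns k"]) (auto intro: carrier_matI)
  qed
qed

lemma act_in_variety:
  assumes "length rs = length ns" "X \<in> tucker_variety ns rs" "k < length ns"
    "A \<in> carrier_mat (ns ! k) (ns ! k)"
  shows "act k A X \<in> tucker_variety ns rs"
  using assms mrank_act_le[of X ns _ k A]
  by (auto simp: tucker_variety_iff act_tspace_same intro: order_trans)

section \<open>A criterion for stationarity\<close>

subsection \<open>Entrywise limits of tensors\<close>

definition entrywise :: "(nat \<Rightarrow> tensor) \<Rightarrow> tensor \<Rightarrow> bool" where
  "entrywise X L \<longleftrightarrow> (\<forall>\<alpha>. (\<lambda>t. Poly_Mapping.lookup (X t) \<alpha>) \<longlonglongrightarrow> Poly_Mapping.lookup L \<alpha>)"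

lemma entrywise_unique: "entrywise X L \<Longrightarrow> entrywise X M \<Longrightarrow> L = M"
  by (rule poly_mapping_eqI) (auto simp: entrywise_def intro: LIMSEQ_unique)

lemma entrywise_act:
  assumes "mat_tendsto M M0" "entrywise X L"
  shows "entrywise (\<lambda>t. act k (M t) (X t)) (act k M0 L)"
proof -
  have d: "dim_row (M t) = dim_row M0" "dim_col (M t) = dim_col M0" for t
    using assms by (auto simp: mat_tendsto_def)
  show ?thesis
    using assms unfolding entrywise_def lookup_act d
    by (auto simp: mat_tendsto_def intro!: tendsto_sum tendsto_mult)
qed

lemma entrywise_acts:
  assumes "\<And>k. k \<in> set ks \<Longrightarrow> mat_tendsto (\<lambda>t. M t k) (M0 k)" "entrywise X L"
  shows "entrywise (\<lambda>t. acts (M t) ks (X t)) (acts M0 ks L)"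
  using assms
proof (induction ks arbitrary: X L)
  case (Cons k ks)
  then show ?case unfolding acts_Cons by (intro Cons.IH entrywise_act) auto
qed simp

lemma entrywise_inner:
  assumes "\<And>t. W t \<in> tspace ns" "L \<in> tspace ns" "entrywise A A0" "entrywise W L"
  shows "(\<lambda>t. inner (A t) (W t)) \<longlonglongrightarrow> inner A0 L"
proof -
  have "inner A X = (\<Sum>\<alpha>\<in>midx ns. Poly_Mapping.lookup X \<alpha> * Poly_Mapping.lookup A \<alpha>)" if "X \<in> tspace ns" for A X
    unfolding inner_commute[of A X]
    using that by (subst inner_poly_mapping_superset[OF finite_midx[of ns]]) (auto simp: tspace_def)
  then show ?thesis
    using assms by (auto simp: entrywise_def intro!: tendsto_sum tendsto_mult)
qed

lemma tendsto_entrywise: "X \<longlonglongrightarrow> L \<Longrightarrow> entrywise X L"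
  by (simp add: entrywise_def tendsto_lookup)

subsection \<open>Reduction to the tangent cone\<close>

text \<open>For an element \<open>w\<close> of the cone, \<open>dist a w\<^sup>2 = \<parallel>a\<parallel>\<^sup>2 - 2 \<langle>a, w\<rangle> + \<parallel>w\<parallel>\<^sup>2\<close> exceeds
  \<open>dist a 0\<^sup>2\<close> by at least \<open>\<parallel>w\<parallel>\<^sup>2\<close> if \<open>\<langle>a, w\<rangle> \<le> 0\<close>.\<close>

lemma stationary_if_polar:
  assumes X: "X \<in> tucker_variety ns rs"
    and le: "\<And>v. v \<in> tangent_cone (tucker_variety ns rs) X \<Longrightarrow> inner (- g X) v \<le> 0"
  shows "stationary ns rs g X"
proof -
  let ?T = "tangent_cone (tucker_variety ns rs) X"
  let ?a = "- g X"
  have 0: "0 \<in> ?T" unfolding tangent_cone_def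
    using X lim_inverse_n' LIMSEQ_inverse_real_of_nat
    by (auto intro!: exI[of _ "\<lambda>_. X"] exI[of _ "\<lambda>n. inverse (real (Suc n))"])
  have d: "(dist ?a w)\<^sup>2 \<ge> (dist ?a 0)\<^sup>2 + (norm w)\<^sup>2" if "w \<in> ?T" for w
    using le[OF that] by (simp add: dist_norm power2_norm_eq_inner inner_diff_left inner_diff_right inner_commute)
  have "metric_projection ?T ?a = {0}"
  proof (rule equalityI; rule subsetI)
    fix v assume v: "v \<in> metric_projection ?T ?a"
    then have "v \<in> ?T" and "dist ?a v \<le> dist ?a 0" using 0 by (auto simp: metric_projection_def)
    have "(norm v)\<^sup>2 \<le> 0"
      using d[OF \<open>v \<in> ?T\<close>] power_mono[OF \<open>dist ?a v \<le> dist ?a 0\<close> zero_le_dist, of 2] by linarith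
    then have "norm v = 0" using zero_le_power2[of "norm v"] by (metis order_antisym zero_eq_power2)
    then show "v \<in> {0}" by (metis norm_eq_zero singletonI)
  next
    fix v :: tensor assume v: "v \<in> {0}"
    have "dist ?a 0 \<le> dist ?a w" if "w \<in> ?T" for w
    proof (rule power2_le_imp_le)
      show "(dist ?a 0)\<^sup>2 \<le> (dist ?a w)\<^sup>2"
        using d[OF that] zero_le_power2[of "norm w"] by linarith
    qed (rule zero_le_dist)
    with v 0 show "v \<in> metric_projection ?T ?a" unfolding metric_projection_def by blast
  qed
  then show ?thesis using X by (simp add: stationary_def)
qed

lemma tangent_cone_tspace:
  assumes "X \<in> tucker_variety ns rs" "v \<in> tangent_cone (tucker_variety ns rs) X"
  shows "v \<in> tspace ns"
proof -
  obtain y s where "\<And>i. y i \<in> tucker_variety ns rs" "(\<lambda>i::nat. (y i - X) /\<^sub>R s i) \<longlonglongrightarrow> v"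
    using assms(2) by (auto simp: tangent_cone_def)
  then show ?thesis
    using assms(1) tspace_closed[of "\<lambda>i. (y i - X) /\<^sub>R s i" ns v] tspace_scaleR tspace_diff
    by (auto simp: tucker_variety_def)
qed

text \<open>The unfoldings of the points on a curve tangent to \<open>v\<close> have at most the rank of that of \<open>X\<close>, so that
  \<open>maximal_rank_tangent\<close> applies to them.\<close>

lemma tangent_normal_part:
  assumes len: "length rs = length ns" and X: "X \<in> tucker_variety ns rs"
    and k: "k < length ns" and full: "mrank ns k X = rs ! k"
    and v: "v \<in> tangent_cone (tucker_variety ns rs) X"
    and U0: "U0 \<in> stiefel (mrank ns k X) (ns ! k)" and PX: "act k (proj_mat U0) X = X"
    and C: "C \<in> carrier_mat (nminus ns k) (mrank ns k X)" "U0 = unfolding_mat ns k X * C"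
  shows "\<exists>N \<in> carrier_mat (ns ! k) (ns ! k).
    act k (1\<^sub>m (ns ! k) - proj_mat U0) v = act k ((1\<^sub>m (ns ! k) - proj_mat U0) * N) X"
proof -
  let ?n = "ns ! k"
  let ?u = "unfolding_mat ns k"
  obtain y s where y: "\<And>i. y i \<in> tucker_variety ns rs" and s: "\<And>i::nat. s i > 0"
    and lim: "y \<longlonglongrightarrow> X" "(\<lambda>i. (y i - X) /\<^sub>R s i) \<longlonglongrightarrow> v"
    using v by (auto simp: tangent_cone_def)
  have Xs: "X \<in> tspace ns" and ys: "\<And>i. y i \<in> tspace ns" using X y by (auto simp: tucker_variety_def)
  have vs: "v \<in> tspace ns" by (rule tangent_cone_tspace[OF X v])
  have "\<exists>U. U \<in> stiefel (mrank ns k (y i)) ?n \<and> act k (proj_mat U) (y i) = y i" for i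
    using mode_basis[OF ys k] by metis
  then obtain U where U: "\<And>i. U i \<in> stiefel (mrank ns k (y i)) ?n" "\<And>i. act k (proj_mat (U i)) (y i) = y i"
    by metis
  have PY: "proj_mat (U i) * ?u (y i) = ?u (y i)" for i
    using U proj_mat_carrier[OF U(1)] ys k act_fixed_iff by blast
  have P: "mat_tendsto (\<lambda>i. proj_mat (U i)) (proj_mat U0)"
  proof (rule proj_mat_tendsto[where n = ?n and m = "nminus ns k" and C = C])
    show "mat_tendsto (\<lambda>i. ?u (y i)) (?u X)" by (rule unfolding_tendsto[OF lim(1)])
    show "mrank ns k (y i) \<le> mrank ns k X" for i
      using y[of i] k full len by (simp add: tucker_variety_iff)
  qed (use U PY U0 C in \<open>auto intro: carrier_matI\<close>)
  have Pc: "proj_mat U0 \<in> carrier_mat ?n ?n" by (rule proj_mat_carrier[OF U0])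
  have "\<exists>N \<in> carrier_mat ?n ?n. (1\<^sub>m ?n - proj_mat U0) * ?u v = (1\<^sub>m ?n - proj_mat U0) * N * ?u X"
  proof (rule maximal_rank_tangent[where s = s and Y = "\<lambda>i. ?u (y i)" and P = "\<lambda>i. proj_mat (U i)"
        and m = "nminus ns k"])
    show "mat_tendsto (\<lambda>i. ?u ((y i - X) /\<^sub>R s i)) (?u v)" by (rule unfolding_tendsto[OF lim(2)])
    show "?u (y i) = ?u X + s i \<cdot>\<^sub>m ?u ((y i - X) /\<^sub>R s i)" for i
      using s[of i] by (intro eq_matI) (auto simp: unfolding_mat_def lookup_minus divide_simps)
    show "s i \<noteq> 0" for i using s[of i] by simp
    show "proj_mat U0 * ?u X = ?u X" using PX Pc Xs k act_fixed_iff by blast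
  qed (use P PY Pc proj_mat_idem[OF U0] in \<open>auto intro: carrier_matI\<close>)
  then obtain N where N: "N \<in> carrier_mat ?n ?n"
    and e: "(1\<^sub>m ?n - proj_mat U0) * ?u v = (1\<^sub>m ?n - proj_mat U0) * N * ?u X" by blast
  have R: "1\<^sub>m ?n - proj_mat U0 \<in> carrier_mat ?n ?n" using Pc by auto
  have "act k (1\<^sub>m ?n - proj_mat U0) v = act k ((1\<^sub>m ?n - proj_mat U0) * N) X"
  proof (rule unfolding_mat_inject[of _ ns _ k])
    show "?u (act k (1\<^sub>m ?n - proj_mat U0) v) = ?u (act k ((1\<^sub>m ?n - proj_mat U0) * N) X)"
      using e R N k by (subst (1 2) unfolding_mat_act_same) auto
  qed (use k R N Xs vs in \<open>auto intro!: act_tspace_same\<close>)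
  with N show ?thesis by blast
qed

text \<open>Let \<open>K\<close> be the set of modes in which \<open>X\<close> has full rank. A tangent vector \<open>v\<close> splits into
  its normal parts in the modes of \<open>K\<close> and \<open>v \<times>\<^bsub>k\<in>K\<^esub> P\<^sub>k\<close>. The normal part in a mode \<open>k\<close> is a mode
  product of \<open>X\<close>, hence it is unchanged by the projectors of the other modes, and the parts can be
  removed one after the other.\<close>

lemma stationary_if_orthogonal:
  assumes len: "length rs = length ns" and X: "X \<in> tucker_variety ns rs"
    and K: "K = filter (\<lambda>k. mrank ns k X = rs ! k) [0..<length ns]"
    and U: "\<And>k. k \<in> set K \<Longrightarrow> U k \<in> stiefel (mrank ns k X) (ns ! k) \<and> act k (proj_mat (U k)) X = X"
    and C: "\<And>k. k \<in> set K \<Longrightarrow> C k \<in> carrier_mat (nminus ns k) (mrank ns k X) \<and> U k = unfolding_mat ns k X * C k"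
    and tangential: "acts (\<lambda>k. proj_mat (U k)) K (- g X) = 0"
    and normal: "\<And>k N. k \<in> set K \<Longrightarrow> N \<in> carrier_mat (ns ! k) (ns ! k) \<Longrightarrow>
      inner (- g X) (act k ((1\<^sub>m (ns ! k) - proj_mat (U k)) * N) X) = 0"
  shows "stationary ns rs g X"
proof (rule stationary_if_polar[OF X])
  fix v assume v: "v \<in> tangent_cone (tucker_variety ns rs) X"
  let ?P = "\<lambda>k. proj_mat (U k)"
  have Kd: "distinct K" and Kl: "\<And>k. k \<in> set K \<Longrightarrow> k < length ns \<and> mrank ns k X = rs ! k" by (auto simp: K)
  have Xs: "X \<in> tspace ns" using X by (auto simp: tucker_variety_def)
  have vs: "v \<in> tspace ns" by (rule tangent_cone_tspace[OF X v])
  have "inner (- g X) (acts ?P ks v) = inner (- g X) v" if "distinct ks" "set ks \<subseteq> set K" for ks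
    using that
  proof (induction ks)
    case (Cons k ks)
    then have kK: "k \<in> set K" and kn: "k \<notin> set ks" and k: "k < length ns" using Kl by auto
    let ?R = "1\<^sub>m (ns ! k) - ?P k"
    have Pc: "?P k \<in> carrier_mat (ns ! k) (ns ! k)" using U[OF kK] by (auto intro: proj_mat_carrier)
    obtain N where N: "N \<in> carrier_mat (ns ! k) (ns ! k)" and e: "act k ?R v = act k (?R * N) X"
      using tangent_normal_part[OF len X k _ v] U[OF kK] C[OF kK] Kl[OF kK] by blast
    have w: "acts ?P ks v \<in> tspace ns"
      using Cons.prems U Kl proj_mat_carrier by (intro acts_tspace_same[OF vs]) (metis carrier_matD(1) list.set_intros(2) subsetD)
    \<comment> \<open>the new projector removes the normal part in mode \<open>k\<close>, to which the gradient is orthogonal\<close>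
    have "acts ?P (k # ks) v = act k (?P k) (acts ?P ks v)"
      using kn by (simp add: acts_Cons acts_act_commute)
    also have "\<dots> = acts ?P ks v - act k ?R (acts ?P ks v)"
      using Pc act_one[OF w k] by (subst act_minus_mat) auto
    also have "act k ?R (acts ?P ks v) = acts ?P ks (act k ?R v)"
      using kn by (simp add: acts_act_commute)
    also have "\<dots> = act k (?R * N) (acts ?P ks X)"
      using kn by (simp add: e acts_act_commute)
    also have "acts ?P ks X = X" using Cons.prems U by (intro acts_fixed) auto
    finally show ?case using normal[OF kK N] Cons by (simp add: inner_diff_right)
  qed simp
  from this[OF Kd] have "inner (- g X) v = inner (- g X) (acts ?P K v)" by simp
  also have "\<dots> = inner (acts ?P K (- g X)) v"
    using acts_adjoint[OF Kd, of ?P] by (simp add: proj_mat_symmetric)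
  finally show "inner (- g X) v \<le> 0" by (simp add: tangential)
qed

text \<open>Both conditions of the previous lemma are limits of expressions in the projectors of nearby points,
  because these projectors converge in the modes of \<open>K\<close>.\<close>

lemma stationary_limit:
  assumes len: "length rs = length ns" and X: "X \<in> tucker_variety ns rs"
    and K: "K = filter (\<lambda>k. mrank ns k X = rs ! k) [0..<length ns]"
    and Z: "\<And>t. Z t \<in> tucker_variety ns rs" "Z \<longlonglongrightarrow> X" and A: "A \<longlonglongrightarrow> - g X"
    and U: "\<And>t k. k < length ns \<Longrightarrow> U t k \<in> stiefel (mrank ns k (Z t)) (ns ! k)"
    and PZ: "\<And>t k. k < length ns \<Longrightarrow> act k (proj_mat (U t k)) (Z t) = Z t"
    and tangential: "(\<lambda>t. acts (\<lambda>k. proj_mat (U t k)) K (A t)) \<longlonglongrightarrow> 0"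
    and normal: "\<And>k N. k \<in> set K \<Longrightarrow> N \<in> carrier_mat (ns ! k) (ns ! k) \<Longrightarrow>
      (\<lambda>t. inner (A t) (act k ((1\<^sub>m (ns ! k) - proj_mat (U t k)) * N) (Z t))) \<longlonglongrightarrow> 0"
  shows "stationary ns rs g X"
proof -
  have Xs: "X \<in> tspace ns" and Zs: "\<And>t. Z t \<in> tspace ns" using X Z by (auto simp: tucker_variety_def)
  have Kl: "\<And>k. k \<in> set K \<Longrightarrow> k < length ns \<and> mrank ns k X = rs ! k" by (auto simp: K)
  have "\<exists>U0 C. U0 \<in> stiefel (mrank ns k X) (ns ! k) \<and> act k (proj_mat U0) X = X \<and>
    C \<in> carrier_mat (nminus ns k) (mrank ns k X) \<and> U0 = unfolding_mat ns k X * C" if "k < length ns" for k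
    using mode_basis[OF Xs that] by metis
  then obtain U0 C where U0: "\<And>k. k < length ns \<Longrightarrow> U0 k \<in> stiefel (mrank ns k X) (ns ! k) \<and> act k (proj_mat (U0 k)) X = X"
    and C: "\<And>k. k < length ns \<Longrightarrow> C k \<in> carrier_mat (nminus ns k) (mrank ns k X) \<and> U0 k = unfolding_mat ns k X * C k"
    by metis
  have P: "mat_tendsto (\<lambda>t. proj_mat (U t k)) (proj_mat (U0 k))" if "k \<in> set K" for k
  proof (rule proj_mat_tendsto[where n = "ns ! k" and m = "nminus ns k" and C = "C k"])
    have k: "k < length ns" using Kl that by auto
    show "mat_tendsto (\<lambda>t. unfolding_mat ns k (Z t)) (unfolding_mat ns k X)" by (rule unfolding_tendsto[OF Z(2)])
    show "mrank ns k (Z t) \<le> mrank ns k X" for t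
      using Z(1)[of t] Kl[OF that] len by (simp add: tucker_variety_iff)
    show "proj_mat (U t k) * unfolding_mat ns k (Z t) = unfolding_mat ns k (Z t)" for t
      using U[OF k] PZ[OF k] Zs k act_fixed_iff proj_mat_carrier by metis
    show "U0 k \<in> stiefel (mrank ns k X) (ns ! k)" "C k \<in> carrier_mat (nminus ns k) (mrank ns k X)"
      "U0 k = unfolding_mat ns k X * C k" "\<And>t. U t k \<in> stiefel (mrank ns k (Z t)) (ns ! k)"
      using U0[OF k] C[OF k] U[OF k] by blast+
  qed (auto intro: carrier_matI)
  show ?thesis
  proof (rule stationary_if_orthogonal[OF len X K, of U0 C])
    have "entrywise (\<lambda>t. acts (\<lambda>k. proj_mat (U t k)) K (A t)) (acts (\<lambda>k. proj_mat (U0 k)) K (- g X))"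
      by (rule entrywise_acts[OF P tendsto_entrywise[OF A]])
    with tendsto_entrywise[OF tangential] show "acts (\<lambda>k. proj_mat (U0 k)) K (- g X) = 0"
      by (rule entrywise_unique[rotated])
    fix k and N :: "real mat" assume kK: "k \<in> set K" and N: "N \<in> carrier_mat (ns ! k) (ns ! k)"
    then have k: "k < length ns" using Kl by auto
    have Pc: "proj_mat (U t k) \<in> carrier_mat (ns ! k) (ns ! k)" for t using U[OF k] by (rule proj_mat_carrier)
    have P0c: "proj_mat (U0 k) \<in> carrier_mat (ns ! k) (ns ! k)" using U0[OF k] by (auto intro: proj_mat_carrier)
    have "mat_tendsto (\<lambda>t. (1\<^sub>m (ns ! k) - proj_mat (U t k)) * N) ((1\<^sub>m (ns ! k) - proj_mat (U0 k)) * N)"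
      using N P0c by (intro mat_tendsto_mult mat_tendsto_minus mat_tendsto_const P[OF kK]) auto
    from entrywise_act[OF this tendsto_entrywise[OF Z(2)], of k]
    have "(\<lambda>t. inner (A t) (act k ((1\<^sub>m (ns ! k) - proj_mat (U t k)) * N) (Z t)))
        \<longlonglongrightarrow> inner (- g X) (act k ((1\<^sub>m (ns ! k) - proj_mat (U0 k)) * N) X)"
      using Zs Xs Pc[THEN carrier_matD(1)] P0c by (intro entrywise_inner[where ns = ns] tendsto_entrywise[OF A]) (auto intro!: act_tspace_same)
    from LIMSEQ_unique[OF this normal[OF kK N]]
    show "inner (- g X) (act k ((1\<^sub>m (ns ! k) - proj_mat (U0 k)) * N) X) = 0" .
  qed (insert Kl U0 C, blast+)
qed

section \<open>The partial projection\<close>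

subsection \<open>Tucker decompositions\<close>

lemma tucker_decompositionD:
  assumes "tucker_decomposition ns X G U"
  shows "G \<in> tspace (tucker_rank ns X)"
    and "k < length ns \<Longrightarrow> U k \<in> stiefel (mrank ns k X) (ns ! k)"
    and "X = acts U [0..<length ns] G"
proof -
  show G: "G \<in> tspace (tucker_rank ns X)"
    and U: "k < length ns \<Longrightarrow> U k \<in> stiefel (mrank ns k X) (ns ! k)" for k
    using assms by (auto simp: tucker_decomposition_def)
  have "X = mode_prods (tucker_rank ns X) G (map (\<lambda>k. (k, U k)) [0..<length ns])"
    using assms by (simp add: tucker_decomposition_def)
  also have "\<dots> = acts U [0..<length ns] G"
  proof (rule mode_prods_acts[OF G])
    show "k < length (tucker_rank ns X) \<and> dim_col (U k) = tucker_rank ns X ! k" if "k \<in> set [0..<length ns]" for k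
      using U[of k] that by auto
  qed simp
  finally show "X = acts U [0..<length ns] G" .
qed

lemma acts_split_mode:
  assumes "k < d"
  shows "acts M [0..<d] X = act k (M k) (acts M (filter (\<lambda>j. j \<noteq> k) [0..<d]) X)"
proof -
  have "remove1 k [0..<d] = filter (\<lambda>j. j \<noteq> k) [0..<d]"
    by (simp add: distinct_remove1_removeAll removeAll_filter_not_eq) metis
  then show ?thesis using acts_remove1[of "[0..<d]" k M X] assms by simp
qed

lemma tucker_decomposition_fixed:
  assumes "tucker_decomposition ns X G U" "k < length ns"
  shows "act k (proj_mat (U k)) X = X"
proof -
  have U: "U k \<in> stiefel (mrank ns k X) (ns ! k)" using tucker_decompositionD(2)[OF assms(1)] assms(2) .
  let ?Y = "acts U (filter (\<lambda>j. j \<noteq> k) [0..<length ns]) G"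
  have X: "X = act k (U k) ?Y"
    using tucker_decompositionD(3)[OF assms(1)] acts_split_mode[OF assms(2)] by simp
  have "act k (proj_mat (U k)) (act k (U k) ?Y) = act k (proj_mat (U k) * U k) ?Y"
    by (rule act_compose) (simp add: proj_mat_def)
  also have "proj_mat (U k) * U k = U k"
    using U by (auto dest!: stiefel_carrier simp: proj_mat_def mat_assoc stiefel_left_inverse[OF U])
  finally show ?thesis using X by simp
qed

text \<open>A rank-deficient unfolding of the core would give \<open>X\<close> a smaller rank than the number of
  columns of the factor.\<close>

lemma core_right_inverse:
  assumes T: "tucker_decomposition ns X G U" and X: "X \<in> tspace ns" and k: "k < length ns"
  obtains R where "R \<in> carrier_mat (nminus (tucker_rank ns X) k) (mrank ns k X)"
    "unfolding_mat (tucker_rank ns X) k G * R = 1\<^sub>m (mrank ns k X)"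
proof -
  define us where "us = tucker_rank ns X"
  define r where "r = mrank ns k X"
  have us: "us ! k = r" "length us = length ns" using k by (auto simp: us_def r_def)
  let ?G = "unfolding_mat us k G"
  have Gc: "?G \<in> carrier_mat r (nminus us k)" using us by (auto intro: carrier_matI)
  have Gs: "G \<in> tspace us" using tucker_decompositionD(1)[OF T] by (simp add: us_def)
  have Uk: "U k \<in> stiefel r (ns ! k)" using tucker_decompositionD(2)[OF T k] by (simp add: r_def)
  have Ukc: "U k \<in> carrier_mat (ns ! k) r" using Uk by auto
  obtain W C where W: "W \<in> stiefel (mat_rank ?G) r" and C: "C \<in> carrier_mat (nminus us k) (mat_rank ?G)"
    and WC: "W = ?G * C" and WG: "W * transpose_mat W * ?G = ?G"
    using exists_column_space_basis[OF Gc] .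
  have Wc: "W \<in> carrier_mat r (mat_rank ?G)" using W by auto
  let ?js = "filter (\<lambda>j. j \<noteq> k) [0..<length ns]"
  have XY: "X = act k (U k) (acts U ?js G)"
    using tucker_decompositionD(3)[OF T] acts_split_mode[OF k] by simp
  have G': "act k (W * transpose_mat W) G = G"
    using Gs us k Wc WG by (subst act_fixed_iff[of _ us]) auto
  have "act k (U k * W * (transpose_mat W * transpose_mat (U k))) X
      = act k (U k * W * (transpose_mat W * transpose_mat (U k)) * U k) (acts U ?js G)"
    using Ukc Wc by (subst XY, subst act_compose) auto
  also have "U k * W * (transpose_mat W * transpose_mat (U k)) * U k = U k * (W * transpose_mat W)"
    using Ukc Wc by (simp add: mat_assoc stiefel_left_inverse[OF Uk])
  also have "act k (U k * (W * transpose_mat W)) (acts U ?js G) = act k (U k) (act k (W * transpose_mat W) (acts U ?js G))"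
    using Ukc Wc by (subst act_compose) auto
  also have "act k (W * transpose_mat W) (acts U ?js G) = acts U ?js (act k (W * transpose_mat W) G)"
    by (simp add: acts_act_commute)
  finally have "act k (U k * W * (transpose_mat W * transpose_mat (U k))) X = X"
    using G' XY by simp
  then have "r \<le> mat_rank ?G"
    unfolding r_def using X k Ukc Wc by (intro mrank_le_of_fixed) (auto simp: r_def)
  with stiefel_le[OF W] have e: "mat_rank ?G = r" by simp
  have "transpose_mat W * W = 1\<^sub>m r" using stiefel_left_inverse[OF W] e by simp
  then have "W * transpose_mat W = 1\<^sub>m r"
    using Wc e by (intro mat_mult_left_right_inverse[of "transpose_mat W" r W]) auto
  then have "?G * (C * transpose_mat W) = 1\<^sub>m r" using WC C Wc Gc by (simp add: mat_assoc)
  moreover have "C * transpose_mat W \<in> carrier_mat (nminus us k) r" using C Wc by auto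
  ultimately show thesis using that by (simp add: us_def r_def)
qed

text \<open>The right inverse makes \<open>A\<^sup>T\<close> injective and hence \<open>A A\<^sup>T\<close> invertible. Then \<open>A\<^sup>\<dagger> A\<close> is the
  orthogonal projector onto the row space of \<open>A\<close>.\<close>

lemma right_pinv_mult:
  assumes A: "A \<in> carrier_mat r m" and R: "R \<in> carrier_mat m r" and AR: "A * R = 1\<^sub>m r"
  shows "right_pinv A \<in> carrier_mat m r" and "A * transpose_mat (right_pinv A * A) = A"
proof -
  let ?H = "A * transpose_mat A"
  have H: "?H \<in> carrier_mat r r" using A by auto
  have "det ?H \<noteq> 0"
  proof
    assume "det ?H = 0"
    then obtain v where v: "v \<in> carrier_vec r" "v \<noteq> 0\<^sub>v r" and Hv: "?H *\<^sub>v v = 0\<^sub>v r"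
      using det_0_iff_vec_prod_zero_field[OF H] by blast
    define w where "w = transpose_mat A *\<^sub>v v"
    have w: "w \<in> carrier_vec m" using A v by (auto simp: w_def)
    have "w \<bullet> w = v \<bullet> (A *\<^sub>v w)"
      using transpose_vec_mult_scalar[OF A w v(1)] by (simp add: w_def)
    also have "A *\<^sub>v w = 0\<^sub>v r" using A v Hv by (simp add: w_def)
    finally have "w \<bullet> w = 0" using v by simp
    then have "w = 0\<^sub>v m" using conjugate_square_eq_0_vec[OF w] by simp
    then have "transpose_mat R *\<^sub>v w = 0\<^sub>v r" using R by auto
    moreover have "transpose_mat R *\<^sub>v w = transpose_mat (A * R) *\<^sub>v v"
      using A R v by (simp add: w_def transpose_mult[OF A R])
    ultimately show False using AR v by simp
  qed
  from det_non_zero_imp_unit[OF H this, where b = "()"] mat_inverse(1)[OF H, where b = "()"]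
  obtain B where "mat_inverse ?H = Some B" by (cases "mat_inverse ?H") auto
  moreover from mat_inverse(2)[OF H this] have BH: "B * ?H = 1\<^sub>m r" and B: "B \<in> carrier_mat r r" by auto
  ultimately have p: "right_pinv A = transpose_mat A * B" by (simp add: right_pinv_def)
  then show "right_pinv A \<in> carrier_mat m r" using A B by auto
  have HB: "A * (transpose_mat A * transpose_mat B) = 1\<^sub>m r"
  proof -
    have "transpose_mat (B * ?H) = transpose_mat ?H * transpose_mat B" using B H by (rule transpose_mult)
    then show ?thesis using BH A B by (simp add: transpose_mult[of A r m "transpose_mat A" r] mat_assoc)
  qed
  have "transpose_mat (right_pinv A * A) = transpose_mat A * (transpose_mat B * A)"
    unfolding p using A B transpose_mult[of "transpose_mat A * B" m r A m]
      transpose_mult[of "transpose_mat A" m r B r] by simp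
  then have "A * transpose_mat (right_pinv A * A) = A * (transpose_mat A * transpose_mat B) * A"
    using A B by (simp add: mat_assoc)
  also have "\<dots> = A" using A by (simp only: HB) simp
  finally show "A * transpose_mat (right_pinv A * A) = A" .
qed

subsection \<open>The projections of index at least one\<close>

lemma proj_perp_properties:
  assumes "U \<in> stiefel r n"
  shows "proj_perp_mat U = 1\<^sub>m n - proj_mat U" "proj_perp_mat U \<in> carrier_mat n n"
    "transpose_mat (proj_perp_mat U) = proj_perp_mat U" "proj_perp_mat U * proj_perp_mat U = proj_perp_mat U"
proof -
  have U: "U \<in> carrier_mat n r" using assms by auto
  have P: "proj_mat U \<in> carrier_mat n n" using assms by (rule proj_mat_carrier)
  show e: "proj_perp_mat U = 1\<^sub>m n - proj_mat U" using U by (simp add: proj_perp_mat_def proj_mat_def)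
  show c: "proj_perp_mat U \<in> carrier_mat n n" using P unfolding e by (intro minus_carrier_mat)
  show "transpose_mat (proj_perp_mat U) = proj_perp_mat U"
    unfolding e using P proj_mat_symmetric[of U] transpose_minus[of "1\<^sub>m n" n n "proj_mat U"] by simp
  have "proj_perp_mat U * proj_perp_mat U = proj_perp_mat U * 1\<^sub>m n - proj_perp_mat U * proj_mat U"
    by (subst (2) e) (use P c in \<open>auto simp: mult_minus_distrib_mat[where nr=n and n=n and nc=n]\<close>)
  also have "proj_perp_mat U * proj_mat U = 0\<^sub>m n n"
    unfolding e using P by (subst minus_mult_distrib_mat[where nr=n and n=n and nc=n]) (auto simp: proj_mat_idem[OF assms])
  finally show "proj_perp_mat U * proj_perp_mat U = proj_perp_mat U" using c by auto
qed

text \<open>\<open>P\<^sub>k(A)\<close> is the orthogonal projection of \<open>A\<close> onto the space of the tensors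
  \<open>X \<times>\<^sub>k (P\<^sup>\<bottom> N)\<close>, where \<open>P\<^sup>\<bottom>\<close> projects onto the complement of the range of \<open>U\<^sub>k\<close>. In the
  coordinates of the other factors it maps the unfolding \<open>B\<close> of the contracted tensor to
  \<open>P\<^sup>\<bottom> B (G\<^sup>\<dagger> G)\<close>, and \<open>G\<^sup>\<dagger> G\<close> projects onto the row space of the unfolded core.\<close>

lemma partial_proj_is_projection:
  assumes T: "tucker_decomposition ns X G U" and X: "X \<in> tspace ns" and k: "k < length ns"
    and A: "A \<in> tspace ns"
  defines "V \<equiv> partial_proj ns (tucker_rank ns X) G U k A" and "R \<equiv> 1\<^sub>m (ns ! k) - proj_mat (U k)"
  shows "\<exists>N \<in> carrier_mat (ns ! k) (ns ! k). V = act k (R * N) X"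
    and "N \<in> carrier_mat (ns ! k) (ns ! k) \<Longrightarrow> inner A (act k (R * N) X) = inner V (act k (R * N) X)"
proof -
  define us where "us = tucker_rank ns X"
  define r where "r = mrank ns k X"
  have us: "us ! k = r" "length us = length ns" "\<And>j. j < length ns \<Longrightarrow> us ! j = mrank ns j X"
    using k by (auto simp: us_def r_def)
  have Gs: "G \<in> tspace us" using tucker_decompositionD(1)[OF T] by (simp add: us_def)
  have U: "U j \<in> stiefel (us ! j) (ns ! j)" if "j < length ns" for j
    using tucker_decompositionD(2)[OF T that] that us by simp
  have Uc: "U j \<in> carrier_mat (ns ! j) (us ! j)" if "j < length ns" for j using U[OF that] by auto
  define js where "js = filter (\<lambda>j. j \<noteq> k) [0..<length ns]"
  have js: "distinct js" "k \<notin> set js" "\<And>j. j \<in> set js \<Longrightarrow> j < length ns \<and> j \<noteq> k" by (auto simp: js_def)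
  have XY: "X = acts U js (act k (U k) G)"
    using tucker_decompositionD(3)[OF T] acts_split_mode[OF k] js(2) by (simp add: js_def acts_act_commute)
  let ?us' = "us[k := ns ! k]"
  let ?G = "unfolding_mat us k G"
  define B where "B = acts (\<lambda>j. transpose_mat (U j)) js A"
  have Bs: "B \<in> tspace ?us'"
    unfolding B_def
  proof (rule acts_tspace[OF A])
    show "?us' ! l = (if l \<in> set js then dim_row (transpose_mat (U l)) else ns ! l)" if "l < length ns" for l
      using that Uc[OF that] us by (auto simp: js_def nth_list_update)
  qed (use us js in auto)
  have B: "mode_prods ns A [(j, transpose_mat (U j)). j \<leftarrow> [0..<length ns], j \<noteq> k] = B"
    unfolding B_def comprehension_filter js_def
    by (rule mode_prods_acts[OF A]) (use Uc in auto)
  obtain Q where Q: "Q \<in> carrier_mat (nminus us k) r" "?G * Q = 1\<^sub>m r"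
    using core_right_inverse[OF T X k] by (auto simp: us_def r_def)
  have Gc: "?G \<in> carrier_mat r (nminus us k)" using us by (auto intro: carrier_matI)
  note pinv = right_pinv_mult[OF Gc Q]
  have Rp: "R = proj_perp_mat (U k)" using proj_perp_properties(1)[OF U[OF k]] by (simp add: R_def)
  have R: "R \<in> carrier_mat (ns ! k) (ns ! k)" "transpose_mat R = R" "R * R = R"
    using proj_perp_properties[OF U[OF k]] by (auto simp: Rp)
  let ?B = "unfolding_mat ?us' k B"
  have Bc: "?B \<in> carrier_mat (ns ! k) (nminus us k)" using us k by (auto intro: carrier_matI)
  define W where "W = R * (?B * right_pinv ?G)"
  have Wc: "W \<in> carrier_mat (ns ! k) r" using R Bc pinv(1) by (auto simp: W_def)
  have W': "proj_perp_mat (U k) * ?B * right_pinv ?G = W"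
    using R Bc pinv(1) by (simp add: W_def Rp mat_assoc)
  have WGs: "act k M G \<in> tspace ?us'" if "M \<in> carrier_mat (ns ! k) r" for M
    by (rule act_tspace[OF Gs]) (use that us k in auto)
  have V: "V = acts U js (act k W G)"
  proof -
    have "V = mode_prods (us[k := dim_row W]) (mode_prod us G k W) (map (\<lambda>j. (j, U j)) js)"
      unfolding V_def partial_proj_def us_def[symmetric] Let_def B W' by (simp add: comprehension_filter js_def)
    also have "mode_prod us G k W = act k W G" by (rule mode_prod_act[OF Gs]) (use Wc us k in auto)
    also have "us[k := dim_row W] = ?us'" using Wc by simp
    also have "mode_prods ?us' (act k W G) (map (\<lambda>j. (j, U j)) js) = acts U js (act k W G)"
    proof (rule mode_prods_acts[OF WGs[OF Wc] js(1)])
      show "j < length ?us' \<and> dim_col (U j) = ?us' ! j" if "j \<in> set js" for j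
        using js(3)[OF that] us(2) Uc[of j] by auto
    qed
    finally show ?thesis .
  qed
  have actX: "act k M X = acts U js (act k (M * U k) G)" if "M \<in> carrier_mat (ns ! k) (ns ! k)" for M
    using that Uc[OF k] js(2) by (subst XY) (simp add: act_compose flip: acts_act_commute)
  have Ukc: "U k \<in> carrier_mat (ns ! k) r" using Uc[OF k] us by simp
  define N0 where "N0 = ?B * right_pinv ?G * transpose_mat (U k)"
  have N0: "N0 \<in> carrier_mat (ns ! k) (ns ! k)" unfolding N0_def using Bc pinv(1) Ukc
    by (intro mult_carrier_mat) auto
  have "R * N0 * U k = W"
    using R Bc pinv(1) Ukc us k
    by (simp add: N0_def W_def mat_assoc stiefel_left_inverse[OF U[OF k]])
  then have "V = act k (R * N0) X" using R N0 by (subst actX) (auto simp: V)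
  with N0 show "\<exists>N \<in> carrier_mat (ns ! k) (ns ! k). V = act k (R * N) X" by blast
  assume N: "N \<in> carrier_mat (ns ! k) (ns ! k)"
  define M where "M = R * (N * U k)"
  have M: "M \<in> carrier_mat (ns ! k) r" unfolding M_def using R N Ukc by (intro mult_carrier_mat) auto
  have RM: "R * M = M" using mat_assoc[of R R "N * U k"] R N Ukc by (simp add: M_def)
  have XM: "act k (R * N) X = acts U js (act k M G)"
    using R N Ukc by (subst actX) (auto simp: M_def mat_assoc)
  have "inner A (act k (R * N) X) = inner B (act k M G)"
    unfolding XM B_def using acts_adjoint[OF js(1), of U "act k M G" A] by (simp add: inner_commute)
  also have "\<dots> = minner ?B (M * ?G)"
    using inner_unfolding[OF Bs, of k "act k M G"] M us k by (simp add: unfolding_mat_act)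
  also have "\<dots> = minner ?B (M * (?G * transpose_mat (right_pinv ?G * ?G)))" by (simp only: pinv(2))
  also have "\<dots> = minner ?B (M * ?G * transpose_mat (right_pinv ?G * ?G))"
    using M Gc pinv(1) us k by (simp add: mat_assoc)
  also have "\<dots> = minner (?B * (right_pinv ?G * ?G)) (M * ?G)"
    using M Gc pinv(1) Bc us k by (subst minner_mult_right) auto
  also have "\<dots> = minner (?B * (right_pinv ?G * ?G)) (transpose_mat R * (M * ?G))"
    using mat_assoc[of R M ?G] R RM M us k by simp
  also have "\<dots> = minner (R * (?B * (right_pinv ?G * ?G))) (M * ?G)"
    using R M Gc pinv(1) Bc us k by (subst minner_mult_left) auto
  also have "R * (?B * (right_pinv ?G * ?G)) = W * ?G"
    using R Gc pinv(1) Bc us k by (simp add: W_def mat_assoc)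
  also have "minner (W * ?G) (M * ?G) = inner (act k W G) (act k M G)"
    using inner_unfolding[OF WGs[OF Wc], of k "act k M G"] M Wc us k by (simp add: unfolding_mat_act)
  also have "\<dots> = inner V (act k (R * N) X)"
    unfolding V XM
  proof (rule inner_acts_stiefel[OF WGs[OF Wc] js(1), symmetric])
    show "j < length ?us' \<and> U j \<in> stiefel (?us' ! j) (ns ! j)" if "j \<in> set js" for j
      using js(3)[OF that] us U by simp
  qed
  finally show "inner A (act k (R * N) X) = inner V (act k (R * N) X)" .
qed


subsection \<open>The projection of index zero\<close>

lemma sum_lessThan_add:
  fixes f :: "nat \<Rightarrow> real"
  shows "(\<Sum>c<a + b. f c) = (\<Sum>c<a. f c) + (\<Sum>c<b. f (a + c))"
  by (induction b) simp_all

lemma append_cols_mult_transpose: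
  assumes "A \<in> carrier_mat n a" "B \<in> carrier_mat n b"
  shows "append_cols A B \<in> carrier_mat n (a + b)"
    and "proj_mat (append_cols A B) = proj_mat A + proj_mat B"
proof -
  have d: "dim_row (append_cols A B) = n" "dim_col (append_cols A B) = a + b"
    using assms by (auto simp: append_cols_def)
  then show "append_cols A B \<in> carrier_mat n (a + b)" by (auto intro: carrier_matI)
  have e: "append_cols A B $$ (i, c) = (if c < a then A $$ (i, c) else B $$ (i, c - a))"
    if "i < n" "c < a + b" for i c
    using that assms by (auto simp: append_cols_def mat_of_cols_def nth_append)
  show "proj_mat (append_cols A B) = proj_mat A + proj_mat B"
  proof (rule eq_matI)
    fix i j assume "i < dim_row (proj_mat A + proj_mat B)" "j < dim_col (proj_mat A + proj_mat B)"
    then have "i < n" "j < n" using assms by (auto simp: proj_mat_def)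
    then show "proj_mat (append_cols A B) $$ (i,j) = (proj_mat A + proj_mat B) $$ (i,j)"
      using assms d
      by (simp add: proj_mat_def mat_mult_index sum_lessThan_add e del: index_mult_mat(1))
  qed (use assms d in \<open>auto simp: proj_mat_def\<close>)
qed

text \<open>The projector onto the extended range is the sum of the projectors onto the ranges of the old and the
  new columns, whose products vanish by orthogonality.\<close>

lemma extended_factor_properties:
  assumes ext: "extended_factors ns rs (tucker_rank ns X) U A S"
    and U: "U k \<in> stiefel (mrank ns k X) (ns ! k)" and k: "k < length ns"
    and le: "mrank ns k X \<le> rs ! k"
  shows "S k \<in> carrier_mat (ns ! k) (rs ! k)" "proj_mat (S k) * proj_mat (S k) = proj_mat (S k)"
    "proj_mat (S k) * proj_mat (U k) = proj_mat (U k)"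
proof -
  let ?u = "mrank ns k X" and ?n = "ns ! k"
  have Uc: "U k \<in> carrier_mat ?n ?u" using U by auto
  have "S k \<in> carrier_mat ?n (rs ! k) \<and> proj_mat (S k) * proj_mat (S k) = proj_mat (S k) \<and>
    proj_mat (S k) * proj_mat (U k) = proj_mat (U k)"
  proof (cases "?u < rs ! k")
    case False
    then have "S k = U k" using ext k by (auto simp: extended_factors_def Let_def)
    with False le Uc show ?thesis using proj_mat_idem[OF U] by auto
  next
    case True
    from ext obtain U' where U': "\<forall>k<length ns.
          if k \<in> {k. k < length ns \<and> tucker_rank ns X ! k < rs ! k}
          then U' k \<in> stiefel (rs ! k - tucker_rank ns X ! k) (ns ! k) \<and>
               transpose_mat (U k) * U' k = 0\<^sub>m (tucker_rank ns X ! k) (rs ! k - tucker_rank ns X ! k) \<and>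
               S k = append_cols (U k) (U' k)
          else S k = U k"
      unfolding extended_factors_def Let_def by blast
    let ?W = "U' k"
    have W: "?W \<in> stiefel (rs ! k - ?u) ?n" and UW: "transpose_mat (U k) * ?W = 0\<^sub>m ?u (rs ! k - ?u)"
      and S: "S k = append_cols (U k) ?W"
      using U'[rule_format, OF k] True k by auto
    have Wc: "?W \<in> carrier_mat ?n (rs ! k - ?u)" using W by auto
    let ?P = "proj_mat (U k)" and ?Q = "proj_mat ?W"
    have Pc: "?P \<in> carrier_mat ?n ?n" and Qc: "?Q \<in> carrier_mat ?n ?n"
      using U W proj_mat_carrier by auto
    have "?P * ?Q = U k * (transpose_mat (U k) * ?W * transpose_mat ?W)"
      using Uc Wc by (simp add: proj_mat_def mat_assoc)
    then have PQ: "?P * ?Q = 0\<^sub>m ?n ?n" using UW Uc Wc by simp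
    have "transpose_mat (?P * ?Q) = ?Q * ?P"
      using transpose_mult[OF Pc Qc] by (simp add: proj_mat_symmetric)
    then have QP: "?Q * ?P = 0\<^sub>m ?n ?n" using PQ by simp
    have SP: "proj_mat (S k) = ?P + ?Q" and Sc: "S k \<in> carrier_mat ?n (rs ! k)"
      using append_cols_mult_transpose[OF Uc Wc] True by (auto simp: S)
    have "(?P + ?Q) * (?P + ?Q) = (?P + ?Q) * ?P + (?P + ?Q) * ?Q"
      using Pc Qc by (intro mult_add_distrib_mat) auto
    moreover have SPP: "(?P + ?Q) * ?P = ?P" "(?P + ?Q) * ?Q = ?Q"
      using Pc Qc by (auto simp: add_mult_distrib_mat[OF Pc Qc] PQ QP proj_mat_idem[OF U] proj_mat_idem[OF W])
    ultimately show ?thesis using SP Sc by simp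
  qed
  then show "S k \<in> carrier_mat (ns ! k) (rs ! k)" "proj_mat (S k) * proj_mat (S k) = proj_mat (S k)"
    "proj_mat (S k) * proj_mat (U k) = proj_mat (U k)" by auto
qed

lemma partial_proj_0_acts:
  assumes "A \<in> tspace ns" "\<And>k. k < length ns \<Longrightarrow> dim_row (S k) = ns ! k"
  shows "partial_proj_0 ns S A = acts (\<lambda>k. proj_mat (S k)) [0..<length ns] A"
  unfolding partial_proj_0_def using assms by (intro mode_prods_acts) (auto simp: proj_mat_def)

text \<open>Both \<open>X\<close> and the projection are fixed by the projectors onto the extended ranges, which have rank at
  most \<open>r\<^sub>k\<close>; hence so is every point of the line through \<open>X\<close>.\<close>

lemma partial_proj_0_properties:
  assumes T: "tucker_decomposition ns X G U" and len: "length rs = length ns"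
    and X: "X \<in> tucker_variety ns rs" and A: "A \<in> tspace ns"
    and ext: "extended_factors ns rs (tucker_rank ns X) U A S"
  defines "V \<equiv> partial_proj_0 ns S A"
  shows "inner A V = (norm V)\<^sup>2" and "X + s *\<^sub>R V \<in> tucker_variety ns rs"
proof -
  let ?P = "\<lambda>k. proj_mat (S k)" and ?ks = "[0..<length ns]"
  have Xs: "X \<in> tspace ns" and le: "\<And>k. k < length ns \<Longrightarrow> mrank ns k X \<le> rs ! k"
    using X len by (auto simp: tucker_variety_iff)
  note U = tucker_decompositionD(2)[OF T]
  note S = extended_factor_properties[OF ext U _ le]
  have d: "dim_row (?P k) = ns ! k" "dim_col (?P k) = ns ! k" if "k < length ns" for k
    using S(1)[OF that that that] by (auto simp: proj_mat_def)
  have V: "V = acts ?P ?ks A"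
    unfolding V_def using S(1) by (intro partial_proj_0_acts[OF A]) auto
  have "acts ?P ?ks V = acts (\<lambda>k. ?P k * ?P k) ?ks A"
    unfolding V by (intro acts_compose) (auto simp: d)
  also have "\<dots> = V" unfolding V using S(2) by (intro acts_cong) auto
  finally have VV: "acts ?P ?ks V = V" .
  have "inner V V = inner A (acts ?P ?ks V)"
    using acts_adjoint[of ?ks ?P A V] by (simp add: V proj_mat_symmetric)
  then show "inner A V = (norm V)\<^sup>2" by (simp add: VV power2_norm_eq_inner)
  have Vs: "V \<in> tspace ns" unfolding V using d by (intro acts_tspace_same[OF A]) auto
  have Ws: "X + s *\<^sub>R V \<in> tspace ns" using Xs Vs by (intro tspace_add tspace_scaleR)
  have "mrank ns k (X + s *\<^sub>R V) \<le> rs ! k" if k: "k < length ns" for k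
  proof (rule mrank_le_of_fixed[OF Ws k])
    have PX: "act k (proj_mat (U k)) X = X" by (rule tucker_decomposition_fixed[OF T k])
    have "act k (?P k) X = act k (?P k) (act k (proj_mat (U k)) X)" by (simp add: PX)
    also have "\<dots> = act k (?P k * proj_mat (U k)) X"
      using d[OF k] proj_mat_carrier[OF U[OF k]] by (intro act_compose) auto
    finally have "act k (?P k) X = X" using S(3)[OF k k k] PX by simp
    moreover have "act k (?P k) V = V"
    proof -
      have "V = act k (?P k) (acts ?P (filter (\<lambda>j. j \<noteq> k) ?ks) A)"
        unfolding V by (rule acts_split_mode[OF k])
      moreover have "act k (?P k) (act k (?P k) Y) = act k (?P k) Y" for Y
        using d[OF k] S(2)[OF k k k] by (simp add: act_compose)
      ultimately show ?thesis by metis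
    qed
    ultimately show "act k (S k * transpose_mat (S k)) (X + s *\<^sub>R V) = X + s *\<^sub>R V"
      by (simp add: act_add act_scaleR proj_mat_def)
  qed (use S(1)[OF k k k] in auto)
  then show "X + s *\<^sub>R V \<in> tucker_variety ns rs" using Ws len by (simp add: tucker_variety_iff)
qed

subsection \<open>Properties of the selected projection\<close>

text \<open>A lower bound, valid for all ranks \<open>u\<^sub>k < r\<^sub>k\<close>, of the factor \<open>\<Prod>\<^sub>k sqrt ((r\<^sub>k - u\<^sub>k) / min n\<^sub>k n\<^bsub>-k\<^esub>)\<close>
  that the new columns guarantee.\<close>

definition proj_const :: "nat list \<Rightarrow> real" where
  "proj_const ns = (\<Prod>k<length ns. sqrt (1 / real (min (ns ! k) (nminus ns k))))"

lemma proj_const_le: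
  assumes pos: "\<And>k. k < length ns \<Longrightarrow> 0 < min (ns ! k) (nminus ns k)" and I: "I \<subseteq> {..<length ns}"
    and u: "\<And>k. k \<in> I \<Longrightarrow> u k < r k"
  shows "proj_const ns \<le> (\<Prod>k\<in>I. sqrt (real (r k - u k) / real (min (ns ! k) (nminus ns k))))"
    and "0 < proj_const ns"
proof -
  define m where "m k = real (min (ns ! k) (nminus ns k))" for k
  have m: "1 \<le> m k" if "k < length ns" for k using pos[OF that] by (simp add: m_def)
  then have m01: "0 < 1 / m k \<and> 1 / m k \<le> 1" if "k < length ns" for k
    using m[OF that] by simp
  have "proj_const ns = (\<Prod>k\<in>{..<length ns} - I. sqrt (1 / m k)) * (\<Prod>k\<in>I. sqrt (1 / m k))"
    unfolding proj_const_def m_def[symmetric] by (rule prod.subset_diff[OF I]) simp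
  also have "\<dots> \<le> 1 * (\<Prod>k\<in>I. sqrt (1 / m k))"
  proof (rule mult_right_mono)
    show "(\<Prod>k\<in>{..<length ns} - I. sqrt (1 / m k)) \<le> 1"
      using m by (intro prod_le_1) (fastforce dest: m)
    show "0 \<le> (\<Prod>k\<in>I. sqrt (1 / m k))"
    proof (rule prod_nonneg)
      fix k assume "k \<in> I"
      then show "0 \<le> sqrt (1 / m k)" using m01[of k] I by auto
    qed
  qed
  also have "\<dots> \<le> (\<Prod>k\<in>I. sqrt (real (r k - u k) / m k))"
    unfolding mult_1
  proof (rule prod_mono)
    fix k assume k: "k \<in> I"
    then have "1 \<le> real (r k - u k)" using u[OF k] by simp
    moreover have "1 \<le> m k" using m[of k] I k by auto
    ultimately show "0 \<le> sqrt (1 / m k) \<and> sqrt (1 / m k) \<le> sqrt (real (r k - u k) / m k)"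
      by (simp add: divide_right_mono)
  qed
  finally show "proj_const ns \<le> (\<Prod>k\<in>I. sqrt (real (r k - u k) / real (min (ns ! k) (nminus ns k))))"
    unfolding m_def .
  show "0 < proj_const ns" unfolding proj_const_def m_def[symmetric]
  proof (rule prod_pos)
    fix k assume "k \<in> {..<length ns}"
    then show "0 < sqrt (1 / m k)" using m01[of k] by simp
  qed
qed

text \<open>As \<open>V\<close> is longest among all the projections, \<open>\<parallel>V\<parallel>\<close> dominates what each of them measures: those of
  index \<open>k\<close> the inner products with \<open>X \<times>\<^sub>k (1 - P\<^sub>k) N\<close>, the zeroth one the part of \<open>A\<close> that lies in the
  ranges of the modes of full rank.\<close>

lemma hat_proj_properties:
  assumes len: "length rs = length ns" and pos: "\<And>k. k < length ns \<Longrightarrow> 0 < min (ns ! k) (nminus ns k)"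
    and X: "X \<in> tucker_variety ns rs" and A: "A \<in> tspace ns" and V: "V \<in> hat_proj ns rs X A"
  shows "inner A V = (norm V)\<^sup>2" and "X + s *\<^sub>R V \<in> tucker_variety ns rs"
    and "\<exists>U. (\<forall>k<length ns. U k \<in> stiefel (mrank ns k X) (ns ! k) \<and> act k (proj_mat (U k)) X = X \<and>
        (\<forall>N \<in> carrier_mat (ns ! k) (ns ! k).
          \<bar>inner A (act k ((1\<^sub>m (ns ! k) - proj_mat (U k)) * N) X)\<bar> \<le>
            norm V * norm (act k ((1\<^sub>m (ns ! k) - proj_mat (U k)) * N) X))) \<and>
      proj_const ns * norm (acts (\<lambda>k. proj_mat (U k)) (filter (\<lambda>k. mrank ns k X = rs ! k) [0..<length ns]) A) \<le> norm V"
proof -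
  have Xs: "X \<in> tspace ns" and le: "\<And>k. k < length ns \<Longrightarrow> mrank ns k X \<le> rs ! k"
    using X len by (auto simp: tucker_variety_iff)
  define C where "C G U S = insert (partial_proj_0 ns S A)
      ((\<lambda>k. partial_proj ns (tucker_rank ns X) G U k A) ` {..<length ns})" for G U S
  obtain G U S where T: "tucker_decomposition ns X G U"
    and ext: "extended_factors ns rs (tucker_rank ns X) U A S"
    and VC: "V \<in> C G U S" and max: "\<And>Z. Z \<in> C G U S \<Longrightarrow> norm Z \<le> norm V"
    using V unfolding hat_proj_def Let_def C_def by blast
  note U = tucker_decompositionD(2)[OF T]
  let ?R = "\<lambda>k. 1\<^sub>m (ns ! k) - proj_mat (U k)"
  have Rc: "?R k \<in> carrier_mat (ns ! k) (ns ! k)" if "k < length ns" for k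
    using proj_mat_carrier[OF U[OF that]] by (intro minus_carrier_mat)
  have "inner A V = (norm V)\<^sup>2 \<and> X + s *\<^sub>R V \<in> tucker_variety ns rs"
  proof (cases "V = partial_proj_0 ns S A")
    case True
    with partial_proj_0_properties[OF T len X A ext] show ?thesis by simp
  next
    case False
    then obtain k where k: "k < length ns" and Vk: "V = partial_proj ns (tucker_rank ns X) G U k A"
      using VC by (auto simp: C_def)
    note pp = partial_proj_is_projection[OF T Xs k A, folded Vk]
    obtain N where N: "N \<in> carrier_mat (ns ! k) (ns ! k)" and VN: "V = act k (?R k * N) X"
      using pp(1) by blast
    have RN: "?R k * N \<in> carrier_mat (ns ! k) (ns ! k)" using Rc[OF k] N by (rule mult_carrier_mat)
    have "inner A V = (norm V)\<^sup>2" using pp(2)[OF N] by (simp add: VN power2_norm_eq_inner)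
    moreover have "X + s *\<^sub>R V = act k (1\<^sub>m (ns ! k) + s \<cdot>\<^sub>m (?R k * N)) X"
    proof -
      have "act k (1\<^sub>m (ns ! k) + s \<cdot>\<^sub>m (?R k * N)) X = act k (1\<^sub>m (ns ! k)) X + act k (s \<cdot>\<^sub>m (?R k * N)) X"
        using carrier_matD[OF RN] by (intro act_plus_mat) simp_all
      then show ?thesis by (simp only: act_one[OF Xs k] act_smult_mat VN)
    qed
    moreover have "act k (1\<^sub>m (ns ! k) + s \<cdot>\<^sub>m (?R k * N)) X \<in> tucker_variety ns rs"
      using RN by (intro act_in_variety[OF len X k]) auto
    ultimately show ?thesis by simp
  qed
  then show "inner A V = (norm V)\<^sup>2" and "X + s *\<^sub>R V \<in> tucker_variety ns rs" by auto
  show "\<exists>U. (\<forall>k<length ns. U k \<in> stiefel (mrank ns k X) (ns ! k) \<and> act k (proj_mat (U k)) X = X \<and>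
        (\<forall>N \<in> carrier_mat (ns ! k) (ns ! k).
          \<bar>inner A (act k ((1\<^sub>m (ns ! k) - proj_mat (U k)) * N) X)\<bar> \<le>
            norm V * norm (act k ((1\<^sub>m (ns ! k) - proj_mat (U k)) * N) X))) \<and>
      proj_const ns * norm (acts (\<lambda>k. proj_mat (U k)) (filter (\<lambda>k. mrank ns k X = rs ! k) [0..<length ns]) A) \<le> norm V"
  proof (intro exI[of _ U] conjI allI impI ballI)
    fix k and N :: "real mat" assume k: "k < length ns" and N: "N \<in> carrier_mat (ns ! k) (ns ! k)"
    let ?Vk = "partial_proj ns (tucker_rank ns X) G U k A"
    have "\<bar>inner A (act k (?R k * N) X)\<bar> \<le> norm ?Vk * norm (act k (?R k * N) X)"
      using partial_proj_is_projection(2)[OF T Xs k A N] Cauchy_Schwarz_ineq2[of ?Vk "act k (?R k * N) X"] by simp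
    also have "\<dots> \<le> norm V * norm (act k (?R k * N) X)"
      using max[of ?Vk] k by (intro mult_right_mono) (auto simp: C_def)
    finally show "\<bar>inner A (act k (?R k * N) X)\<bar> \<le> norm V * norm (act k (?R k * N) X)" .
  next
    let ?I = "{k. k < length ns \<and> tucker_rank ns X ! k < rs ! k}"
    let ?K = "filter (\<lambda>k. mrank ns k X = rs ! k) [0..<length ns]"
    have K: "filter (\<lambda>k. k \<notin> ?I) [0..<length ns] = ?K"
      using le by (intro filter_cong) (auto simp: order.order_iff_strict)
    have "norm (mode_prods ns A [(k, proj_mat (U k)). k \<leftarrow> [0..<length ns], k \<notin> ?I]) *
         (\<Prod>k\<in>?I. sqrt (real (rs ! k - tucker_rank ns X ! k) / real (min (ns ! k) (nminus ns k)))) \<le> norm (partial_proj_0 ns S A)"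
      using ext by (simp add: extended_factors_def Let_def)
    also have "\<dots> \<le> norm V" by (intro max) (simp add: C_def)
    also have "mode_prods ns A [(k, proj_mat (U k)). k \<leftarrow> [0..<length ns], k \<notin> ?I] = acts (\<lambda>k. proj_mat (U k)) ?K A"
      unfolding comprehension_filter K using proj_mat_carrier[OF U] by (intro mode_prods_acts[OF A]) auto
    finally have *: "norm (acts (\<lambda>k. proj_mat (U k)) ?K A) *
      (\<Prod>k\<in>?I. sqrt (real (rs ! k - tucker_rank ns X ! k) / real (min (ns ! k) (nminus ns k)))) \<le> norm V" .
    have "proj_const ns \<le> (\<Prod>k\<in>?I. sqrt (real (rs ! k - tucker_rank ns X ! k) / real (min (ns ! k) (nminus ns k))))"
      by (rule proj_const_le[OF pos]) auto
    then have "norm (acts (\<lambda>k. proj_mat (U k)) ?K A) * proj_const ns \<le> norm (acts (\<lambda>k. proj_mat (U k)) ?K A) *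
      (\<Prod>k\<in>?I. sqrt (real (rs ! k - tucker_rank ns X ! k) / real (min (ns ! k) (nminus ns k))))"
      by (rule mult_left_mono) simp
    with * show "proj_const ns * norm (acts (\<lambda>k. proj_mat (U k)) ?K A) \<le> norm V" by (simp add: mult.commute)
  qed (use U tucker_decomposition_fixed[OF T] in auto)
qed

section \<open>Truncated HOSVD\<close>

lemma minner_diff_eq_0D: "minner (A - B) (A - B) \<le> 0 \<Longrightarrow> dim_row A = dim_row B \<Longrightarrow> dim_col A = dim_col B \<Longrightarrow> A = B"
proof -
  assume "minner (A - B) (A - B) \<le> 0" and d: "dim_row A = dim_row B" "dim_col A = dim_col B"
  then have "minner (A - B) (A - B) = 0" using minner_nonneg[of "A - B"] by simp
  from minner_eq_0D[OF this] have z: "A - B = 0\<^sub>m (dim_row B) (dim_col B)" using d by simp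
  show "A = B"
  proof (rule eq_matI)
    fix i j assume "i < dim_row B" "j < dim_col B"
    then have "(A - B) $$ (i,j) = A $$ (i,j) - B $$ (i,j)" "(0\<^sub>m (dim_row B) (dim_col B)) $$ (i,j) = (0::real)" by auto
    with z show "A $$ (i,j) = B $$ (i,j)" by simp
  qed (use d in auto)
qed

lemma best_rank_approx_self:
  assumes "mat_rank A \<le> s"
  shows "best_rank_approx s A = {A}"
proof -
  have 0: "frobenius_norm (A - A) = 0" by (simp add: frobenius_norm_def)
  have pos: "0 \<le> frobenius_norm B" for B by (simp add: frobenius_norm_minner minner_nonneg)
  have Ac: "A \<in> carrier_mat (dim_row A) (dim_col A)" by (rule carrier_matI) auto
  have "A \<in> best_rank_approx s A"
    unfolding best_rank_approx_def mem_Collect_eq 0 using assms pos Ac by blast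
  moreover have "B = A" if "B \<in> best_rank_approx s A" for B
  proof -
    have "frobenius_norm (A - B) \<le> 0" and B: "B \<in> carrier_mat (dim_row A) (dim_col A)"
      using that assms Ac unfolding best_rank_approx_def mem_Collect_eq by (metis 0, metis)
    then have "minner (A - B) (A - B) \<le> 0" by (simp add: frobenius_norm_minner)
    with B show "B = A" using minner_diff_eq_0D[of A B] by auto
  qed
  ultimately show ?thesis by blast
qed

text \<open>The projector \<open>P\<close> onto the column space of \<open>B\<close> satisfies
  \<open>\<parallel>A - B\<parallel>\<^sup>2 = \<parallel>A - P A\<parallel>\<^sup>2 + \<parallel>P A - B\<parallel>\<^sup>2\<close>, and \<open>P A\<close> competes with the best approximation \<open>B\<close>.\<close>

lemma best_rank_approx_projection:
  assumes B: "B \<in> best_rank_approx s A"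
  shows "\<exists>P \<in> carrier_mat (dim_row A) (dim_row A). B = P * A"
proof -
  let ?n = "dim_row A" and ?m = "dim_col A"
  have Bc: "B \<in> carrier_mat ?n ?m" and rB: "mat_rank B \<le> s"
    and min: "\<And>C. C \<in> carrier_mat ?n ?m \<Longrightarrow> mat_rank C \<le> s \<Longrightarrow> frobenius_norm (A - B) \<le> frobenius_norm (A - C)"
    using B by (auto simp: best_rank_approx_def)
  obtain U where U: "U \<in> stiefel (mat_rank B) ?n" and "U * transpose_mat U * B = B"
    using exists_column_space_basis[OF Bc] by blast
  then have PB: "proj_mat U * B = B" by (simp add: proj_mat_def)
  let ?P = "proj_mat U"
  have Uc: "U \<in> carrier_mat ?n (mat_rank B)" using U by auto
  have P: "?P \<in> carrier_mat ?n ?n" by (rule proj_mat_carrier[OF U])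
  have PA: "?P * A \<in> carrier_mat ?n ?m" using P by auto
  have "U * (transpose_mat U * A) = ?P * A" using Uc by (simp add: proj_mat_def mat_assoc)
  then have "mat_rank (?P * A) \<le> mat_rank B"
    using Uc by (intro mat_rank_le_of_fixed[of U ?n _ _ _ ?m]) (auto intro: carrier_matI)
  with rB have "frobenius_norm (A - B) \<le> frobenius_norm (A - ?P * A)" by (intro min[OF PA]) auto
  then have le: "minner (A - B) (A - B) \<le> minner (A - ?P * A) (A - ?P * A)"
    by (simp add: frobenius_norm_minner)
  have PP: "?P * (?P * A) = ?P * A" using P proj_mat_idem[OF U] by (simp flip: mat_assoc)
  have 1: "minner (?P * A) (?P * A) = minner A (?P * A)"
    using P by (subst minner_mult_left) (auto simp: proj_mat_symmetric PP)
  have 2: "minner (?P * A) B = minner A B"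
    using P Bc by (subst minner_mult_left) (auto simp: proj_mat_symmetric PB)
  have c: "minner (?P * A) A = minner A (?P * A)" "minner B A = minner A B" "minner B (?P * A) = minner (?P * A) B"
    using P Bc by (auto intro: minner_commute)
  have "minner (A - B) (A - B) = minner A A - 2 * minner A B + minner B B"
    using Bc by (simp add: minner_diff_left minner_diff_right c)
  moreover have "minner (A - ?P * A) (A - ?P * A) = minner A A - minner (?P * A) (?P * A)"
    using P by (simp add: minner_diff_left minner_diff_right c 1)
  moreover have "minner (?P * A - B) (?P * A - B) = minner (?P * A) (?P * A) - 2 * minner A B + minner B B"
    using P Bc by (simp add: minner_diff_left minner_diff_right c 2)
  ultimately have "minner (?P * A - B) (?P * A - B) \<le> 0" using le by linarith
  then have "?P * A = B" by (rule minner_diff_eq_0D) (use P Bc in auto)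
  with P show ?thesis by blast
qed

lemma mode_truncation_self:
  assumes "Y \<in> tspace ns" "k < length ns" "mrank ns k Y \<le> s"
  shows "mode_truncation ns k s Y = {Y}"
  using assms by (simp add: mode_truncation_def best_rank_approx_self ten_unfolding_mat)

lemma mode_truncation_properties:
  assumes Y: "Y \<in> tspace ns" and k: "k < length ns" and Z: "Z \<in> mode_truncation ns k s Y"
  shows "Z \<in> tspace ns" "mrank ns k Z \<le> s" "j < length ns \<Longrightarrow> mrank ns j Z \<le> mrank ns j Y"
    "L \<in> tspace ns \<Longrightarrow> mrank ns k L \<le> s \<Longrightarrow> norm (Y - Z) \<le> norm (Y - L)"
proof -
  let ?u = "unfolding_mat ns k"
  obtain B where B: "B \<in> best_rank_approx s (?u Y)" and ZB: "Z = ten ns k B"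
    using Z by (auto simp: mode_truncation_def)
  have Bc: "B \<in> carrier_mat (ns ! k) (nminus ns k)" and rB: "mat_rank B \<le> s"
    and min: "\<And>C. C \<in> carrier_mat (ns ! k) (nminus ns k) \<Longrightarrow> mat_rank C \<le> s \<Longrightarrow>
       frobenius_norm (?u Y - B) \<le> frobenius_norm (?u Y - C)"
    using B by (auto simp: best_rank_approx_def)
  have uZ: "?u Z = B" unfolding ZB by (rule unfolding_mat_ten[OF Bc k])
  show Zs: "Z \<in> tspace ns" unfolding ZB by (rule ten_in_tspace)
  show "mrank ns k Z \<le> s" using rB uZ by simp
  obtain P where P: "P \<in> carrier_mat (ns ! k) (ns ! k)" and "B = P * ?u Y"
    using best_rank_approx_projection[OF B] by auto
  then have "?u Z = ?u (act k P Y)" using uZ k by (simp add: unfolding_mat_act_same)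
  then have "Z = act k P Y"
    using P by (intro unfolding_mat_inject[OF Zs _ k]) (auto intro: act_tspace_same[OF Y])
  then show "mrank ns j Z \<le> mrank ns j Y" if "j < length ns"
    using mrank_act_le[OF Y that k P] by simp
  show "norm (Y - Z) \<le> norm (Y - L)" if L: "L \<in> tspace ns" "mrank ns k L \<le> s"
    using min[of "?u L"] L uZ norm_unfolding[OF tspace_diff[OF Y Zs] k] norm_unfolding[OF tspace_diff[OF Y L(1)] k]
    by (simp add: unfolding_mat_diff carrier_matI[OF unfolding_mat_carrier])
qed

lemma hosvd_self:
  assumes "X \<in> tspace ns" "\<And>k. k < length ns \<Longrightarrow> mrank ns k X \<le> ss ! k"
  shows "hosvd ns ss X = {X}"
proof -
  have "foldl (\<lambda>S k. \<Union>Y\<in>S. mode_truncation ns k (ss ! k) Y) {X} ks = {X}" if "set ks \<subseteq> {..<length ns}" for ks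
    using that by (induction ks) (auto simp: mode_truncation_self assms)
  from this[of "[0..<length ns]"] show ?thesis unfolding hosvd_def by fastforce
qed

text \<open>Each truncation at most doubles the distance to a tensor \<open>L\<close> that satisfies the rank bounds, because
  \<open>L\<close> competes with the best approximation. The truncations in later modes act as mode products, so
  that they preserve the rank bounds already achieved.\<close>

lemma hosvd_properties:
  assumes X: "X \<in> tspace ns" and Z: "Z \<in> hosvd ns ss X"
  shows "Z \<in> tspace ns" "k < length ns \<Longrightarrow> mrank ns k Z \<le> ss ! k" 
    "k < length ns \<Longrightarrow> mrank ns k Z \<le> mrank ns k X"
    "L \<in> tspace ns \<Longrightarrow> (\<And>k. k < length ns \<Longrightarrow> mrank ns k L \<le> ss ! k) \<Longrightarrow>
      norm (Z - L) \<le> 2 ^ length ns * norm (X - L)"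
proof -
  let ?F = "\<lambda>m. foldl (\<lambda>S k. \<Union>Y\<in>S. mode_truncation ns k (ss ! k) Y) {X} [0..<m]"
  have main: "Z \<in> tspace ns \<and> (\<forall>k<m. mrank ns k Z \<le> ss ! k) \<and> (\<forall>k<length ns. mrank ns k Z \<le> mrank ns k X) \<and>
    (\<forall>L\<in>tspace ns. (\<forall>k<length ns. mrank ns k L \<le> ss ! k) \<longrightarrow> norm (Z - L) \<le> 2 ^ m * norm (X - L))"
    if "Z \<in> ?F m" "m \<le> length ns" for Z m
    using that
  proof (induction m arbitrary: Z)
    case 0
    then show ?case using X by simp
  next
    case (Suc m)
    then obtain Y where Y: "Y \<in> ?F m" and Z: "Z \<in> mode_truncation ns m (ss ! m) Y" by auto
    have m: "m < length ns" using Suc by simp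
    note IH = Suc.IH[OF Y less_imp_le[OF m]]
    have Ys: "Y \<in> tspace ns" using IH by simp
    note p = mode_truncation_properties[OF Ys m Z]
    have "norm (Z - L) \<le> 2 ^ Suc m * norm (X - L)"
      if L: "L \<in> tspace ns" "\<forall>k<length ns. mrank ns k L \<le> ss ! k" for L
    proof -
      have "norm (Z - L) \<le> norm (Z - Y) + norm (Y - L)" using norm_triangle_ineq[of "Z - Y" "Y - L"] by simp
      also have "norm (Z - Y) \<le> norm (Y - L)" using p(4)[OF L(1)] L(2) m by (simp add: norm_minus_commute)
      also have "norm (Y - L) \<le> 2 ^ m * norm (X - L)" using IH L by blast
      finally show ?thesis by (simp add: mult_ac)
    qed
    moreover have "mrank ns k Z \<le> ss ! k" if "k < Suc m" for k
    proof (cases "k = m")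
      case False
      then show ?thesis using that IH p(3)[of k] m by (meson le_trans less_SucE less_trans)
    qed (use p(2) in simp)
    moreover have "mrank ns k Z \<le> mrank ns k X" if "k < length ns" for k
      using IH p(3)[OF that] that by (meson le_trans)
    ultimately show ?case using p(1) by blast
  qed
  note r = main[OF Z[unfolded hosvd_def] order_refl]
  show "Z \<in> tspace ns" "k < length ns \<Longrightarrow> mrank ns k Z \<le> ss ! k" "k < length ns \<Longrightarrow> mrank ns k Z \<le> mrank ns k X"
    "L \<in> tspace ns \<Longrightarrow> (\<And>k. k < length ns \<Longrightarrow> mrank ns k L \<le> ss ! k) \<Longrightarrow>
      norm (Z - L) \<le> 2 ^ length ns * norm (X - L)"
    using r by blast+
qed

section \<open>The smallest nonzero singular value\<close>

text \<open>Vectors of dimension \<open>r\<close> are represented by coordinate functions, of which only the first \<open>r\<close> values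
  matter: a minimising sequence has a subsequence that converges in each of these coordinates.\<close>

lemma attains_minimum_on_sphere:
  fixes q :: "(nat \<Rightarrow> real) \<Rightarrow> real"
  assumes r: "0 < r" and nonneg: "\<And>x. 0 \<le> q x"
    and cont: "\<And>x y. (\<And>i. i < r \<Longrightarrow> (\<lambda>t::nat. x t i) \<longlonglongrightarrow> y i) \<Longrightarrow> (\<lambda>t. q (x t)) \<longlonglongrightarrow> q y"
  shows "\<exists>y. (\<Sum>i<r. (y i)\<^sup>2) = 1 \<and> (\<forall>z. (\<Sum>i<r. (z i)\<^sup>2) = 1 \<longrightarrow> q y \<le> q z)"
proof -
  define S where "S = {z :: nat \<Rightarrow> real. (\<Sum>i<r. (z i)\<^sup>2) = 1}"
  define m where "m = Inf (q ` S)"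
  have "(\<lambda>i. if i = 0 then 1 else 0) \<in> S"
    using r by (simp add: S_def if_distrib[of "\<lambda>x. x\<^sup>2"] cong: if_cong)
  then have ne: "q ` S \<noteq> {}" by auto
  have bd: "bdd_below (q ` S)" using nonneg by (auto intro!: bdd_belowI[of _ 0])
  have "\<exists>z\<in>S. q z < m + 1 / real (Suc t)" for t
    using cInf_lessD[OF ne, of "m + 1 / real (Suc t)"] by (auto simp: m_def)
  then obtain x where x: "\<And>t. x t \<in> S" "\<And>t. q (x t) < m + 1 / real (Suc t)" by metis
  have b: "\<bar>x t i\<bar> \<le> 1" if "i < r" for t i
  proof -
    have "(x t i)\<^sup>2 \<le> (\<Sum>i<r. (x t i)\<^sup>2)" by (rule member_le_sum) (use that in auto)
    then show ?thesis using x(1)[of t] by (simp add: S_def abs_square_le_1)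
  qed
  have bdx: "bounded ((\<lambda>z. z i) ` range x)" if "i \<in> {..<r}" for i
    using b that by (intro boundedI[where B = 1]) auto
  have "\<forall>\<delta>\<subseteq>{..<r}. \<exists>l. \<exists>\<phi>::nat\<Rightarrow>nat. strict_mono \<phi> \<and>
    (\<forall>\<epsilon>>0. eventually (\<lambda>n. \<forall>i\<in>\<delta>. dist (x (\<phi> n) i) (l i) < \<epsilon>) sequentially)"
    by (rule compact_lemma_general[where unproj = "\<lambda>x. x" and proj = "\<lambda>x i. x i"])
      (rule finite_lessThan bdx refl | assumption)+
  from this[rule_format, OF order_refl] obtain l \<phi> where \<phi>: "strict_mono \<phi>"
    and l: "\<And>\<epsilon>. \<epsilon> > 0 \<Longrightarrow> eventually (\<lambda>n. \<forall>i\<in>{..<r}. dist (x (\<phi> n) i) (l i) < \<epsilon>) sequentially"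
    by blast
  have lim: "(\<lambda>t. x (\<phi> t) i) \<longlonglongrightarrow> l i" if "i < r" for i
    unfolding tendsto_iff
  proof (intro allI impI)
    fix e :: real assume "e > 0"
    from l[OF this] show "\<forall>\<^sub>F t in sequentially. dist (x (\<phi> t) i) (l i) < e"
      by (rule eventually_mono) (use that in blast)
  qed
  then have "(\<lambda>t. \<Sum>i<r. (x (\<phi> t) i)\<^sup>2) \<longlonglongrightarrow> (\<Sum>i<r. (l i)\<^sup>2)" by (intro tendsto_intros) auto
  moreover have "(\<lambda>t. \<Sum>i<r. (x (\<phi> t) i)\<^sup>2) = (\<lambda>t. 1)" using x(1) by (auto simp: S_def)
  ultimately have "(\<Sum>i<r. (l i)\<^sup>2) = 1" by (metis LIMSEQ_unique tendsto_const)
  moreover have "q l \<le> m"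
  proof (rule LIMSEQ_le)
    show "(\<lambda>t. q (x (\<phi> t))) \<longlonglongrightarrow> q l" by (rule cont) (rule lim)
    have "(\<lambda>t. m + 1 / real (Suc t)) \<longlonglongrightarrow> m + 0"
      by (intro tendsto_add tendsto_const LIMSEQ_inverse_real_of_nat[unfolded inverse_eq_divide])
    then show "(\<lambda>t. m + 1 / real (Suc (\<phi> t))) \<longlonglongrightarrow> m"
      using LIMSEQ_subseq_LIMSEQ[OF _ \<phi>, of "\<lambda>t. m + 1 / real (Suc t)" m] by (simp add: o_def)
    show "\<exists>N. \<forall>n\<ge>N. q (x (\<phi> n)) \<le> m + 1 / real (Suc (\<phi> n))" using x(2) by (auto intro: less_imp_le)
  qed
  moreover have "m \<le> q z" if "z \<in> S" for z unfolding m_def using bd that by (intro cInf_lower) auto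
  ultimately show ?thesis unfolding S_def by (auto intro: order_trans)
qed

text \<open>The first variation of a quadratic form vanishes at a minimum.\<close>

lemma linear_coefficient_zero:
  fixes b c :: real
  assumes "\<And>t. 0 \<le> 2 * t * b + t\<^sup>2 * c"
  shows "b = 0"
proof -
  \<comment> \<open>for \<open>b \<noteq> 0\<close> the value at \<open>t = - e b\<close> is negative as soon as \<open>e \<bar>c\<bar> < 2\<close>\<close>
  define e where "e = 1 / (1 + \<bar>c\<bar>)"
  have e: "e > 0" "e * \<bar>c\<bar> \<le> 1" by (auto simp: e_def divide_simps)
  have "0 \<le> 2 * (- e * b) * b + (- e * b)\<^sup>2 * c" by (rule assms)
  also have "\<dots> = e * b\<^sup>2 * (e * c - 2)" by (simp add: power2_eq_square algebra_simps)
  finally have "0 \<le> (e * b\<^sup>2) * (e * c - 2)" .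
  moreover have "e * c \<le> e * \<bar>c\<bar>" using e by (intro mult_left_mono) auto
  then have "e * c - 2 < 0" using e(2) by linarith
  ultimately have "e * b\<^sup>2 \<le> 0" by (simp add: zero_le_mult_iff)
  then show ?thesis using e(1) by (simp add: mult_le_0_iff)
qed

lemma mat_vec_assoc:
  fixes A B :: "real mat"
  assumes "dim_col A = dim_row B" "dim_vec v = dim_col B"
  shows "A * B *\<^sub>v v = A *\<^sub>v (B *\<^sub>v v)"
  by (rule assoc_mult_mat_vec[OF carrier_matI carrier_matI carrier_vecI]) (use assms in auto)

lemma scalar_prod_self_nonneg: "0 \<le> (v :: real vec) \<bullet> (v :: real vec)"
  by (auto simp: scalar_prod_def intro!: sum_nonneg)

lemma scalar_prod_self_zero: "v \<in> carrier_vec n \<Longrightarrow> (v :: real vec) \<bullet> v = 0 \<Longrightarrow> v = (0\<^sub>v n :: real vec)"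
  using conjugate_square_eq_0_vec[of v n] by simp

text \<open>By the first variation a minimiser of \<open>\<parallel>M y\<parallel>\<^sup>2\<close> over the unit sphere is an eigenvector of
  \<open>M\<^sup>T M\<close>, and the minimum is its eigenvalue.\<close>

lemma min_eigenvector:
  fixes M :: "real mat"
  assumes M: "M \<in> carrier_mat m r" and r: "0 < r"
  obtains y \<mu> where "y \<in> carrier_vec r" "y \<bullet> y = 1" "transpose_mat M *\<^sub>v (M *\<^sub>v y) = \<mu> \<cdot>\<^sub>v y"
    "\<And>z. z \<in> carrier_vec r \<Longrightarrow> \<mu> * (z \<bullet> z) \<le> (M *\<^sub>v z) \<bullet> (M *\<^sub>v z)"
proof -
  define q where "q x = (\<Sum>i<m. (\<Sum>j<r. M $$ (i,j) * x j)\<^sup>2)" for x :: "nat \<Rightarrow> real"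
  have q: "(M *\<^sub>v z) \<bullet> (M *\<^sub>v z) = q (vec_index z)" if "z \<in> carrier_vec r" for z
    using M that by (simp add: q_def scalar_prod_def atLeast0LessThan power2_eq_square)
  have n: "z \<bullet> z = (\<Sum>i<r. (vec_index z i)\<^sup>2)" if "z \<in> carrier_vec r" for z :: "real vec"
    using that by (simp add: scalar_prod_def atLeast0LessThan power2_eq_square)
  obtain y0 where y0: "(\<Sum>i<r. (y0 i)\<^sup>2) = 1" and min: "\<And>z. (\<Sum>i<r. (z i)\<^sup>2) = 1 \<Longrightarrow> q y0 \<le> q z"
  proof -
    have "0 \<le> q x" for x by (auto simp: q_def intro!: sum_nonneg)
    moreover have "(\<lambda>t. q (x t)) \<longlonglongrightarrow> q y" if "\<And>i. i < r \<Longrightarrow> (\<lambda>t::nat. x t i) \<longlonglongrightarrow> y i" for x y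
      unfolding q_def using that by (intro tendsto_sum tendsto_power tendsto_mult tendsto_const) auto
    ultimately show ?thesis using that attains_minimum_on_sphere[OF r, of q] by blast
  qed
  define y where "y = Matrix.vec r y0"
  have y: "y \<in> carrier_vec r" by (simp add: y_def)
  have yy: "y \<bullet> y = 1" unfolding n[OF y] using y0 by (simp add: y_def)
  define \<mu> where "\<mu> = (M *\<^sub>v y) \<bullet> (M *\<^sub>v y)"
  have \<mu>: "\<mu> = q y0" unfolding \<mu>_def q[OF y] by (auto simp: q_def y_def intro!: sum.cong)
  have ge: "\<mu> * (z \<bullet> z) \<le> (M *\<^sub>v z) \<bullet> (M *\<^sub>v z)" if z: "z \<in> carrier_vec r" for z
  proof (cases "z \<bullet> z = 0")
    case True
    then show ?thesis using scalar_prod_self_nonneg by simp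
  next
    case False
    define s where "s = sqrt (z \<bullet> z)"
    have s: "s > 0" "s\<^sup>2 = z \<bullet> z" using False scalar_prod_self_nonneg[of z] by (auto simp: s_def)
    have "(\<Sum>i<r. (vec_index z i / s)\<^sup>2) = 1"
      using s False by (simp add: power_divide n[OF z] flip: sum_divide_distrib)
    from min[OF this] have "\<mu> \<le> q (\<lambda>i. vec_index z i / s)" by (simp add: \<mu>)
    also have "\<dots> = q (vec_index z) / s\<^sup>2"
    proof -
      have "(\<Sum>j<r. M $$ (i,j) * (vec_index z j / s)) = (\<Sum>j<r. M $$ (i,j) * vec_index z j) / s" for i
        by (simp add: sum_divide_distrib)
      then show ?thesis unfolding q_def by (simp only: power_divide flip: sum_divide_distrib)
    qed
    finally have "\<mu> \<le> q (vec_index z) / (z \<bullet> z)" by (simp add: s(2))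
    moreover have "0 < z \<bullet> z" using s by (metis zero_less_power)
    ultimately show ?thesis by (simp add: pos_le_divide_eq q[OF z])
  qed
  \<comment> \<open>the residual of the eigenvalue equation serves as the direction of the variation\<close>
  define w where "w = transpose_mat M *\<^sub>v (M *\<^sub>v y) - \<mu> \<cdot>\<^sub>v y"
  have w: "w \<in> carrier_vec r" using M y by (simp add: w_def)
  have My: "M *\<^sub>v y \<in> carrier_vec m" and Mw: "M *\<^sub>v w \<in> carrier_vec m" using M y w by auto
  have b: "(M *\<^sub>v y) \<bullet> (M *\<^sub>v w) - \<mu> * (y \<bullet> w) = 0"
  proof (rule linear_coefficient_zero)
    fix t :: real
    let ?z = "y + t \<cdot>\<^sub>v w"
    have tw: "t \<cdot>\<^sub>v w \<in> carrier_vec r" and tMw: "t \<cdot>\<^sub>v (M *\<^sub>v w) \<in> carrier_vec m" using w Mw by auto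
    have z: "?z \<in> carrier_vec r" using y w by simp
    have Mz: "M *\<^sub>v ?z = M *\<^sub>v y + t \<cdot>\<^sub>v (M *\<^sub>v w)"
      using M y w tw by (simp add: mult_add_distrib_mat_vec mult_mat_vec)
    have "(M *\<^sub>v ?z) \<bullet> (M *\<^sub>v ?z) = \<mu> + 2 * t * ((M *\<^sub>v y) \<bullet> (M *\<^sub>v w)) + t\<^sup>2 * ((M *\<^sub>v w) \<bullet> (M *\<^sub>v w))"
      unfolding Mz using My Mw tMw comm_scalar_prod[OF My Mw]
      by (simp add: add_scalar_prod_distrib[of _ m] scalar_prod_add_distrib[of _ m] \<mu>_def power2_eq_square algebra_simps)
    moreover have "?z \<bullet> ?z = 1 + 2 * t * (y \<bullet> w) + t\<^sup>2 * (w \<bullet> w)"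
      using y w tw yy comm_scalar_prod[OF y w]
      by (simp add: add_scalar_prod_distrib[of _ r] scalar_prod_add_distrib[of _ r] power2_eq_square algebra_simps)
    ultimately show "0 \<le> 2 * t * ((M *\<^sub>v y) \<bullet> (M *\<^sub>v w) - \<mu> * (y \<bullet> w)) +
        t\<^sup>2 * ((M *\<^sub>v w) \<bullet> (M *\<^sub>v w) - \<mu> * (w \<bullet> w))"
      using ge[OF z] by (simp add: algebra_simps)
  qed
  have MMy: "transpose_mat M *\<^sub>v (M *\<^sub>v y) \<in> carrier_vec r" and \<mu>y: "\<mu> \<cdot>\<^sub>v y \<in> carrier_vec r" using M y by auto
  have "w \<bullet> w = (transpose_mat M *\<^sub>v (M *\<^sub>v y)) \<bullet> w - (\<mu> \<cdot>\<^sub>v y) \<bullet> w"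
    by (subst (1) w_def) (rule minus_scalar_prod_distrib[OF MMy \<mu>y w])
  also have "\<dots> = 0" using b transpose_vec_mult_scalar[OF M w My] y w by simp
  finally have "w = 0\<^sub>v r" by (rule scalar_prod_self_zero[OF w])
  have "transpose_mat M *\<^sub>v (M *\<^sub>v y) = \<mu> \<cdot>\<^sub>v y"
  proof (rule eq_vecI)
    fix i assume i: "i < dim_vec (\<mu> \<cdot>\<^sub>v y)"
    then have "vec_index w i = vec_index (transpose_mat M *\<^sub>v (M *\<^sub>v y)) i - vec_index (\<mu> \<cdot>\<^sub>v y) i"
      unfolding w_def by (intro index_minus_vec) auto
    moreover have "vec_index w i = 0" using \<open>w = 0\<^sub>v r\<close> i y by simp
    ultimately show "vec_index (transpose_mat M *\<^sub>v (M *\<^sub>v y)) i = vec_index (\<mu> \<cdot>\<^sub>v y) i" by simp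
  qed (use M y in simp)
  with that y yy ge show thesis by blast
qed

lemma wide_matrix_kernel:
  fixes K :: "real mat"
  assumes K: "K \<in> carrier_mat s r" and sr: "s < r"
  obtains w where "w \<in> carrier_vec r" "w \<noteq> 0\<^sub>v r" "K *\<^sub>v w = 0\<^sub>v s"
proof -
  \<comment> \<open>a square matrix with rows of zeros below those of \<open>K\<close>\<close>
  define K' where "K' = Matrix.mat r r (\<lambda>(i,j). if i < s then K $$ (i,j) else 0)"
  have K': "K' \<in> carrier_mat r r" by (simp add: K'_def)
  have "transpose_mat K' *\<^sub>v unit_vec r s = col (transpose_mat K') s" using K' sr by (intro mult_unit_vec) auto
  also have "\<dots> = 0\<^sub>v r" using sr by (intro eq_vecI) (auto simp: K'_def)
  finally have ker: "transpose_mat K' *\<^sub>v unit_vec r s = 0\<^sub>v r" .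
  have KT: "transpose_mat K' \<in> carrier_mat r r" using K' by simp
  have "det (transpose_mat K') = 0"
    unfolding det_0_iff_vec_prod_zero_field[OF KT]
    using ker unit_vec_nonzero[OF sr] unit_vec_carrier[of r s] by blast
  then have "det K' = 0" using det_transpose[OF K'] by simp
  then obtain w where w: "w \<in> carrier_vec r" "w \<noteq> 0\<^sub>v r" "K' *\<^sub>v w = 0\<^sub>v r"
    using det_0_iff_vec_prod_zero_field[OF K'] by blast
  have "K *\<^sub>v w = 0\<^sub>v s"
  proof (rule eq_vecI)
    fix i assume i: "i < dim_vec (0\<^sub>v s)"
    have "vec_index (K' *\<^sub>v w) i = vec_index (K *\<^sub>v w) i"
      using i sr K w(1) by (auto simp: K'_def scalar_prod_def intro!: sum.cong)
    with w(3) i sr show "vec_index (K *\<^sub>v w) i = vec_index (0\<^sub>v s) i" by simp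
  qed (use K in simp)
  with w that show thesis by blast
qed

lemma mult_vec_le_frobenius:
  assumes D: "D \<in> carrier_mat n m" and x: "x \<in> carrier_vec n"
  shows "(transpose_mat D *\<^sub>v x) \<bullet> (transpose_mat D *\<^sub>v x) \<le> minner D D * (x \<bullet> x)"
proof -
  have "(transpose_mat D *\<^sub>v x) \<bullet> (transpose_mat D *\<^sub>v x) = (\<Sum>j<m. (\<Sum>i<n. D $$ (i,j) * vec_index x i)\<^sup>2)"
    using D x by (simp add: scalar_prod_def atLeast0LessThan power2_eq_square)
  also have "\<dots> \<le> (\<Sum>j<m. (\<Sum>i<n. (D $$ (i,j))\<^sup>2) * (\<Sum>i<n. (vec_index x i)\<^sup>2))"
    by (intro sum_mono Cauchy_Schwarz_ineq_sum)
  also have "\<dots> = minner D D * (x \<bullet> x)"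
    using D x unfolding minner_def
    by (subst sum.swap) (simp add: scalar_prod_def atLeast0LessThan power2_eq_square sum_distrib_right)
  finally show ?thesis .
qed

lemma finite_eigenvalues:
  fixes A :: "real mat"
  assumes A: "A \<in> carrier_mat n n"
  shows "finite {\<mu>. eigenvalue A \<mu>}"
proof -
  have "monic (char_poly A)" using degree_monic_char_poly[OF A] by simp
  then have "char_poly A \<noteq> 0" by auto
  then show ?thesis unfolding eigenvalue_root_char_poly[OF A] by (rule poly_roots_finite)
qed

text \<open>The distance to the matrices of smaller rank is at least the smallest nonzero singular value. On
  the range of \<open>A\<close> the smallest value \<open>\<sigma>\<close> of \<open>\<parallel>A\<^sup>T x\<parallel>\<close> over unit vectors is a singular value, it is
  positive, and for \<open>B\<close> of smaller rank some vector of the range of \<open>A\<close> is mapped to \<open>0\<close> by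
  \<open>B\<^sup>T\<close>.\<close>

lemma rank_gap:
  assumes A: "A \<in> carrier_mat n m" and pos: "0 < mat_rank A"
  shows "\<exists>\<sigma>>0. sigma_min A \<le> \<sigma> \<and>
    (\<forall>B \<in> carrier_mat n m. mat_rank B < mat_rank A \<longrightarrow> \<sigma> \<le> frobenius_norm (A - B))"
proof -
  obtain U C where U: "U \<in> stiefel (mat_rank A) n" and C: "C \<in> carrier_mat m (mat_rank A)"
    and UC: "U = A * C" and UA: "U * transpose_mat U * A = A"
    using exists_column_space_basis[OF A] .
  define r where "r = mat_rank A"
  have Uc: "U \<in> carrier_mat n r" using U by (auto simp: r_def)
  have r: "0 < r" using pos by (simp add: r_def)
  define M where "M = transpose_mat A * U"
  have M: "M \<in> carrier_mat m r" using A Uc by (auto simp: M_def)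
  obtain y \<mu> where y: "y \<in> carrier_vec r" "y \<bullet> y = 1" and ev: "transpose_mat M *\<^sub>v (M *\<^sub>v y) = \<mu> \<cdot>\<^sub>v y"
    and min: "\<And>z. z \<in> carrier_vec r \<Longrightarrow> \<mu> * (z \<bullet> z) \<le> (M *\<^sub>v z) \<bullet> (M *\<^sub>v z)"
    using min_eigenvector[OF M r] by blast
  define x where "x = M *\<^sub>v y"
  have x: "x \<in> carrier_vec m" using M y by (simp add: x_def)
  have MT: "transpose_mat M = transpose_mat U * A"
    using A Uc transpose_mult[of "transpose_mat A" m n U r] by (simp add: M_def)
  have "A *\<^sub>v x = U * transpose_mat U * A *\<^sub>v x" by (simp add: UA)
  also have "\<dots> = U *\<^sub>v (transpose_mat M *\<^sub>v x)"
    using A Uc x by (simp add: MT mat_vec_assoc)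
  also have "\<dots> = \<mu> \<cdot>\<^sub>v (U *\<^sub>v y)" using Uc y by (simp add: x_def ev mult_mat_vec)
  finally have Ax: "A *\<^sub>v x = \<mu> \<cdot>\<^sub>v (U *\<^sub>v y)" .
  have Uy: "U *\<^sub>v y \<in> carrier_vec n" using Uc y by auto
  have "transpose_mat A * A *\<^sub>v x = transpose_mat A *\<^sub>v (A *\<^sub>v x)" using A x by (simp add: mat_vec_assoc)
  also have "\<dots> = \<mu> \<cdot>\<^sub>v (transpose_mat A *\<^sub>v (U *\<^sub>v y))" using A Uy by (simp add: Ax mult_mat_vec)
  also have "transpose_mat A *\<^sub>v (U *\<^sub>v y) = x" using A Uc y by (simp add: x_def M_def mat_vec_assoc)
  finally have eig: "transpose_mat A * A *\<^sub>v x = \<mu> \<cdot>\<^sub>v x" .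
  have x0: "x \<noteq> 0\<^sub>v m"
  proof
    assume "x = 0\<^sub>v m"
    have "y = (transpose_mat U * U) *\<^sub>v y" using stiefel_left_inverse[OF U] y by (simp add: r_def)
    also have "transpose_mat U * U = transpose_mat C * M"
      using A C Uc by (subst UC) (simp add: M_def transpose_mult[OF A C] mat_assoc)
    also have "(transpose_mat C * M) *\<^sub>v y = transpose_mat C *\<^sub>v x"
      using C M y by (simp add: x_def r_def mat_vec_assoc)
    also have "\<dots> = 0\<^sub>v r" using C \<open>x = 0\<^sub>v m\<close> by (auto simp: r_def)
    finally have "y = 0\<^sub>v r" .
    with y(2) show False by simp
  qed
  have xx: "x \<bullet> x = \<mu>"
  proof -
    have "x \<bullet> x = (transpose_mat M *\<^sub>v x) \<bullet> y"
      using transpose_vec_mult_scalar[OF M y(1) x] by (simp add: x_def)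
    also have "\<dots> = \<mu>" using y by (simp add: x_def ev)
    finally show ?thesis .
  qed
  have \<mu>: "\<mu> > 0" using xx x0 scalar_prod_self_nonneg[of x] scalar_prod_self_zero[OF x] by fastforce
  have AA: "transpose_mat A * A \<in> carrier_mat m m" using A by auto
  have "eigenvalue (transpose_mat A * A) \<mu>"
    unfolding eigenvalue_def eigenvector_def using eig x x0 A by (intro exI[of _ x]) auto
  then have "sqrt \<mu> \<in> {sqrt \<mu> | \<mu>. eigenvalue (transpose_mat A * A) \<mu> \<and> \<mu> \<noteq> 0}" using \<mu> by blast
  moreover have "finite {sqrt \<mu> | \<mu>. eigenvalue (transpose_mat A * A) \<mu> \<and> \<mu> \<noteq> 0}"
    by (rule finite_subset[OF _ finite_imageI[OF finite_eigenvalues[OF AA], of sqrt]]) auto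
  ultimately have le: "sigma_min A \<le> sqrt \<mu>" unfolding sigma_min_def by (intro Min_le)
  have "sqrt \<mu> \<le> frobenius_norm (A - B)" if B: "B \<in> carrier_mat n m" and lt: "mat_rank B < mat_rank A" for B
  proof -
  obtain W where W: "W \<in> stiefel (mat_rank B) n" and WB: "W * transpose_mat W * B = B"
    using exists_column_space_basis[OF B] by blast
  have Wc: "W \<in> carrier_mat n (mat_rank B)" using W by auto
  obtain w where w: "w \<in> carrier_vec r" "w \<noteq> 0\<^sub>v r" and Ww: "(transpose_mat W * U) *\<^sub>v w = 0\<^sub>v (mat_rank B)"
    using wide_matrix_kernel[of "transpose_mat W * U" "mat_rank B" r] Wc Uc lt by (auto simp: r_def)
  have Uw: "U *\<^sub>v w \<in> carrier_vec n" using Uc w by auto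
  have BT: "transpose_mat B = transpose_mat B * W * transpose_mat W"
  proof -
    have WW: "W * transpose_mat W \<in> carrier_mat n n" using Wc by auto
    have "transpose_mat B = transpose_mat B * transpose_mat (W * transpose_mat W)"
      using transpose_mult[OF WW B] by (simp add: WB)
    then show ?thesis using B Wc proj_mat_symmetric[of W] by (simp add: proj_mat_def mat_assoc)
  qed
  have "transpose_mat B *\<^sub>v (U *\<^sub>v w) = transpose_mat B * W *\<^sub>v ((transpose_mat W * U) *\<^sub>v w)"
    using B Wc Uc w Uw by (subst BT) (simp add: mat_vec_assoc)
  also have "\<dots> = transpose_mat B *\<^sub>v (W *\<^sub>v 0\<^sub>v (mat_rank B))"
    unfolding Ww using B Wc by (intro mat_vec_assoc) auto
  also have "W *\<^sub>v 0\<^sub>v (mat_rank B) = 0\<^sub>v n"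
    using Wc by (intro eq_vecI) (auto intro: scalar_prod_right_zero)
  also have "transpose_mat B *\<^sub>v 0\<^sub>v n = 0\<^sub>v m"
    using B by (intro eq_vecI) (auto intro: scalar_prod_right_zero)
  finally have Bw: "transpose_mat B *\<^sub>v (U *\<^sub>v w) = 0\<^sub>v m" .
  have "transpose_mat (A - B) *\<^sub>v (U *\<^sub>v w) = transpose_mat A *\<^sub>v (U *\<^sub>v w) - transpose_mat B *\<^sub>v (U *\<^sub>v w)"
    using A B Uw by (simp add: transpose_minus[OF A B] minus_mult_distrib_mat_vec[of _ m n])
  also have "\<dots> = M *\<^sub>v w" using A Uc w M by (simp add: Bw M_def mat_vec_assoc)
  finally have Dw: "transpose_mat (A - B) *\<^sub>v (U *\<^sub>v w) = M *\<^sub>v w" .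
  have "(U *\<^sub>v w) \<bullet> (U *\<^sub>v w) = (transpose_mat U *\<^sub>v (U *\<^sub>v w)) \<bullet> w"
    using transpose_vec_mult_scalar[OF Uc w(1) Uw] by simp
  also have "transpose_mat U *\<^sub>v (U *\<^sub>v w) = w"
    using Uc w stiefel_left_inverse[OF U] by (simp add: r_def flip: mat_vec_assoc)
  finally have nw: "(U *\<^sub>v w) \<bullet> (U *\<^sub>v w) = w \<bullet> w" .
  have "\<mu> * (w \<bullet> w) \<le> (M *\<^sub>v w) \<bullet> (M *\<^sub>v w)" by (rule min[OF w(1)])
  also have "\<dots> \<le> minner (A - B) (A - B) * (w \<bullet> w)"
    using mult_vec_le_frobenius[OF minus_carrier_mat[OF B] Uw, of A] by (simp only: Dw nw)
  finally have "\<mu> * (w \<bullet> w) \<le> minner (A - B) (A - B) * (w \<bullet> w)" .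
  moreover have "w \<bullet> w > 0" using w scalar_prod_self_nonneg[of w] scalar_prod_self_zero[OF w(1)] by fastforce
  ultimately have "\<mu> \<le> minner (A - B) (A - B)" by simp
  then show ?thesis by (simp add: frobenius_norm_minner)
  qed
  with le \<mu> show ?thesis by (intro exI[of _ "sqrt \<mu>"]) simp
qed

section \<open>Ranks near a limit point\<close>

text \<open>A smaller rank would force a distance of at least the gap of \<open>rank_gap\<close>.\<close>

lemma mrank_lower_semicontinuous:
  assumes L: "L \<in> tspace ns"
  obtains \<delta> where "\<delta> > 0"
    "\<And>X k. X \<in> tspace ns \<Longrightarrow> norm (X - L) < \<delta> \<Longrightarrow> k < length ns \<Longrightarrow> mrank ns k L \<le> mrank ns k X"
proof -
  have "\<exists>\<delta>>0. \<forall>X \<in> tspace ns. norm (X - L) < \<delta> \<longrightarrow> mrank ns k L \<le> mrank ns k X" if k: "k < length ns" for k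
  proof (cases "mrank ns k L = 0")
    case True
    then show ?thesis by (intro exI[of _ 1]) simp
  next
    case False
    let ?u = "unfolding_mat ns k"
    have uc: "?u X \<in> carrier_mat (ns ! k) (nminus ns k)" for X by (rule carrier_matI) auto
    obtain \<sigma> where \<sigma>: "\<sigma> > 0"
      and gap: "\<And>B. B \<in> carrier_mat (ns ! k) (nminus ns k) \<Longrightarrow> mat_rank B < mrank ns k L \<Longrightarrow> \<sigma> \<le> frobenius_norm (?u L - B)"
      using rank_gap[OF uc[of L]] False by blast
    have "mrank ns k L \<le> mrank ns k X" if X: "X \<in> tspace ns" "norm (X - L) < \<sigma>" for X
    proof (rule ccontr)
      assume "\<not> mrank ns k L \<le> mrank ns k X"
      then have "\<sigma> \<le> frobenius_norm (?u L - ?u X)" using gap[OF uc[of X]] by simp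
      also have "\<dots> = norm (X - L)"
        using norm_unfolding[OF tspace_diff[OF L X(1)] k] by (simp add: unfolding_mat_diff norm_minus_commute)
      finally show False using X(2) by simp
    qed
    with \<sigma> show ?thesis by blast
  qed
  then obtain d where d: "\<And>k. k < length ns \<Longrightarrow> d k > 0 \<and>
    (\<forall>X \<in> tspace ns. norm (X - L) < d k \<longrightarrow> mrank ns k L \<le> mrank ns k X)" by metis
  define \<delta> where "\<delta> = Min (insert 1 (d ` {..<length ns}))"
  have "\<delta> > 0" unfolding \<delta>_def using d by (subst Min_gr_iff) auto
  moreover have "\<delta> \<le> d k" if "k < length ns" for k unfolding \<delta>_def using that by (intro Min_le) auto
  ultimately show thesis using that d by (meson less_le_trans)
qed

lemma mat_rank_zero: "mat_rank (0\<^sub>m n m) = 0"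
  unfolding mat_rank_def by (simp add: vec_space.rank_0I)

lemma rank_in_candidates: "mat_rank A \<in> rank_candidates \<Delta> A"
  using mat_rank_zero[of "dim_row A" "dim_col A"] by (auto simp: rank_candidates_def)

text \<open>In the modes in which the limit \<open>L\<close> is rank deficient a candidate of deficient rank is available:
  either \<open>X\<close> is already deficient, or its smallest singular value is at most the distance to \<open>L\<close>.\<close>

lemma good_candidate:
  assumes len: "length rs = length ns" and X: "X \<in> tucker_variety ns rs" and L: "L \<in> tspace ns"
    and near: "norm (X - L) \<le> \<Delta>" and le: "\<And>k. k < length ns \<Longrightarrow> mrank ns k L \<le> mrank ns k X"
  obtains qs where "qs \<in> tucker_rank_candidates ns \<Delta> X"
    "\<And>k. k < length ns \<Longrightarrow> mrank ns k L \<le> qs ! k"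
    "\<And>k. k < length ns \<Longrightarrow> mrank ns k L < rs ! k \<Longrightarrow> qs ! k < rs ! k"
proof -
  have Xs: "X \<in> tspace ns" and Xr: "\<And>k. k < length ns \<Longrightarrow> mrank ns k X \<le> rs ! k"
    using X len by (auto simp: tucker_variety_iff)
  define q where "q k = (if mrank ns k L < rs ! k \<and> mrank ns k X = rs ! k then rs ! k - 1 else mrank ns k X)" for k
  have "q k \<in> rank_candidates \<Delta> (unfolding_mat ns k X)" if k: "k < length ns" for k
  proof (cases "mrank ns k L < rs ! k \<and> mrank ns k X = rs ! k")
    case False
    then show ?thesis using rank_in_candidates by (simp only: q_def if_False)
  next
    case True
    let ?u = "unfolding_mat ns k"
    have uc: "?u X \<in> carrier_mat (ns ! k) (nminus ns k)" for X by (rule carrier_matI) auto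
    have "0 < mrank ns k X" using True by linarith
    from rank_gap[OF uc this] uc[of L] True
    have "sigma_min (?u X) \<le> frobenius_norm (?u X - ?u L)" by (metis order_trans)
    also have "\<dots> = norm (X - L)"
      using norm_unfolding[OF tspace_diff[OF Xs L] k] by (simp add: unfolding_mat_diff)
    finally have "sigma_min (?u X) \<le> \<Delta>" using near by simp
    moreover have "?u X \<noteq> 0\<^sub>m (ns ! k) (nminus ns k)"
      using \<open>0 < mrank ns k X\<close> mat_rank_zero by (metis less_irrefl)
    ultimately show ?thesis using True by (simp add: rank_candidates_def q_def)
  qed
  then have "map q [0..<length ns] \<in> tucker_rank_candidates ns \<Delta> X"
    by (simp add: tucker_rank_candidates_def)
  moreover have "mrank ns k L \<le> q k" if "k < length ns" for k using le[OF that] by (auto simp: q_def)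
  moreover have "q k < rs ! k" if "k < length ns" "mrank ns k L < rs ! k" for k
    using that Xr[OF that(1)] by (auto simp: q_def)
  ultimately show thesis using that[of "map q [0..<length ns]"] by simp
qed

lemma norm_acts_filter_le:
  assumes "distinct ks" "\<And>k. k \<in> set ks \<Longrightarrow> transpose_mat (P k) = P k \<and> P k * P k = P k"
  shows "norm (acts P ks A) \<le> norm (acts P (filter Q ks) A)"
  using assms
proof (induction ks arbitrary: A)
  case (Cons k ks)
  show ?case
  proof (cases "Q k")
    case True
    then show ?thesis using Cons by (simp add: acts_Cons)
  next
    case False
    have "norm (act k (P k) (acts P ks A)) \<le> norm (acts P ks A)"
      using Cons.prems by (intro norm_act_projection) auto
    also have "\<dots> \<le> norm (acts P (filter Q ks) A)" using Cons by auto
    finally show ?thesis using False Cons.prems by (simp add: acts_Cons acts_act_commute)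
  qed
qed simp

section \<open>The descent method\<close>

locale low_rank_problem =
  fixes ns rs :: "nat list" and f :: "tensor \<Rightarrow> real" and g :: "tensor \<Rightarrow> tensor" and sbar \<rho> a :: real
  assumes len: "length rs = length ns"
    and rs: "\<And>k. k < length ns \<Longrightarrow> 0 < rs ! k \<and> rs ! k \<le> min (ns ! k) (nminus ns k)"
    and grad: "\<And>Z. Z \<in> tspace ns \<Longrightarrow> g Z \<in> tspace ns"
    and deriv: "\<And>Z. Z \<in> tspace ns \<Longrightarrow> (f has_derivative (\<lambda>H. inner (g Z) H)) (at Z within tspace ns)"
    and cont: "continuous_on (tspace ns) g"
    and lipschitz: "\<And>Z. Z \<in> tspace ns \<Longrightarrow> \<exists>e>0. \<exists>L. L-lipschitz_on (ball Z e \<inter> tspace ns) g"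
    and sbar: "sbar > 0" and \<rho>: "0 < \<rho>" "\<rho> < 1" and a: "0 < a" "a < 1"
begin

lemma modes_pos: "k < length ns \<Longrightarrow> 0 < min (ns ! k) (nminus ns k)"
  using rs[of k] by linarith

lemma variety_tspace: "Z \<in> tucker_variety ns rs \<Longrightarrow> Z \<in> tspace ns"
  by (simp add: tucker_variety_def)

lemma neg_gradient_tspace: "Z \<in> tucker_variety ns rs \<Longrightarrow> - g Z \<in> tspace ns"
  by (intro tspace_uminus grad variety_tspace)

lemmas direction = hat_proj_properties[OF len modes_pos _ neg_gradient_tspace]

lemma direction_tspace:
  assumes "Z \<in> tucker_variety ns rs" "V \<in> hat_proj ns rs Z (- g Z)"
  shows "V \<in> tspace ns"
proof -
  have "Z + 1 *\<^sub>R V \<in> tspace ns" using direction(2)[OF _ assms(1,1,2), of 1] variety_tspace by blast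
  from tspace_diff[OF this variety_tspace[OF assms(1)]] show ?thesis by simp
qed

lemma mean_value:
  assumes Z: "Z \<in> tspace ns" and V: "V \<in> tspace ns"
  shows "\<exists>\<tau>. 0 < \<tau> \<and> \<tau> < 1 \<and> f (Z + V) - f Z = inner (g (Z + \<tau> *\<^sub>R V)) V"
proof -
  have W: "Z + \<tau> *\<^sub>R V \<in> tspace ns" for \<tau> using Z V by (intro tspace_add tspace_scaleR)
  have d: "((\<lambda>\<tau>. f (Z + \<tau> *\<^sub>R V)) has_real_derivative inner (g (Z + \<tau> *\<^sub>R V)) V) (at \<tau>)" for \<tau>
  proof -
    have "((\<lambda>\<tau>. Z + \<tau> *\<^sub>R V) has_derivative (\<lambda>h. h *\<^sub>R V)) (at \<tau>)"
      by (auto intro!: derivative_eq_intros)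
    moreover have "(f has_derivative (\<lambda>H. inner (g (Z + \<tau> *\<^sub>R V)) H)) (at (Z + \<tau> *\<^sub>R V) within range (\<lambda>\<tau>. Z + \<tau> *\<^sub>R V))"
      by (rule has_derivative_subset[OF deriv[OF W]]) (use W in auto)
    ultimately have "((\<lambda>\<tau>. f (Z + \<tau> *\<^sub>R V)) has_derivative (\<lambda>h. inner (g (Z + \<tau> *\<^sub>R V)) (h *\<^sub>R V))) (at \<tau>)"
      by (rule has_derivative_in_compose)
    then show ?thesis by (simp add: has_field_derivative_def mult.commute[of _ "inner _ _"])
  qed
  obtain \<tau> where "0 < \<tau>" "\<tau> < 1" "f (Z + 1 *\<^sub>R V) - f (Z + 0 *\<^sub>R V) = (1 - 0) * inner (g (Z + \<tau> *\<^sub>R V)) V"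
    using MVT2[of 0 1 "\<lambda>\<tau>. f (Z + \<tau> *\<^sub>R V)" "\<lambda>\<tau>. inner (g (Z + \<tau> *\<^sub>R V)) V"] d by auto
  then show ?thesis by auto
qed

text \<open>The line through \<open>Z\<close> in the direction \<open>V\<close> stays on the variety, so that the retraction by
  truncated HOSVD is trivial.\<close>

lemma sufficient_decrease_iff:
  assumes Z: "Z \<in> tucker_variety ns rs" and V: "V \<in> hat_proj ns rs Z (- g Z)"
  shows "sufficient_decrease ns rs f g a Z V s \<longleftrightarrow> s * a * (norm V)\<^sup>2 \<le> f Z - f (Z + s *\<^sub>R V)"
proof -
  have "Z + s *\<^sub>R V \<in> tucker_variety ns rs" using direction(2)[OF _ Z Z V] by blast
  then have "hosvd ns rs (Z + s *\<^sub>R V) = {Z + s *\<^sub>R V}"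
    using len by (intro hosvd_self) (auto simp: tucker_variety_iff)
  then show ?thesis using direction(1)[OF _ Z Z V] by (simp add: sufficient_decrease_def)
qed

lemma armijo_decrease:
  assumes Z: "Z \<in> tucker_variety ns rs" and V: "V \<in> hat_proj ns rs Z (- g Z)"
    and s: "armijo_stepsize ns rs f g sbar \<rho> a Z V s"
  shows "s * a * (norm V)\<^sup>2 \<le> f Z - f (Z + s *\<^sub>R V)" "0 < s"
proof -
  show "s * a * (norm V)\<^sup>2 \<le> f Z - f (Z + s *\<^sub>R V)"
    using s unfolding armijo_stepsize_def sufficient_decrease_iff[OF Z V] by blast
  show "0 < s" using s sbar \<rho> by (auto simp: armijo_stepsize_def)
qed

text \<open>By the mean value theorem \<open>f\<close> changes by \<open>s\<close> times the slope at an intermediate point, which differs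
  from the slope \<open>- \<parallel>V\<parallel>\<^sup>2\<close> at \<open>Z\<close> by at most \<open>s L \<parallel>V\<parallel>\<^sup>2\<close>.\<close>

lemma small_step_decrease:
  assumes Z: "Z \<in> tucker_variety ns rs" and V: "V \<in> hat_proj ns rs Z (- g Z)"
    and L: "L-lipschitz_on (ball X e \<inter> tspace ns) g" and near: "dist X Z < e / 2"
    and s: "0 < s" "s * norm V \<le> e / 2" "s * L \<le> 1 - a"
  shows "sufficient_decrease ns rs f g a Z V s"
proof -
  have Zs: "Z \<in> tspace ns" and Vs: "V \<in> tspace ns"
    using variety_tspace[OF Z] direction_tspace[OF Z V] by auto
  obtain \<tau> where \<tau>: "0 < \<tau>" "\<tau> < 1"
    and mv: "f (Z + s *\<^sub>R V) - f Z = inner (g (Z + \<tau> *\<^sub>R s *\<^sub>R V)) (s *\<^sub>R V)"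
    using mean_value[OF Zs tspace_scaleR[OF Vs]] by blast
  define W where "W = Z + \<tau> *\<^sub>R s *\<^sub>R V"
  have WZ: "norm (W - Z) = \<tau> * (s * norm V)" using \<tau> s by (simp add: W_def)
  have "\<tau> * (s * norm V) \<le> 1 * (s * norm V)" using \<tau> s by (intro mult_right_mono) auto
  then have WZ': "norm (W - Z) \<le> s * norm V" using WZ by simp
  have "dist X W \<le> dist X Z + dist Z W" by (rule dist_triangle)
  also have "\<dots> < e" using near WZ' s(2) by (simp add: dist_norm norm_minus_commute)
  finally have W: "W \<in> ball X e \<inter> tspace ns"
    using Zs Vs by (simp add: W_def tspace_add tspace_scaleR)
  have "dist X Z < e" using near zero_le_dist[of X Z] by linarith
  then have "Z \<in> ball X e \<inter> tspace ns" using Zs by simp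
  from lipschitz_onD[OF L W this] have "norm (g W - g Z) \<le> L * norm (W - Z)" by (simp add: dist_norm)
  also have "\<dots> \<le> L * (s * norm V)" using WZ' lipschitz_on_nonneg[OF L] by (intro mult_left_mono)
  finally have gW: "norm (g W - g Z) \<le> L * (s * norm V)" .
  have "inner (g W - g Z) V \<le> norm (g W - g Z) * norm V" by (rule norm_cauchy_schwarz)
  also have "\<dots> \<le> L * (s * norm V) * norm V" using gW by (intro mult_right_mono) auto
  also have "\<dots> = (s * L) * (norm V)\<^sup>2" by (simp add: power2_eq_square)
  also have "\<dots> \<le> (1 - a) * (norm V)\<^sup>2" using s(3) by (intro mult_right_mono) auto
  finally have "inner (g W - g Z) V \<le> (1 - a) * (norm V)\<^sup>2" .
  moreover have "inner (- g Z) V = (norm V)\<^sup>2" using direction(1)[OF _ Z Z V] by blast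
  ultimately have "a * (norm V)\<^sup>2 \<le> - inner (g W) V" by (simp add: inner_diff_left algebra_simps)
  then have "s * (a * (norm V)\<^sup>2) \<le> s * - inner (g W) V" using s(1) by (intro mult_left_mono) auto
  then show ?thesis unfolding sufficient_decrease_iff[OF Z V] using mv by (simp add: W_def mult.assoc)
qed

text \<open>Near a point the stepsizes are bounded below, because the directions are bounded and the
  gradient is Lipschitz continuous there.\<close>

lemma uniform_decrease:
  assumes X: "X \<in> tspace ns"
  obtains \<delta> c where "\<delta> > 0" "c > 0"
    "\<And>Z V s. Z \<in> tucker_variety ns rs \<Longrightarrow> norm (Z - X) < \<delta> \<Longrightarrow> V \<in> hat_proj ns rs Z (- g Z) \<Longrightarrow>
      armijo_stepsize ns rs f g sbar \<rho> a Z V s \<Longrightarrow> c * (norm V)\<^sup>2 \<le> f Z - f (Z + s *\<^sub>R V)"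
proof -
  obtain e L where e: "e > 0" and L: "L-lipschitz_on (ball X e \<inter> tspace ns) g"
    using lipschitz[OF X] by blast
  have L0: "L \<ge> 0" by (rule lipschitz_on_nonneg[OF L])
  \<comment> \<open>\<open>b\<close> bounds the directions, and steps up to \<open>s0\<close> stay in the ball and satisfy the Armijo condition\<close>
  define b where "b = norm (g X) + L * e + 1"
  have b: "b > 0" using L0 e by (simp add: b_def add_nonneg_pos)
  define s0 where "s0 = min (e / (2 * b)) ((1 - a) / (L + 1))"
  have s0: "s0 > 0" using e b L0 a by (simp add: s0_def)
  define c where "c = min sbar (\<rho> * s0) * a"
  have c: "c > 0" using sbar s0 \<rho> a by (simp add: c_def)
  have "c * (norm V)\<^sup>2 \<le> f Z - f (Z + s *\<^sub>R V)"
    if Z: "Z \<in> tucker_variety ns rs" and near: "norm (Z - X) < e / 2" and V: "V \<in> hat_proj ns rs Z (- g Z)"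
      and s: "armijo_stepsize ns rs f g sbar \<rho> a Z V s" for Z V s
  proof -
    have near': "dist X Z < e / 2" using near by (simp add: dist_norm norm_minus_commute)
    have "norm V \<le> b"
    proof -
      have "norm V * norm V \<le> norm (- g Z) * norm V"
        using direction(1)[OF _ Z Z V] norm_cauchy_schwarz[of "- g Z" V] by (simp add: power2_eq_square)
      then have "norm V \<le> norm (g Z)" by (cases "norm V = 0") auto
      also have "\<dots> \<le> norm (g X) + norm (g Z - g X)" using norm_triangle_ineq[of "g X" "g Z - g X"] by simp
      also have "norm (g Z - g X) \<le> L * dist Z X"
        using lipschitz_onD[OF L, of Z X] near' e X variety_tspace[OF Z] by (simp add: dist_norm[of "g Z"])
      also have "\<dots> \<le> L * e" using L0 near' zero_le_dist[of Z X]
        unfolding dist_commute[of X Z] by (intro mult_left_mono) linarith+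
      finally show ?thesis by (simp add: b_def)
    qed
    have small: "sufficient_decrease ns rs f g a Z V t" if t: "0 < t" "t \<le> s0" for t
    proof (rule small_step_decrease[OF Z V L near' t(1)])
      have "t * norm V \<le> e / (2 * b) * b"
        using t \<open>norm V \<le> b\<close> b e by (intro mult_mono) (auto simp: s0_def)
      then show "t * norm V \<le> e / 2" using b by simp
      have "t * L \<le> (1 - a) / (L + 1) * (L + 1)" using t L0 a by (intro mult_mono) (auto simp: s0_def)
      then show "t * L \<le> 1 - a" using L0 by simp
    qed
    obtain l where l: "s = \<rho> ^ l * sbar" and fail: "\<And>m. m < l \<Longrightarrow> \<not> sufficient_decrease ns rs f g a Z V (\<rho> ^ m * sbar)"
      using s by (auto simp: armijo_stepsize_def)
    have "min sbar (\<rho> * s0) \<le> s"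
    proof (cases l)
      case (Suc m)
      then have "\<not> \<rho> ^ m * sbar \<le> s0" using fail[of m] small[of "\<rho> ^ m * sbar"] \<rho> sbar by auto
      then have "\<rho> * s0 \<le> \<rho> * (\<rho> ^ m * sbar)" using \<rho> by (intro mult_left_mono) auto
      then show ?thesis using Suc l by (simp add: mult.assoc)
    qed (use l in simp)
    then have "c * (norm V)\<^sup>2 \<le> s * a * (norm V)\<^sup>2"
      unfolding c_def using a by (intro mult_right_mono) auto
    with armijo_decrease(1)[OF Z V s] show ?thesis by linarith
  qed
  with that[of "e / 2" c] e c show thesis by simp
qed

lemma step_properties:
  assumes X: "X \<in> tucker_variety ns rs" and step: "rfgrapr_step ns rs f g \<Delta> sbar \<rho> a X X'"
  shows "X' \<in> tucker_variety ns rs" "f X' \<le> f X"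
    and "qs \<in> tucker_rank_candidates ns \<Delta> X \<Longrightarrow> \<exists>Z \<in> hosvd ns qs X. Z \<in> tucker_variety ns rs \<and>
      (\<exists>V \<in> hat_proj ns rs Z (- g Z). \<exists>s. armijo_stepsize ns rs f g sbar \<rho> a Z V s \<and> f X' \<le> f (Z + s *\<^sub>R V))"
proof -
  have Xs: "X \<in> tspace ns" and Xr: "\<And>k. k < length ns \<Longrightarrow> mrank ns k X \<le> rs ! k"
    using X len by (auto simp: tucker_variety_iff)
  obtain Y where Y: "\<And>qs. qs \<in> tucker_rank_candidates ns \<Delta> X \<Longrightarrow>
        \<exists>Z \<in> hosvd ns qs X. \<exists>V \<in> hat_proj ns rs Z (- g Z). \<exists>s.
               armijo_stepsize ns rs f g sbar \<rho> a Z V s \<and> Y qs = Z + s *\<^sub>R V"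
    and best: "\<exists>qs \<in> tucker_rank_candidates ns \<Delta> X.
             X' = Y qs \<and> (\<forall>ps \<in> tucker_rank_candidates ns \<Delta> X. f (Y qs) \<le> f (Y ps))"
    using step unfolding rfgrapr_step_def by blast
  have ZM: "Z \<in> tucker_variety ns rs" if "qs \<in> tucker_rank_candidates ns \<Delta> X" "Z \<in> hosvd ns qs X" for qs Z
    using hosvd_properties(1,3)[OF Xs that(2)] Xr len by (fastforce simp: tucker_variety_iff intro: order_trans)
  show main: "\<exists>Z \<in> hosvd ns qs X. Z \<in> tucker_variety ns rs \<and>
      (\<exists>V \<in> hat_proj ns rs Z (- g Z). \<exists>s. armijo_stepsize ns rs f g sbar \<rho> a Z V s \<and> f X' \<le> f (Z + s *\<^sub>R V))"
    if qs: "qs \<in> tucker_rank_candidates ns \<Delta> X" for qs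
  proof -
    have "f X' \<le> f (Y qs)" using best qs by auto
    with Y[OF qs] ZM[OF qs] show ?thesis by metis
  qed
  show "X' \<in> tucker_variety ns rs"
  proof -
    obtain qs where qs: "qs \<in> tucker_rank_candidates ns \<Delta> X" "X' = Y qs" using best by blast
    from Y[OF qs(1)] obtain Z V s where Z: "Z \<in> hosvd ns qs X" and V: "V \<in> hat_proj ns rs Z (- g Z)"
      and "Y qs = Z + s *\<^sub>R V" by blast
    with direction(2)[OF _ ZM[OF qs(1) Z] ZM[OF qs(1) Z] V, of s] qs(2) show ?thesis by simp
  qed
  \<comment> \<open>the candidate without any rank reduction\<close>
  have "tucker_rank ns X \<in> tucker_rank_candidates ns \<Delta> X"
    by (simp add: tucker_rank_candidates_def rank_in_candidates)
  from main[OF this] obtain Z V s where "Z \<in> hosvd ns (tucker_rank ns X) X" and ZV: "Z \<in> tucker_variety ns rs"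
      "V \<in> hat_proj ns rs Z (- g Z)" "armijo_stepsize ns rs f g sbar \<rho> a Z V s" and le: "f X' \<le> f (Z + s *\<^sub>R V)"
    by blast
  then have ZX: "Z = X" using hosvd_self[OF Xs, of "tucker_rank ns X"] by simp
  have "0 \<le> s * a * (norm V)\<^sup>2" using armijo_decrease(2)[OF ZV] a by simp
  with armijo_decrease(1)[OF ZV] le have "f X' \<le> f Z" by linarith
  then show "f X' \<le> f X" by (simp add: ZX)
qed

text \<open>Only the deficient modes of \<open>X\<close> have to be deficient at \<open>Z t\<close>: the modes of full rank at \<open>Z t\<close> then
  belong to \<open>K\<close>, and projecting in further modes of \<open>K\<close> does not increase the norm.\<close>

lemma stationary_if_directions_vanish:
  assumes X: "X \<in> tucker_variety ns rs" and Z: "\<And>t. Z t \<in> tucker_variety ns rs" "Z \<longlonglongrightarrow> X"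
    and V: "\<And>t. V t \<in> hat_proj ns rs (Z t) (- g (Z t))" "(\<lambda>t. norm (V t)) \<longlonglongrightarrow> 0"
    and deficient: "\<And>t k. k < length ns \<Longrightarrow> mrank ns k X < rs ! k \<Longrightarrow> mrank ns k (Z t) < rs ! k"
  shows "stationary ns rs g X"
proof -
  define K where "K = filter (\<lambda>k. mrank ns k X = rs ! k) [0..<length ns]"
  define A where "A t = - g (Z t)" for t
  note Zs = variety_tspace[OF Z(1)] and Xs = variety_tspace[OF X]
  have "(\<lambda>t. g (Z t)) \<longlonglongrightarrow> g X"
    using continuous_on_tendsto_compose[OF cont Z(2) Xs] Zs by simp
  then have A: "A \<longlonglongrightarrow> - g X" unfolding A_def by (rule tendsto_minus)
  let ?R = "\<lambda>U k. 1\<^sub>m (ns ! k) - proj_mat (U k)"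
  let ?K = "\<lambda>t. filter (\<lambda>k. mrank ns k (Z t) = rs ! k) [0..<length ns]"
  let ?Q = "\<lambda>t U. (\<forall>k<length ns. U k \<in> stiefel (mrank ns k (Z t)) (ns ! k) \<and> act k (proj_mat (U k)) (Z t) = Z t \<and>
        (\<forall>N \<in> carrier_mat (ns ! k) (ns ! k).
          \<bar>inner (A t) (act k (?R U k * N) (Z t))\<bar> \<le> norm (V t) * norm (act k (?R U k * N) (Z t)))) \<and>
      proj_const ns * norm (acts (\<lambda>k. proj_mat (U k)) (?K t) (A t)) \<le> norm (V t)"
  have "\<exists>U. ?Q t U" for t
    unfolding A_def by (rule direction(3)[OF _ Z(1) Z(1) V(1)])
  then have "\<forall>t. \<exists>U. ?Q t U" by (rule allI)
  from choice[OF this] obtain U where Q: "\<forall>t. ?Q t (U t)" ..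
  have U: "U t k \<in> stiefel (mrank ns k (Z t)) (ns ! k)"
    and PZ: "act k (proj_mat (U t k)) (Z t) = Z t" if "k < length ns" for t k
    using Q[rule_format, of t] that by blast+
  have N: "\<bar>inner (A t) (act k (?R (U t) k * M) (Z t))\<bar> \<le> norm (V t) * norm (act k (?R (U t) k * M) (Z t))"
    if "k < length ns" "M \<in> carrier_mat (ns ! k) (ns ! k)" for t k M
    using Q[rule_format, of t] that by blast
  have T: "proj_const ns * norm (acts (\<lambda>k. proj_mat (U t k)) (?K t) (A t)) \<le> norm (V t)" for t
    using Q[rule_format, of t] by blast
  have cpos: "0 < proj_const ns" using proj_const_le(2)[OF modes_pos, of "{}"] by simp
  show ?thesis
  proof (rule stationary_limit[where U = U and g = g, OF len X K_def Z A U PZ])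
    have bound: "\<forall>t. norm (acts (\<lambda>k. proj_mat (U t k)) K (A t)) \<le> norm (V t) / proj_const ns"
    proof
      fix t
      have "?K t = filter (\<lambda>k. mrank ns k (Z t) = rs ! k) K"
        unfolding K_def filter_filter
        using deficient[of _ t] X len by (intro filter_cong) (fastforce simp: tucker_variety_iff)+
      moreover have "norm (acts (\<lambda>k. proj_mat (U t k)) K (A t)) \<le>
          norm (acts (\<lambda>k. proj_mat (U t k)) (filter (\<lambda>k. mrank ns k (Z t) = rs ! k) K) (A t))"
        by (rule norm_acts_filter_le) (auto simp: K_def proj_mat_symmetric proj_mat_idem[OF U])
      ultimately have "norm (acts (\<lambda>k. proj_mat (U t k)) K (A t)) \<le> norm (acts (\<lambda>k. proj_mat (U t k)) (?K t) (A t))"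
        by simp
      then have "proj_const ns * norm (acts (\<lambda>k. proj_mat (U t k)) K (A t)) \<le>
          proj_const ns * norm (acts (\<lambda>k. proj_mat (U t k)) (?K t) (A t))"
        by (rule mult_left_mono) (rule less_imp_le[OF cpos])
      then have "proj_const ns * norm (acts (\<lambda>k. proj_mat (U t k)) K (A t)) \<le> norm (V t)"
        using T[of t] by (rule order_trans)
      then show "norm (acts (\<lambda>k. proj_mat (U t k)) K (A t)) \<le> norm (V t) / proj_const ns"
        using cpos by (simp add: pos_le_divide_eq mult.commute)
    qed
    show "(\<lambda>t. acts (\<lambda>k. proj_mat (U t k)) K (A t)) \<longlonglongrightarrow> 0"
      by (rule Lim_null_comparison[OF always_eventually[OF bound] tendsto_divide_zero[OF V(2)]])
  next
    fix k and M :: "real mat" assume "k \<in> set K" and M: "M \<in> carrier_mat (ns ! k) (ns ! k)"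
    then have k: "k < length ns" by (simp add: K_def)
    have MZ: "act k M Y \<in> tspace ns" if "Y \<in> tspace ns" for Y using that M by (intro act_tspace_same) auto
    have "entrywise (\<lambda>t. act k M (Z t)) (act k M X)"
      by (rule entrywise_act[OF mat_tendsto_const tendsto_entrywise[OF Z(2)]])
    from entrywise_inner[OF MZ[OF Zs] MZ[OF Xs] this this]
    have "(\<lambda>t. norm (act k M (Z t))) \<longlonglongrightarrow> norm (act k M X)"
      unfolding norm_eq_sqrt_inner by (rule tendsto_real_sqrt)
    from tendsto_mult[OF V(2) this] have lim: "(\<lambda>t. norm (V t) * norm (act k M (Z t))) \<longlonglongrightarrow> 0" by simp
    have bound: "\<forall>t. norm (inner (A t) (act k (?R (U t) k * M) (Z t))) \<le> norm (V t) * norm (act k M (Z t))"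
    proof
      fix t
      note R = proj_perp_properties[OF U[OF k, of t]]
      have "act k (?R (U t) k * M) (Z t) = act k (proj_perp_mat (U t k)) (act k M (Z t))"
        unfolding R(1)[symmetric]
        using act_compose[of "proj_perp_mat (U t k)" M k "Z t"] carrier_matD[OF R(2)] M by simp
      then have "norm (act k (?R (U t) k * M) (Z t)) \<le> norm (act k M (Z t))"
        using norm_act_projection[OF R(3,4)] by simp
      then have "norm (V t) * norm (act k (?R (U t) k * M) (Z t)) \<le> norm (V t) * norm (act k M (Z t))"
        by (rule mult_left_mono) (rule norm_ge_zero)
      with N[OF k M, of t]
      show "norm (inner (A t) (act k (?R (U t) k * M) (Z t))) \<le> norm (V t) * norm (act k M (Z t))"
        unfolding real_norm_def by (rule order_trans)
    qed
    show "(\<lambda>t. inner (A t) (act k ((1\<^sub>m (ns ! k) - proj_mat (U t k)) * M) (Z t))) \<longlonglongrightarrow> 0"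
      by (rule Lim_null_comparison[OF always_eventually[OF bound] lim])
  qed
qed

lemma stationary_if_stopped:
  assumes X: "X \<in> tucker_variety ns rs" and stop: "rfgrapr_stop ns rs g X"
  shows "stationary ns rs g X"
proof -
  obtain V where "V \<in> hat_proj ns rs X (- g X)" "norm V = 0" using stop by (auto simp: rfgrapr_stop_def)
  then show ?thesis
    using X by (intro stationary_if_directions_vanish[of X "\<lambda>_. X" "\<lambda>_. V"]) auto
qed

lemma f_tendsto:
  assumes "X \<in> tspace ns" "\<And>t::nat. Z t \<in> tspace ns" "Z \<longlonglongrightarrow> X"
  shows "(\<lambda>t. f (Z t)) \<longlonglongrightarrow> f X"
proof -
  have "continuous_on (tspace ns) f"
    unfolding continuous_on_eq_continuous_within using has_derivative_continuous[OF deriv] by blast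
  from continuous_on_tendsto_compose[OF this assms(3,1)] assms(2) show ?thesis by simp
qed

text \<open>The values at the iterates decrease to \<open>f L\<close>, and the values at the rank-reduced points converge to
  \<open>f L\<close> as well. So the decrease achieved from these points tends to \<open>0\<close>, and with it their directions.\<close>

lemma limit_point_stationary:
  assumes X: "\<And>t. X t \<in> tucker_variety ns rs" and step: "\<And>t. rfgrapr_step ns rs f g \<Delta> sbar \<rho> a (X t) (X (Suc t))"
    and \<Delta>: "\<Delta> > 0" and L: "L \<in> tucker_variety ns rs" and \<phi>: "strict_mono \<phi>" and lim: "(X \<circ> \<phi>) \<longlonglongrightarrow> L"
  shows "stationary ns rs g L"
proof -
  note Xs = variety_tspace[OF X] and Ls = variety_tspace[OF L]
  have Lr: "\<And>k. k < length ns \<Longrightarrow> mrank ns k L \<le> rs ! k" using L len by (auto simp: tucker_variety_iff)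
  have dec: "decseq (\<lambda>t. f (X t))"
    using step_properties(2)[OF X step] by (simp add: decseq_Suc_iff)
  have fL: "f L \<le> f (X t)" for t
  proof (rule LIMSEQ_le_const2[OF f_tendsto[OF Ls _ lim]])
    show "\<exists>N. \<forall>n\<ge>N. f ((X \<circ> \<phi>) n) \<le> f (X t)"
    proof (intro exI allI impI)
      fix n assume "n \<ge> t"
      then have "t \<le> \<phi> n" using seq_suble[OF \<phi>, of n] by simp
      with dec show "f ((X \<circ> \<phi>) n) \<le> f (X t)" by (simp add: decseq_def)
    qed
  qed (use Xs in simp)
  obtain \<delta> c where \<delta>: "\<delta> > 0" and c: "c > 0" and uniform: "\<And>Z V s. Z \<in> tucker_variety ns rs \<Longrightarrow>
      norm (Z - L) < \<delta> \<Longrightarrow> V \<in> hat_proj ns rs Z (- g Z) \<Longrightarrow> armijo_stepsize ns rs f g sbar \<rho> a Z V s \<Longrightarrow>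
      c * (norm V)\<^sup>2 \<le> f Z - f (Z + s *\<^sub>R V)"
    using uniform_decrease[OF Ls] by blast
  obtain \<delta>' where \<delta>': "\<delta>' > 0"
    and lower: "\<And>X k. X \<in> tspace ns \<Longrightarrow> norm (X - L) < \<delta>' \<Longrightarrow> k < length ns \<Longrightarrow> mrank ns k L \<le> mrank ns k X"
    using mrank_lower_semicontinuous[OF Ls] by blast
  define \<epsilon> where "\<epsilon> = min (min \<delta>' \<Delta>) (\<delta> / 2 ^ length ns)"
  have "\<epsilon> > 0" using \<delta> \<delta>' \<Delta> by (simp add: \<epsilon>_def)
  then obtain N where N: "\<And>t. t \<ge> N \<Longrightarrow> norm (X (\<phi> t) - L) < \<epsilon>"
    using lim by (auto simp: LIMSEQ_iff)
  define W where "W t = X (\<phi> (t + N))" for t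
  have W: "W t \<in> tucker_variety ns rs" "norm (W t - L) < \<epsilon>" for t
    using X N by (simp_all add: W_def)
  have Wlim: "W \<longlonglongrightarrow> L" using LIMSEQ_ignore_initial_segment[OF lim, of N] by (simp add: W_def[abs_def] o_def)
  have "\<exists>Z V. Z \<in> tucker_variety ns rs \<and> norm (Z - L) \<le> 2 ^ length ns * norm (W t - L) \<and>
      V \<in> hat_proj ns rs Z (- g Z) \<and> c * (norm V)\<^sup>2 \<le> f Z - f L \<and>
      (\<forall>k<length ns. mrank ns k L < rs ! k \<longrightarrow> mrank ns k Z < rs ! k)" for t
  proof -
    have Ws: "W t \<in> tspace ns" using variety_tspace[OF W(1)] .
    have "norm (W t - L) \<le> \<Delta>" "norm (W t - L) < \<delta>'" using W(2)[of t] by (auto simp: \<epsilon>_def)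
    then obtain qs where qs: "qs \<in> tucker_rank_candidates ns \<Delta> (W t)"
      and Lq: "\<And>k. k < length ns \<Longrightarrow> mrank ns k L \<le> qs ! k"
      and def: "\<And>k. k < length ns \<Longrightarrow> mrank ns k L < rs ! k \<Longrightarrow> qs ! k < rs ! k"
      using good_candidate[OF len W(1) Ls, of t \<Delta>] lower[OF Ws] by blast
    obtain Z V s where Z: "Z \<in> hosvd ns qs (W t)" and ZM: "Z \<in> tucker_variety ns rs"
      and V: "V \<in> hat_proj ns rs Z (- g Z)" and s: "armijo_stepsize ns rs f g sbar \<rho> a Z V s"
      and le: "f (X (Suc (\<phi> (t + N)))) \<le> f (Z + s *\<^sub>R V)"
      using step_properties(3)[OF X step qs[unfolded W_def]] unfolding W_def by blast
    note h = hosvd_properties[OF Ws Z]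
    have n: "norm (Z - L) \<le> 2 ^ length ns * norm (W t - L)" using h(4)[OF Ls Lq] by blast
    also have "\<dots> < 2 ^ length ns * (\<delta> / 2 ^ length ns)"
      using W(2)[of t] by (intro mult_strict_left_mono) (auto simp: \<epsilon>_def)
    finally have "norm (Z - L) < \<delta>" by simp
    from uniform[OF ZM this V s] have "c * (norm V)\<^sup>2 \<le> f Z - f L"
      using le fL[of "Suc (\<phi> (t + N))"] by linarith
    moreover have "mrank ns k Z < rs ! k" if "k < length ns" "mrank ns k L < rs ! k" for k
      using h(2)[OF that(1)] def[OF that] by simp
    ultimately show ?thesis using ZM n V by blast
  qed
  then obtain Z V where ZM: "\<And>t. Z t \<in> tucker_variety ns rs"
    and n: "\<And>t. norm (Z t - L) \<le> 2 ^ length ns * norm (W t - L)"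
    and V: "\<And>t. V t \<in> hat_proj ns rs (Z t) (- g (Z t))" and d: "\<And>t. c * (norm (V t))\<^sup>2 \<le> f (Z t) - f L"
    and deficient: "\<And>t k. k < length ns \<Longrightarrow> mrank ns k L < rs ! k \<Longrightarrow> mrank ns k (Z t) < rs ! k"
    by metis
  have "(\<lambda>t. 2 ^ length ns * norm (W t - L)) \<longlonglongrightarrow> 2 ^ length ns * norm (L - L)"
    by (intro tendsto_intros Wlim)
  then have "(\<lambda>t. 2 ^ length ns * norm (W t - L)) \<longlonglongrightarrow> 0" by simp
  then have "(\<lambda>t. Z t - L) \<longlonglongrightarrow> 0"
    by (rule Lim_null_comparison[rotated]) (simp add: n always_eventually)
  then have Zlim: "Z \<longlonglongrightarrow> L" by (rule LIM_zero_cancel)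
  have "(\<lambda>t. sqrt ((f (Z t) - f L) / c)) \<longlonglongrightarrow> sqrt ((f L - f L) / c)"
    using c by (intro tendsto_intros f_tendsto[OF Ls variety_tspace[OF ZM] Zlim]) auto
  then have sq: "(\<lambda>t. sqrt ((f (Z t) - f L) / c)) \<longlonglongrightarrow> 0" by simp
  have bound: "norm (norm (V t)) \<le> sqrt ((f (Z t) - f L) / c)" for t
  proof -
    have "norm (V t) \<le> sqrt ((f (Z t) - f L) / c)"
      using d[of t] c by (intro real_le_rsqrt) (simp add: pos_le_divide_eq mult.commute)
    then show ?thesis by simp
  qed
  have "(\<lambda>t. norm (V t)) \<longlonglongrightarrow> 0"
    by (rule Lim_null_comparison[OF always_eventually sq]) (rule allI, rule bound)
  from stationary_if_directions_vanish[OF L ZM Zlim V this deficient] show ?thesis .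
qed

end

theorem theorem5p5:
  fixes ns rs :: "nat list"
    and f :: "tensor \<Rightarrow> real" and g :: "tensor \<Rightarrow> tensor"
    and X :: "nat \<Rightarrow> tensor" and fstar \<Delta> sbar \<rho> a :: real
  assumes "length ns > 0"
    and "\<forall>k<length ns. ns ! k > 0"
    and "length rs = length ns"
    and "\<forall>k<length ns. 0 < rs ! k \<and> rs ! k \<le> min (ns ! k) (nminus ns k)"
    and "\<forall>Z\<in>tspace ns. g Z \<in> tspace ns \<and>
           (f has_derivative (\<lambda>H. inner (g Z) H)) (at Z within tspace ns)"
    and "continuous_on (tspace ns) g"
    and "\<forall>Z\<in>tspace ns. \<exists>e>0. \<exists>L. L-lipschitz_on (ball Z e \<inter> tspace ns) g"
    and "\<forall>Z\<in>tucker_variety ns rs. fstar \<le> f Z"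
    and "\<Delta> > 0" and "sbar > 0" and "0 < \<rho>" and "\<rho> < 1" and "0 < a" and "a < 1"
    and "X 0 \<in> tucker_variety ns rs"
    and "compact {Z \<in> tucker_variety ns rs. f Z \<le> f (X 0)}"
  shows "(\<forall>T. (\<forall>t<T. rfgrapr_step ns rs f g \<Delta> sbar \<rho> a (X t) (X (Suc t))) \<and>
              rfgrapr_stop ns rs g (X T) \<longrightarrow> stationary ns rs g (X T))
       \<and> ((\<forall>t. rfgrapr_step ns rs f g \<Delta> sbar \<rho> a (X t) (X (Suc t))) \<longrightarrow>
            (\<exists>Xs \<phi>. strict_mono \<phi> \<and> (X \<circ> \<phi>) \<longlonglongrightarrow> Xs) \<and>
            (\<forall>Xs \<phi>. strict_mono \<phi> \<and> (X \<circ> \<phi>) \<longlonglongrightarrow> Xs \<longrightarrow> stationary ns rs g Xs))"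
proof -
  interpret low_rank_problem ns rs f g sbar \<rho> a
    by unfold_locales (use assms in auto)
  let ?S = "{Z \<in> tucker_variety ns rs. f Z \<le> f (X 0)}"
  have iterates: "X T \<in> ?S" if "\<forall>t<T. rfgrapr_step ns rs f g \<Delta> sbar \<rho> a (X t) (X (Suc t))" for T
    using that
  proof (induction T)
    case 0
    then show ?case using assms by simp
  next
    case (Suc T)
    then have T: "X T \<in> ?S" and step: "rfgrapr_step ns rs f g \<Delta> sbar \<rho> a (X T) (X (Suc T))" by auto
    then show ?case using step_properties(1,2)[OF _ step] by force
  qed
  have finite_case: "stationary ns rs g (X T)"
    if "\<forall>t<T. rfgrapr_step ns rs f g \<Delta> sbar \<rho> a (X t) (X (Suc t))" "rfgrapr_stop ns rs g (X T)" for T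
    using stationary_if_stopped[OF _ that(2)] iterates[OF that(1)] by blast
  have infinite_case: "(\<exists>Xs \<phi>. strict_mono \<phi> \<and> (X \<circ> \<phi>) \<longlonglongrightarrow> Xs) \<and>
      (\<forall>Xs \<phi>. strict_mono \<phi> \<and> (X \<circ> \<phi>) \<longlonglongrightarrow> Xs \<longrightarrow> stationary ns rs g Xs)"
    if step: "\<forall>t. rfgrapr_step ns rs f g \<Delta> sbar \<rho> a (X t) (X (Suc t))"
  proof (intro conjI allI impI)
    have XS: "\<And>t. X t \<in> ?S" using iterates step by blast
    show "\<exists>Xs \<phi>. strict_mono \<phi> \<and> (X \<circ> \<phi>) \<longlonglongrightarrow> Xs"
      using assms(16) XS unfolding compact_def by metis
    fix Xs \<phi> assume lim: "strict_mono \<phi> \<and> (X \<circ> \<phi>) \<longlonglongrightarrow> Xs"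
    have "Xs \<in> ?S"
      using closed_sequentially[OF compact_imp_closed[OF assms(16)], of "X \<circ> \<phi>" Xs] XS lim by auto
    then show "stationary ns rs g Xs"
      using limit_point_stationary[of X \<Delta> Xs \<phi>] XS step assms(9) lim by blast
  qed
  from finite_case infinite_case show ?thesis by blast
qed

end
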